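(* For every nonzero signed integer $m$ prime to six, the set of classes $h(v)$ of integral tuples $v\in M$ with signed norm product $\prod_jN(v_j)=m$ is exactly $$c(m)+\sum_{q^e\parallel|m|}R_q(e),$$ where the sum is a sumset in $H$ over the primes $q$ dividing $m$, and the empty sum is $\{0\}$. If all costs are at most $w$, each $R_q(e)$ is unchanged when $e$ is replaced by $\min\{e,w(|H|-1)\}$. The description is independent of the chosen prime generators, and it constructs a tuple for each class in the displayed set.
   Context: Let $M=\mathbb Z\times\prod_{j=1}^sO_j$, where each $O_j$ is either $\mathbb Z$ or the ring of integers of a totally imaginary number field of class number one; the first factor $\mathbb Z$ is position $0$. The norm $N$ of a component in $\mathbb Z$ is the component itself, with its sign; on other components $N$ is the absolute field norm to $\mathbb Q$. A tuple in $M$ is prime to six if all its component norms are prime to six. Let $U_+=\{\varepsilon\in M^\times:\prod_jN(\varepsilon_j)=1\}$. Let $h$ be a homomorphism from the multiplicative monoid of tuples in $M$ prime to six to a finite abelian group $H$ (written additively), obtained from finite residue rings (that is, $h$ factors through reduction modulo an ideal of finite index in $M$ modulo which every tuple prime to six is a unit) and killing $U_+$. Write $h_j(a)$ for the value of $h$ on the tuple with $a$ at position $j$ and ones elsewhere, and put $c(m)=h_0(m)$ for signed integers $m$ prime to six. For each prime $q>3$, each position $j>0$ and each prime ideal $\mathfrak q\mid qO_j$, of norm $q^f$, choose an integral generator $\alpha_{\mathfrak q}$ (for a rational position use the generator $q$, with $f=1$) and attach the move $h_j(\alpha_{\mathfrak q})-f\,h_0(q)\in H$, of cost $f$. All prime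 ideals and all component positions $j>0$ are included. $R_q(e)\subseteq H$ is the set of sums of finite sequences of these moves (repetition allowed, including the empty sum $0$) having total cost at most $e$. *)

theory Defs
  imports "HOL-Algebra.Algebra" "HOL-Algebra.Algebraic_Closure_Type" "HOL-Library.Set_Algebras" "HOL-Library.Cardinality"
begin

text \<open>
  Number fields are taken as subfields of the complex numbers (every number field has such a copy).
  A component \<open>\<int>\<close> of \<open>M\<close> is the ring of integers of the field \<open>\<rat>\<close>, so \<open>M\<close> is given by
  the number \<open>s\<close> and a family \<open>K\<close> of fields with \<open>K 0 = \<rat>\<close>; only \<open>K 0, \<dots>, K s\<close> matter.
\<close>

abbreviation complex_ring :: "complex ring" where
  "complex_ring \<equiv> ring_of_type_algebra"

definition number_field :: "complex set \<Rightarrow> bool" where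
  "number_field K \<longleftrightarrow>
     subfield K complex_ring \<and> ring.finite_dimension complex_ring \<rat> K"

definition integers_of :: "complex set \<Rightarrow> complex ring" where
  "integers_of K = complex_ring\<lparr>carrier := {x \<in> K. algebraic_int x}\<rparr>"

text \<open>
  Intersecting with \<^const>\<open>extensional\<close> fixes the values outside \<open>K\<close>, so that each embedding
  occurs exactly once.
\<close>

definition embeddings :: "complex set \<Rightarrow> (complex \<Rightarrow> complex) set" where
  "embeddings K = ring_hom (complex_ring\<lparr>carrier := K\<rparr>) complex_ring \<inter> extensional K"

definition totally_imaginary :: "complex set \<Rightarrow> bool" where
  "totally_imaginary K \<longleftrightarrow> (\<forall>\<sigma>\<in>embeddings K. \<not> \<sigma> ` K \<subseteq> \<real>)"

definition nonzero_ideals :: "complex set \<Rightarrow> complex set set" where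
  "nonzero_ideals K = {I. ideal I (integers_of K) \<and> I \<noteq> {0}}"

definition ideal_class_rel :: "complex set \<Rightarrow> (complex set \<times> complex set) set" where
  "ideal_class_rel K =
     {(I, J). I \<in> nonzero_ideals K \<and> J \<in> nonzero_ideals K \<and>
        (\<exists>a \<in> carrier (integers_of K) - {0}. \<exists>b \<in> carrier (integers_of K) - {0}.
           a <#\<^bsub>integers_of K\<^esub> I = b <#\<^bsub>integers_of K\<^esub> J)}"

definition class_number :: "complex set \<Rightarrow> nat" where
  "class_number K = card (nonzero_ideals K // ideal_class_rel K)"

definition component_fields :: "nat \<Rightarrow> (nat \<Rightarrow> complex set) \<Rightarrow> bool" where
  "component_fields s K \<longleftrightarrow>
     K 0 = \<rat> \<and>
     (\<forall>j\<in>{1..s}. K j = \<rat> \<or>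
        (number_field (K j) \<and> totally_imaginary (K j) \<and> class_number (K j) = 1))"

text \<open>
  The norm to \<open>\<rat>\<close>, as an element of \<^typ>\<open>complex\<close>; on integers of \<open>K\<close> its values lie in \<open>\<int>\<close>.
\<close>

definition comp_norm :: "complex set \<Rightarrow> complex \<Rightarrow> complex" where
  "comp_norm K x = (if K = \<rat> then x else \<Prod>\<sigma>\<in>embeddings K. \<sigma> x)"

definition tuple_ring :: "nat \<Rightarrow> (nat \<Rightarrow> complex set) \<Rightarrow> (nat \<Rightarrow> complex) ring" where
  "tuple_ring s K =
     \<lparr>carrier = (\<Pi>\<^sub>E j\<in>{..s}. carrier (integers_of (K j))),
      monoid.mult = (\<lambda>a b. \<lambda>j\<in>{..s}. a j * b j),
      one = (\<lambda>j\<in>{..s}. 1),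
      ring.zero = (\<lambda>j\<in>{..s}. 0),
      add = (\<lambda>a b. \<lambda>j\<in>{..s}. a j + b j)\<rparr>"

definition norm_tuples :: "nat \<Rightarrow> (nat \<Rightarrow> complex set) \<Rightarrow> int \<Rightarrow> (nat \<Rightarrow> complex) set" where
  "norm_tuples s K m =
     {v \<in> carrier (tuple_ring s K). (\<Prod>j\<le>s. comp_norm (K j) (v j)) = of_int m}"

definition prime_to_six :: "nat \<Rightarrow> (nat \<Rightarrow> complex set) \<Rightarrow> (nat \<Rightarrow> complex) set" where
  "prime_to_six s K =
     {v \<in> carrier (tuple_ring s K).
        \<forall>j\<le>s. \<exists>n::int. comp_norm (K j) (v j) = of_int n \<and> coprime n 6}"

definition U_plus :: "nat \<Rightarrow> (nat \<Rightarrow> complex set) \<Rightarrow> (nat \<Rightarrow> complex) set" where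
  "U_plus s K = {\<epsilon> \<in> Units (tuple_ring s K). (\<Prod>j\<le>s. comp_norm (K j) (\<epsilon> j)) = 1}"

text \<open>
  Only the values of \<open>h\<close> on \<^const>\<open>prime_to_six\<close> are constrained. The third conjunct says that
  \<open>h\<close> factors through reduction modulo an ideal \<open>I\<close> of finite index.
\<close>

definition residue_hom ::
  "nat \<Rightarrow> (nat \<Rightarrow> complex set) \<Rightarrow> ((nat \<Rightarrow> complex) \<Rightarrow> 'h::ab_group_add) \<Rightarrow> bool" where
  "residue_hom s K h \<longleftrightarrow>
     h \<one>\<^bsub>tuple_ring s K\<^esub> = 0 \<and>
     (\<forall>a\<in>prime_to_six s K. \<forall>b\<in>prime_to_six s K. h (a \<otimes>\<^bsub>tuple_ring s K\<^esub> b) = h a + h b) \<and>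
     (\<exists>I g. ideal I (tuple_ring s K) \<and>
        finite (carrier (tuple_ring s K Quot I)) \<and>
        (\<forall>a\<in>prime_to_six s K. I +>\<^bsub>tuple_ring s K\<^esub> a \<in> Units (tuple_ring s K Quot I)) \<and>
        (\<forall>a\<in>prime_to_six s K. h a = g (I +>\<^bsub>tuple_ring s K\<^esub> a))) \<and>
     (\<forall>\<epsilon>\<in>U_plus s K. h \<epsilon> = 0)"

definition at_pos :: "nat \<Rightarrow> ((nat \<Rightarrow> complex) \<Rightarrow> 'h) \<Rightarrow> nat \<Rightarrow> complex \<Rightarrow> 'h" where
  "at_pos s h j a = h (\<lambda>i\<in>{..s}. if i = j then a else 1)"

definition places :: "nat \<Rightarrow> (nat \<Rightarrow> complex set) \<Rightarrow> nat \<Rightarrow> (nat \<times> complex set) set" where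
  "places s K q =
     {(j, Q). j \<in> {1..s} \<and> primeideal Q (integers_of (K j)) \<and>
        PIdl\<^bsub>integers_of (K j)\<^esub> (of_nat q) \<subseteq> Q}"

definition cost :: "(nat \<Rightarrow> complex set) \<Rightarrow> nat \<Rightarrow> nat \<times> complex set \<Rightarrow> nat" where
  "cost K q = (\<lambda>(j, Q). THE f. card (carrier (integers_of (K j) Quot Q)) = q ^ f)"

definition generator_choice ::
  "nat \<Rightarrow> (nat \<Rightarrow> complex set) \<Rightarrow> (nat \<Rightarrow> complex set \<Rightarrow> complex) \<Rightarrow> bool" where
  "generator_choice s K \<alpha> \<longleftrightarrow>
     (\<forall>q::nat. Factorial_Ring.prime q \<and> q > 3 \<longrightarrow> (\<forall>(j, Q)\<in>places s K q.
        \<alpha> j Q \<in> carrier (integers_of (K j)) \<and>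
        Q = PIdl\<^bsub>integers_of (K j)\<^esub> (\<alpha> j Q) \<and>
        (K j = \<rat> \<longrightarrow> \<alpha> j Q = of_nat q)))"

text \<open>In \<open>move\<close> the sum over \<open>{..<f}\<close> is the multiple \<open>f h\<^sub>0(q)\<close> in the group.\<close>

definition move ::
  "nat \<Rightarrow> (nat \<Rightarrow> complex set) \<Rightarrow> ((nat \<Rightarrow> complex) \<Rightarrow> 'h::ab_group_add) \<Rightarrow>
   (nat \<Rightarrow> complex set \<Rightarrow> complex) \<Rightarrow> nat \<Rightarrow> nat \<times> complex set \<Rightarrow> 'h" where
  "move s K h \<alpha> q = (\<lambda>(j, Q).
     at_pos s h j (\<alpha> j Q) - (\<Sum>_<cost K q (j, Q). at_pos s h 0 (of_nat q)))"

definition place_seqs ::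
  "nat \<Rightarrow> (nat \<Rightarrow> complex set) \<Rightarrow> nat \<Rightarrow> nat \<Rightarrow> (nat \<times> complex set) list set" where
  "place_seqs s K q e = {L. set L \<subseteq> places s K q \<and> (\<Sum>p\<leftarrow>L. cost K q p) \<le> e}"

definition reach ::
  "nat \<Rightarrow> (nat \<Rightarrow> complex set) \<Rightarrow> ((nat \<Rightarrow> complex) \<Rightarrow> 'h::ab_group_add) \<Rightarrow>
   (nat \<Rightarrow> complex set \<Rightarrow> complex) \<Rightarrow> nat \<Rightarrow> nat \<Rightarrow> 'h set" where
  "reach s K h \<alpha> q e = {\<Sum>p\<leftarrow>L. move s K h \<alpha> q p | L. L \<in> place_seqs s K q e}"

text \<open>
  The tuple built from one sequence \<open>L q\<close> of moves for each prime \<open>q\<close> dividing \<open>m\<close>: the chosen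
  generators are multiplied together at their positions \<open>j > 0\<close>, and their norms are divided out
  of \<open>m\<close> at position \<open>0\<close>. The integer division is exact when each \<open>L q\<close> has total cost at most
  the exponent of \<open>q\<close> in \<open>m\<close>.
\<close>

definition built_tuple ::
  "nat \<Rightarrow> (nat \<Rightarrow> complex set) \<Rightarrow> (nat \<Rightarrow> complex set \<Rightarrow> complex) \<Rightarrow> int \<Rightarrow>
   (nat \<Rightarrow> (nat \<times> complex set) list) \<Rightarrow> nat \<Rightarrow> complex" where
  "built_tuple s K \<alpha> m L = (\<lambda>j\<in>{..s}.
     if j = 0
     then of_int (m div (\<Prod>q\<in>prime_factors (nat \<bar>m\<bar>). int q ^ (\<Sum>p\<leftarrow>L q. cost K q p)))
     else \<Prod>q\<in>prime_factors (nat \<bar>m\<bar>). \<Prod>(i, Q)\<leftarrow>filter (\<lambda>(i, Q). i = j) (L q). \<alpha> i Q)"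

end

theory Submission
  imports Defs "Jordan_Normal_Form.Char_Poly"
begin

text \<open>
  If \<open>v\<close> has norm product \<open>m\<close>, then every component \<open>v\<^sub>j\<close> with \<open>j > 0\<close> is a unit times a product of the chosen
  generators, because its ring is a principal ideal domain. Each generator lies over a prime \<open>q\<close> dividing \<open>m\<close>,
  and its norm is \<open>q\<^sup>f\<close> with \<open>q\<^sup>f\<close> the size of the residue field. Hence \<open>v\<close> is an element of \<open>U\<^sub>+\<close> times the
  tuple built from these generators with \<open>m\<close> divided by their norms at position \<open>0\<close>; the value of \<open>h\<close> on the
  latter is \<open>c(m)\<close> plus the sum of the moves. Two generators of the same prime have the same norm, so they
  differ by an element of \<open>U\<^sub>+\<close>. For the truncation, a sequence of \<open>|H|\<close> or more moves has two equal partial sums,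
  and the moves in between can be dropped.

  That the norm \<open>\<Prod>\<sigma> x\<close> over the complex embeddings is up to sign the index of \<open>x O\<close> in \<open>O\<close> is reduced by
  multiplicativity to elements \<open>x\<close> with distinct conjugates. For these, \<open>\<int>[x]\<close> has finite index in \<open>O\<close>, and
  \<open>\<int>[x] / (x)\<close> is \<open>\<int> / F(0)\<close>, where \<open>F\<close> is the monic polynomial whose roots are the conjugates of \<open>x\<close>.
\<close>

text \<open>The delicate point is the sign. Position 0 carries a signed norm and \<open>h\<close> is
  only known to kill units of norm product 1, so -1 at position 0 may have a nonzero class and a
  norm known up to sign is not enough. At a totally imaginary position every nonzero element has
  positive norm, and at a rational position the generator is fixed as \<open>q\<close>; in both
  cases a generator has norm exactly \<open>q^f\<close>. Coprimality to six keeps all primes that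
  occur above 3, the range in which generators are chosen.

  Elements with distinct conjugates are singled out because for them the product of the factors X -
  \<sigma> x can be identified, by counting roots, with a characteristic polynomial over the
  rationals. This replaces symmetric functions, Galois closures and integral bases.

  Factorization is driven by the absolute norm as a natural number: it is multiplicative, equals 1
  exactly on units, and lies in the ideal of its element. Descent on it yields prime divisors and
  factorizations.\<close>

section \<open>Subrings of the complex numbers and polynomials over them\<close>

locale complex_subring =
  fixes S :: "complex set"
  assumes zero_mem: "0 \<in> S" and one_mem: "1 \<in> S"
    and add_mem: "\<And>x y. x \<in> S \<Longrightarrow> y \<in> S \<Longrightarrow> x + y \<in> S"
    and uminus_mem: "\<And>x. x \<in> S \<Longrightarrow> - x \<in> S"
    and mult_mem: "\<And>x y. x \<in> S \<Longrightarrow> y \<in> S \<Longrightarrow> x * y \<in> S"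
begin

lemma diff_mem: "x \<in> S \<Longrightarrow> y \<in> S \<Longrightarrow> x - y \<in> S"
  using add_mem[of x "- y"] uminus_mem[of y] by simp

lemma sum_mem: "(\<And>i. i \<in> A \<Longrightarrow> f i \<in> S) \<Longrightarrow> sum f A \<in> S"
  by (induction A rule: infinite_finite_induct) (auto simp: zero_mem add_mem)

lemma prod_mem: "(\<And>i. i \<in> A \<Longrightarrow> f i \<in> S) \<Longrightarrow> prod f A \<in> S"
  by (induction A rule: infinite_finite_induct) (auto simp: one_mem mult_mem)

lemma power_mem: "x \<in> S \<Longrightarrow> x ^ n \<in> S"
  by (induction n) (auto simp: one_mem mult_mem)

lemma of_nat_mem: "of_nat n \<in> S"
  by (induction n) (auto simp: zero_mem one_mem add_mem)

lemma of_int_mem: "of_int n \<in> S"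
  by (cases n rule: int_cases2) (auto simp: of_nat_mem uminus_mem)

lemma Ints_subset: "\<int> \<subseteq> S"
  by (auto elim!: Ints_cases simp: of_int_mem)

end

lemma complex_subring_Ints: "complex_subring \<int>"
  by unfold_locales auto

lemma complex_subring_Rats: "complex_subring \<rat>"
  by unfold_locales auto

text \<open>A subset of the single type \<open>complex poly\<close>: polynomials over the integers,
  the rationals, a number field or the algebraic integers can then be combined and evaluated without
  coercions, and changing the coefficient ring is \<open>polys_over_mono\<close>.\<close>

definition polys_over :: "complex set \<Rightarrow> complex poly set" where
  "polys_over S = {p. \<forall>i. coeff p i \<in> S}"

lemma polys_over_mono: "S \<subseteq> T \<Longrightarrow> polys_over S \<subseteq> polys_over T"
  by (auto simp: polys_over_def)

context complex_subring
begin

lemma pCons_mem: "a \<in> S \<Longrightarrow> p \<in> polys_over S \<Longrightarrow> pCons a p \<in> polys_over S"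
  by (auto simp: polys_over_def coeff_pCons split: nat.splits)

lemma pCons_memD: "pCons a p \<in> polys_over S \<Longrightarrow> a \<in> S \<and> p \<in> polys_over S"
  unfolding polys_over_def mem_Collect_eq
  by (intro conjI allI) (metis coeff_pCons_0, metis coeff_pCons_Suc)

lemma poly_0_mem: "0 \<in> polys_over S"
  by (auto simp: polys_over_def zero_mem)

lemma poly_const_mem: "a \<in> S \<Longrightarrow> [:a:] \<in> polys_over S"
  by (intro pCons_mem poly_0_mem)

lemma poly_1_mem: "1 \<in> polys_over S"
  using poly_const_mem[OF one_mem] by (simp add: one_pCons)

lemma poly_add_mem: "p \<in> polys_over S \<Longrightarrow> q \<in> polys_over S \<Longrightarrow> p + q \<in> polys_over S"
  by (auto simp: polys_over_def add_mem)

lemma poly_uminus_mem: "p \<in> polys_over S \<Longrightarrow> - p \<in> polys_over S"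
  by (auto simp: polys_over_def uminus_mem)

lemma poly_diff_mem: "p \<in> polys_over S \<Longrightarrow> q \<in> polys_over S \<Longrightarrow> p - q \<in> polys_over S"
  by (auto simp: polys_over_def diff_mem)

lemma poly_smult_mem: "a \<in> S \<Longrightarrow> p \<in> polys_over S \<Longrightarrow> Polynomial.smult a p \<in> polys_over S"
  by (auto simp: polys_over_def mult_mem)

lemma poly_mult_mem: "p \<in> polys_over S \<Longrightarrow> q \<in> polys_over S \<Longrightarrow> p * q \<in> polys_over S"
  by (auto simp: polys_over_def coeff_mult intro!: sum_mem mult_mem)

lemma poly_monom_mem: "a \<in> S \<Longrightarrow> Polynomial.monom a n \<in> polys_over S"
  by (auto simp: polys_over_def zero_mem)

lemma poly_sum_mem: "(\<And>i. i \<in> A \<Longrightarrow> f i \<in> polys_over S) \<Longrightarrow> sum f A \<in> polys_over S"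
  by (induction A rule: infinite_finite_induct) (auto simp: poly_0_mem poly_add_mem)

lemma poly_prod_mem: "(\<And>i. i \<in> A \<Longrightarrow> f i \<in> polys_over S) \<Longrightarrow> prod f A \<in> polys_over S"
  by (induction A rule: infinite_finite_induct) (auto simp: poly_1_mem poly_mult_mem)

lemma poly_pderiv_mem: "p \<in> polys_over S \<Longrightarrow> pderiv p \<in> polys_over S"
  by (auto simp: polys_over_def coeff_pderiv of_nat_mem intro!: mult_mem)
    (metis of_nat_Suc of_nat_mem)

lemma poly_eval_mem: "p \<in> polys_over S \<Longrightarrow> x \<in> S \<Longrightarrow> poly p x \<in> S"
  by (auto simp: polys_over_def poly_altdef intro!: sum_mem mult_mem power_mem)

lemma poly_pcompose_mem:
  "p \<in> polys_over S \<Longrightarrow> q \<in> polys_over S \<Longrightarrow> pcompose p q \<in> polys_over S"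
proof (induction p)
  case (pCons a p)
  then show ?case using pCons_memD[of a p]
    by (auto simp: pcompose_pCons intro!: poly_add_mem poly_const_mem poly_mult_mem)
qed (auto simp: poly_0_mem)

end

section \<open>Integral elements\<close>

text \<open>The degree \<open>n\<close> is recorded because the root count behind
  \<open>emb_poly_of_Rats\<close> requires an annihilating polynomial of degree exactly the number
  of embeddings. Over a field the notion is plain algebraicity.\<close>

definition integral_over :: "complex set \<Rightarrow> nat \<Rightarrow> complex \<Rightarrow> bool" where
  "integral_over S n x \<longleftrightarrow>
     (\<exists>p\<in>polys_over S. lead_coeff p = 1 \<and> degree p = n \<and> poly p x = 0)"

lemma algebraic_int_iff_integral_over: "algebraic_int x \<longleftrightarrow> (\<exists>n. integral_over \<int> n x)"
  by (auto simp: algebraic_int.simps integral_over_def polys_over_def)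

definition lin_span :: "complex set \<Rightarrow> ('i \<Rightarrow> complex) \<Rightarrow> 'i set \<Rightarrow> complex set" where
  "lin_span S w I = {\<Sum>i\<in>I. c i * w i | c. \<forall>i\<in>I. c i \<in> S}"

context complex_subring
begin

lemma span_add: "x \<in> lin_span S w I \<Longrightarrow> y \<in> lin_span S w I \<Longrightarrow> x + y \<in> lin_span S w I"
  unfolding lin_span_def
proof clarify
  fix c d assume "\<forall>i\<in>I. c i \<in> S" "\<forall>i\<in>I. d i \<in> S"
  thus "\<exists>e. (\<Sum>i\<in>I. c i * w i) + (\<Sum>i\<in>I. d i * w i) = (\<Sum>i\<in>I. e i * w i) \<and> (\<forall>i\<in>I. e i \<in> S)"
    by (intro exI[of _ "\<lambda>i. c i + d i"]) (auto simp: sum.distrib algebra_simps add_mem)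
qed

lemma span_mult: "a \<in> S \<Longrightarrow> x \<in> lin_span S w I \<Longrightarrow> a * x \<in> lin_span S w I"
  unfolding lin_span_def
proof clarify
  fix c assume "\<forall>i\<in>I. c i \<in> S" "a \<in> S"
  thus "\<exists>e. a * (\<Sum>i\<in>I. c i * w i) = (\<Sum>i\<in>I. e i * w i) \<and> (\<forall>i\<in>I. e i \<in> S)"
    by (intro exI[of _ "\<lambda>i. a * c i"]) (auto simp: sum_distrib_left mult_ac mult_mem)
qed

lemma span_zero: "0 \<in> lin_span S w I"
  unfolding lin_span_def using zero_mem by (auto intro!: exI[of _ "\<lambda>i. 0"])

lemma span_sum: "(\<And>k. k \<in> A \<Longrightarrow> f k \<in> lin_span S w I) \<Longrightarrow> sum f A \<in> lin_span S w I"
  by (induction A rule: infinite_finite_induct) (auto simp: span_zero span_add)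

lemma span_base: "finite I \<Longrightarrow> i \<in> I \<Longrightarrow> w i \<in> lin_span S w I"
  unfolding lin_span_def using zero_mem one_mem
  by (auto intro!: exI[of _ "\<lambda>j. if j = i then 1 else 0"] simp: if_distrib[of "\<lambda>x. x * _"] sum.delta cong: if_cong)

lemma span_stable:
  assumes "\<And>i. i \<in> I \<Longrightarrow> z * w i \<in> lin_span S w I" "x \<in> lin_span S w I"
  shows "z * x \<in> lin_span S w I"
proof -
  from assms(2) obtain c where c: "\<forall>i\<in>I. c i \<in> S" "x = (\<Sum>i\<in>I. c i * w i)"
    by (auto simp: lin_span_def)
  have "z * x = (\<Sum>i\<in>I. c i * (z * w i))"
    by (simp add: c sum_distrib_left mult_ac)
  also have "\<dots> \<in> lin_span S w I"
    by (rule span_sum, rule span_mult) (use c assms(1) in auto)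
  finally show ?thesis .
qed

lemma det_mem:
  assumes "M \<in> carrier_mat n n" "\<And>i j. i < n \<Longrightarrow> j < n \<Longrightarrow> M $$ (i, j) \<in> polys_over S"
  shows "det M \<in> polys_over S"
proof -
  have sgn: "(signof p :: complex poly) \<in> polys_over S" for p :: "nat \<Rightarrow> nat"
    by (cases p rule: sign_cases) (auto simp: poly_1_mem poly_uminus_mem)
  show ?thesis unfolding det_def'[OF assms(1)]
    by (intro poly_sum_mem poly_mult_mem poly_prod_mem sgn assms(2)) (auto dest: permutes_in_image)
qed

text \<open>The determinant trick: the equations make \<open>z\<close> an eigenvalue, with
  eigenvector \<open>w\<close>, of a matrix with entries in \<open>S\<close>, and the characteristic
  polynomial of that matrix is monic of degree \<open>n\<close> over \<open>S\<close>.\<close>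

lemma integral_of_eigenvalue:
  assumes "\<And>i j. i < n \<Longrightarrow> j < n \<Longrightarrow> a i j \<in> S"
    and ev: "\<And>i. i < n \<Longrightarrow> z * w i = (\<Sum>j<n. a i j * w j)" and "r < n" "w r \<noteq> 0"
  shows "integral_over S n z"
proof -
  define A where "A = mat n n (\<lambda>(i, j). a i j)"
  have A: "A \<in> carrier_mat n n" by (simp add: A_def)
  have "A *\<^sub>v vec n w = z \<cdot>\<^sub>v vec n w"
    by (rule eq_vecI) (auto simp: A_def ev scalar_prod_def lessThan_atLeast0 intro!: sum.cong)
  moreover have "vec n w \<noteq> 0\<^sub>v n"
    using assms(3,4) by (metis index_vec index_zero_vec(1))
  ultimately have "eigenvalue A z"
    unfolding eigenvalue_def eigenvector_def using A by (intro exI[of _ "vec n w"]) auto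
  hence root: "poly (char_poly A) z = 0"
    using eigenvalue_root_char_poly[OF A] by simp
  have "char_poly A \<in> polys_over S"
    unfolding char_poly_def
  proof (rule det_mem)
    show "char_poly_matrix A \<in> carrier_mat n n" using A by simp
    fix i j assume "i < n" "j < n"
    thus "char_poly_matrix A $$ (i, j) \<in> polys_over S"
      using assms(1)[of i j]
      by (auto simp: char_poly_matrix_def A_def zero_mem one_mem uminus_mem diff_mem intro!: pCons_mem poly_0_mem poly_1_mem)
  qed
  thus ?thesis
    using degree_monic_char_poly[OF A] root unfolding integral_over_def by metis
qed

lemma integral_of_stable_span:
  assumes fin: "finite I" and "\<And>i. i \<in> I \<Longrightarrow> z * w i \<in> lin_span S w I" "r \<in> I" "w r \<noteq> 0"
  shows "integral_over S (card I) z"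
proof -
  obtain b where b: "bij_betw b {0..<card I} I"
    using ex_bij_betw_nat_finite[OF fin] by blast
  hence bI: "b k \<in> I" if "k < card I" for k
    using that by (auto simp: bij_betw_def)
  have "\<forall>i\<in>I. \<exists>c. (\<forall>j\<in>I. c j \<in> S) \<and> z * w i = (\<Sum>j\<in>I. c j * w j)"
    using assms(2) unfolding lin_span_def by blast
  then obtain c where c: "\<And>i j. i \<in> I \<Longrightarrow> j \<in> I \<Longrightarrow> c i j \<in> S"
    "\<And>i. i \<in> I \<Longrightarrow> z * w i = (\<Sum>j\<in>I. c i j * w j)"
    by metis
  obtain k where k: "k < card I" "b k = r"
    using b assms(3) by (metis atLeastLessThan_iff bij_betw_def imageE)
  show ?thesis
  proof (rule integral_of_eigenvalue[where a = "\<lambda>i j. c (b i) (b j)" and w = "w \<circ> b" and r = k])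
    fix i assume "i < card I"
    thus "z * (w \<circ> b) i = (\<Sum>j<card I. c (b i) (b j) * (w \<circ> b) j)"
      using c(2)[OF bI] sum.reindex_bij_betw[OF b, of "\<lambda>j. c (b i) j * w j"]
      by (simp add: lessThan_atLeast0)
  qed (use c bI k assms(4) in auto)
qed

lemma monic_root_power:
  assumes "p \<in> polys_over S" "lead_coeff p = 1" "poly p x = 0"
  shows "x ^ degree p = (\<Sum>i<degree p. (- coeff p i) * x ^ i)"
proof -
  have "0 = (\<Sum>i\<le>degree p. coeff p i * x ^ i)"
    using assms(3) by (simp add: poly_altdef)
  also have "\<dots> = (\<Sum>i<degree p. coeff p i * x ^ i) + x ^ degree p"
    using assms(2) by (simp add: lessThan_Suc_atMost[symmetric])
  finally show ?thesis by (simp add: sum_negf add_eq_0_iff)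
qed

text \<open>The module spanned by the products \<open>x^i y^j\<close> with \<open>i < m\<close>,
  \<open>j < n\<close> is stable under multiplication by \<open>x\<close> and by \<open>y\<close>,
  the top powers being rewritten by the monic equations. Hence it is stable under the sum and the
  product.\<close>

lemma integral_add_mult:
  assumes "integral_over S m x" "integral_over S n y"
  shows "integral_over S (m * n) (x + y)" "integral_over S (m * n) (x * y)"
proof -
  obtain p where p: "p \<in> polys_over S" "lead_coeff p = 1" "degree p = m" "poly p x = 0"
    using assms(1) by (auto simp: integral_over_def)
  obtain q where q: "q \<in> polys_over S" "lead_coeff q = 1" "degree q = n" "poly q y = 0"
    using assms(2) by (auto simp: integral_over_def)
  \<comment> \<open>A monic constant is 1 and has no root. Positive degrees put
    \<open>(0, 0)\<close> into \<open>I\<close>, and its generator 1 is the nonzero one that the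
    determinant trick asks for.\<close>
  have m: "m > 0" and n: "n > 0"
    using p q by (auto intro!: Nat.gr0I elim!: degree_eq_zeroE)
  define I where "I = {..<m} \<times> {..<n}"
  define w where "w = (\<lambda>(i, j). x ^ i * y ^ j)"
  have fin: "finite I" by (simp add: I_def)
  have xs: "x * w k \<in> lin_span S w I" if "k \<in> I" for k
  proof -
    obtain i j where k: "k = (i, j)" "i < m" "j < n" using \<open>k \<in> I\<close> by (auto simp: I_def)
    show ?thesis
    proof (cases "Suc i < m")
      case True
      hence "w (Suc i, j) \<in> lin_span S w I" using k fin by (intro span_base) (auto simp: I_def)
      thus ?thesis by (simp add: w_def k mult_ac)
    next
      case False
      hence "x * w k = x ^ m * y ^ j" using k by (simp add: w_def flip: power_Suc) (metis Suc_lessI)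
      also have "\<dots> = (\<Sum>i<m. (- coeff p i) * w (i, j))"
        using monic_root_power[OF p(1,2,4)] p(3) by (simp add: w_def sum_distrib_left sum_negf mult_ac)
      also have "\<dots> \<in> lin_span S w I"
        using k p(1) fin by (intro span_sum span_mult span_base uminus_mem) (auto simp: I_def polys_over_def)
      finally show ?thesis .
    qed
  qed
  have ys: "y * w k \<in> lin_span S w I" if "k \<in> I" for k
  proof -
    obtain i j where k: "k = (i, j)" "i < m" "j < n" using \<open>k \<in> I\<close> by (auto simp: I_def)
    show ?thesis
    proof (cases "Suc j < n")
      case True
      hence "w (i, Suc j) \<in> lin_span S w I" using k fin by (intro span_base) (auto simp: I_def)
      thus ?thesis by (simp add: w_def k mult_ac)
    next
      case False
      hence "y * w k = y ^ n * x ^ i" using k by (simp add: w_def mult_ac flip: power_Suc) (metis Suc_lessI)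
      also have "\<dots> = (\<Sum>j<n. (- coeff q j) * w (i, j))"
        using monic_root_power[OF q(1,2,4)] q(3) by (simp add: w_def sum_distrib_left sum_negf mult_ac)
      also have "\<dots> \<in> lin_span S w I"
        using k q(1) fin by (intro span_sum span_mult span_base uminus_mem) (auto simp: I_def polys_over_def)
      finally show ?thesis .
    qed
  qed
  have card: "card I = m * n" by (simp add: I_def)
  have nz: "(0, 0) \<in> I" "w (0, 0) \<noteq> 0" using m n by (auto simp: I_def w_def)
  show "integral_over S (m * n) (x + y)"
    unfolding card[symmetric] using fin nz
    by (intro integral_of_stable_span[where r = "(0,0)"]) (auto simp: distrib_right intro!: span_add xs ys)
  show "integral_over S (m * n) (x * y)"
    unfolding card[symmetric] using fin nz
    by (intro integral_of_stable_span[where r = "(0,0)"])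
      (auto simp: mult.assoc intro!: span_stable[OF xs] ys)
qed

end

lemma algebraic_int_add: "algebraic_int x \<Longrightarrow> algebraic_int y \<Longrightarrow> algebraic_int (x + y :: complex)"
  using complex_subring.integral_add_mult[OF complex_subring_Ints]
  unfolding algebraic_int_iff_integral_over by blast

lemma algebraic_int_mult: "algebraic_int x \<Longrightarrow> algebraic_int y \<Longrightarrow> algebraic_int (x * y :: complex)"
  using complex_subring.integral_add_mult[OF complex_subring_Ints]
  unfolding algebraic_int_iff_integral_over by blast

lemma complex_subring_algebraic_ints: "complex_subring {x. algebraic_int x}"
  by unfold_locales (auto intro: algebraic_int_add algebraic_int_mult int_imp_algebraic_int)

section \<open>Primitive elements\<close>

lemma monic_degree_0: "lead_coeff p = 1 \<Longrightarrow> degree p = 0 \<Longrightarrow> p = 1"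
  by (auto elim!: degree_eq_zeroE simp: one_pCons)

context complex_subring
begin

text \<open>Only the leading coefficient 1 is ever divided by, so quotient and remainder stay over
  \<open>S\<close>. The lemma is applied over the integers as well as over the rationals.\<close>

lemma monic_division:
  assumes p: "p \<in> polys_over S" "lead_coeff p = 1" and "q \<in> polys_over S"
  shows "\<exists>r\<in>polys_over S. \<exists>t\<in>polys_over S. q = p * r + t \<and> (t = 0 \<or> degree t < degree p)"
  using assms(3)
proof (induction "degree q" arbitrary: q rule: less_induct)
  case less
  show ?case
  proof (cases "degree q < degree p \<or> q = 0")
    case True
    thus ?thesis using less.prems by (intro bexI[of _ 0] bexI[of _ q]) (auto simp: poly_0_mem)
  next
    case False
    define m where "m = Polynomial.monom (lead_coeff q) (degree q - degree p)"
    define q' where "q' = q - p * m"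
    have m: "m \<in> polys_over S" using less.prems by (auto simp: m_def polys_over_def zero_mem)
    have "p \<noteq> 0" using p by auto
    have q': "q' \<in> polys_over S" unfolding q'_def by (intro poly_diff_mem poly_mult_mem less.prems p m)
    show ?thesis
    \<comment> \<open>A nonzero constant cannot drop in degree, so the induction on the degree does
      not reach it; here \<open>p = 1\<close> divides \<open>q\<close> outright.\<close>
    proof (cases "degree q = 0")
      case True
      hence "p = 1" using False p by (intro monic_degree_0) auto
      thus ?thesis using less.prems by (intro bexI[of _ q] bexI[of _ 0]) (auto simp: poly_0_mem)
    next
      case pos: False
      have "q \<noteq> 0" using False by simp
      hence m': "degree m = degree q - degree p" "m \<noteq> 0"
        unfolding m_def by (auto intro!: Polynomial.degree_monom_eq simp: Polynomial.monom_eq_0_iff)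
      hence dm: "degree (p * m) = degree q" using False \<open>p \<noteq> 0\<close> by (simp add: degree_mult_eq)
      have "coeff (p * m) (degree q) = lead_coeff (p * m)" by (simp add: dm)
      also have "\<dots> = lead_coeff m" using p by (simp add: lead_coeff_mult)
      also have "\<dots> = lead_coeff q" unfolding m'(1) by (simp add: m_def)
      finally have q0: "coeff q' (degree q) = 0" by (simp add: q'_def)
      have "degree q' \<noteq> degree q"
      proof
        assume eq: "degree q' = degree q"
        hence "lead_coeff q' = 0" using q0 by simp
        hence "q' = 0" by (simp only: leading_coeff_0_iff)
        thus False using eq pos by simp
      qed
      moreover have "degree q' \<le> degree q"
        unfolding q'_def using dm by (intro degree_diff_le) auto
      ultimately have "degree q' < degree q"
        by simp
      then obtain r t where "r \<in> polys_over S" "t \<in> polys_over S" "q' = p * r + t" "t = 0 \<or> degree t < degree p"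
        using less.hyps[OF _ q'] by blast
      thus ?thesis
        by (intro bexI[of _ "r + m"] bexI[of _ t]) (auto simp: q'_def algebra_simps intro: poly_add_mem m)
    qed
  qed
qed

end

definition min_poly_over :: "complex set \<Rightarrow> complex \<Rightarrow> complex poly \<Rightarrow> bool" where
  "min_poly_over S x p \<longleftrightarrow> p \<in> polys_over S \<and> lead_coeff p = 1 \<and> poly p x = 0 \<and>
     (\<forall>q\<in>polys_over S. q \<noteq> 0 \<longrightarrow> poly q x = 0 \<longrightarrow> degree p \<le> degree q)"

lemma (in complex_subring) min_poly_over_dvd:
  assumes "min_poly_over S x p" "q \<in> polys_over S" "poly q x = 0"
  shows "\<exists>r\<in>polys_over S. q = p * r"
proof -
  from assms(1) have p: "p \<in> polys_over S" "lead_coeff p = 1" "poly p x = 0"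
    "\<forall>q\<in>polys_over S. q \<noteq> 0 \<longrightarrow> poly q x = 0 \<longrightarrow> degree p \<le> degree q"
    by (auto simp: min_poly_over_def)
  obtain r t where rt: "r \<in> polys_over S" "t \<in> polys_over S" "q = p * r + t" "t = 0 \<or> degree t < degree p"
    using monic_division[OF p(1,2) assms(2)] by blast
  from rt(3) assms(3) p(3) have "poly t x = 0" by simp
  hence "t = 0" using p(4) rt(2,4) by force
  thus ?thesis using rt by auto
qed

locale complex_subfield = complex_subring +
  assumes inverse_mem: "x \<in> S \<Longrightarrow> inverse x \<in> S"
begin

lemma Rats_subset: "\<rat> \<subseteq> S"
  by (auto elim!: Rats_cases' simp: divide_inverse intro!: mult_mem inverse_mem of_int_mem)

lemma ex_min_poly_over:
  assumes "q \<in> polys_over S" "q \<noteq> 0" "poly q x = 0"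
  shows "\<exists>p. min_poly_over S x p"
proof -
  define P where "P = (\<lambda>p. p \<in> polys_over S \<and> p \<noteq> 0 \<and> poly p x = 0)"
  obtain p where p: "P p" "\<And>q. P q \<Longrightarrow> degree p \<le> degree q"
    using ex_has_least_nat[of P q degree] assms by (auto simp: P_def)
  have "min_poly_over S x (Polynomial.smult (inverse (lead_coeff p)) p)"
    unfolding min_poly_over_def
    using p by (auto simp: P_def polys_over_def intro!: mult_mem inverse_mem)
  thus ?thesis ..
qed

text \<open>The minimal polynomial of \<open>b\<close> over \<open>S\<close> divides both polynomials, so \<open>b\<close> is its only root, and a simple one.\<close>

lemma unique_common_root_mem:
  assumes g: "g \<in> polys_over S" "rsquarefree g" "poly g b = 0"
    and h: "h \<in> polys_over S" "poly h b = 0"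
    and uniq: "\<And>z. poly g z = 0 \<Longrightarrow> poly h z = 0 \<Longrightarrow> z = b"
  shows "b \<in> S"
proof -
  have "g \<noteq> 0" using g(2) by (auto simp: rsquarefree_def)
  then obtain p where p: "min_poly_over S b p" using ex_min_poly_over g by blast
  obtain r where r: "g = p * r" using min_poly_over_dvd[OF p g(1,3)] by blast
  obtain t where t: "h = p * t" using min_poly_over_dvd[OF p h] by blast
  have pb: "poly p b = 0" "lead_coeff p = 1" "p \<in> polys_over S" using p by (auto simp: min_poly_over_def)
  have roots: "{z. poly p z = 0} = {b}" using pb uniq by (auto simp: r t)
  have "rsquarefree p"
    using g(2) unfolding rsquarefree_roots r by (auto simp: pderiv_mult)
  from complex_poly_decompose_rsquarefree[OF this] have "p = [:- b, 1:]"
    by (simp add: roots pb)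
  with pb(3) have "- b \<in> S" by (metis coeff_pCons_0 mem_Collect_eq polys_over_def)
  thus ?thesis using uminus_mem by fastforce
qed

end

lemma complex_subfield_Rats: "complex_subfield \<rat>"
  by unfold_locales auto

interpretation Q: complex_subfield \<rat> by (rule complex_subfield_Rats)
interpretation Z: complex_subring \<int> by (rule complex_subring_Ints)
interpretation A: complex_subring "{x. algebraic_int x}" by (rule complex_subring_algebraic_ints)

section \<open>Algebraic numbers and their minimal polynomials over the rationals\<close>

definition algebraic_num :: "complex \<Rightarrow> bool" where
  "algebraic_num x \<longleftrightarrow> (\<exists>n. integral_over \<rat> n x)"

lemma ex_min_poly_Rats: "algebraic_num x \<Longrightarrow> \<exists>p. min_poly_over \<rat> x p"
  unfolding algebraic_num_def integral_over_def
  by (metis Q.ex_min_poly_over leading_coeff_0_iff zero_neq_one)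

lemma algebraic_num_Rats: "q \<in> \<rat> \<Longrightarrow> algebraic_num q"
  unfolding algebraic_num_def integral_over_def
  by (intro exI[of _ 1] bexI[of _ "[:- q, 1:]"]) (auto intro!: Q.pCons_mem Q.poly_0_mem)

lemma complex_subring_algebraic: "complex_subring {x. algebraic_num x}"
proof -
  have mult: "algebraic_num (x * y)" and add: "algebraic_num (x + y)"
    if "algebraic_num x" "algebraic_num y" for x y
    using that Q.integral_add_mult unfolding algebraic_num_def by blast+
  show ?thesis
    by unfold_locales (use algebraic_num_Rats mult add mult[OF algebraic_num_Rats[of "-1"]] in auto)
qed

interpretation AN: complex_subring "{x. algebraic_num x}" by (rule complex_subring_algebraic)

lemma algebraic_int_imp_algebraic_num: "algebraic_int x \<Longrightarrow> algebraic_num x"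
  unfolding algebraic_int_iff_integral_over algebraic_num_def integral_over_def
  using polys_over_mono[OF Ints_subset_Rats] by blast

text \<open>Since \<open>p\<close> is irreducible over \<open>\<rat>\<close>, it is also the minimal polynomial of its other roots.\<close>

lemma min_poly_Rats_conjugate:
  assumes "min_poly_over \<rat> x p" "poly p r = 0"
  shows "min_poly_over \<rat> r p"
proof -
  have p: "p \<in> polys_over \<rat>" "lead_coeff p = 1" "poly p x = 0"
    using assms by (auto simp: min_poly_over_def)
  hence "p \<noteq> 0" by auto
  then obtain p' where p': "min_poly_over \<rat> r p'"
    using Q.ex_min_poly_over[OF p(1) _ assms(2)] by blast
  then obtain k where k: "k \<in> polys_over \<rat>" "p = p' * k"
    using Q.min_poly_over_dvd[OF p' p(1) assms(2)] by blast
  have nz: "p' \<noteq> 0" "k \<noteq> 0" using k \<open>p \<noteq> 0\<close> by auto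
  have deg: "degree p = degree p' + degree k" using k nz by (simp add: degree_mult_eq)
  have "degree p' > 0"
    using p' monic_degree_0[of p'] unfolding min_poly_over_def by (intro gr0I) auto
  have "degree p = degree p'"
  proof (cases "poly k x = 0")
    case True
    hence "degree p \<le> degree k" using assms(1) k nz by (auto simp: min_poly_over_def)
    thus ?thesis using deg \<open>degree p' > 0\<close> by simp
  next
    case False
    hence "poly p' x = 0" using p(3) k by simp
    hence "degree p \<le> degree p'" using assms(1) p' nz by (auto simp: min_poly_over_def)
    thus ?thesis using deg by simp
  qed
  thus ?thesis using p' p assms(2) by (auto simp: min_poly_over_def)
qed

text \<open>A multiple root \<open>r\<close> is also a root of the derivative. But \<open>p\<close>
  is the minimal polynomial of \<open>r\<close> as well, so the derivative, having smaller degree,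
  would be zero and \<open>p\<close> constant.\<close>

lemma min_poly_Rats_rsquarefree:
  assumes "min_poly_over \<rat> x p"
  shows "rsquarefree p"
  unfolding rsquarefree_roots
proof (intro allI notI, elim conjE)
  fix r assume r: "poly p r = 0" "poly (pderiv p) r = 0"
  have p: "min_poly_over \<rat> r p" using min_poly_Rats_conjugate[OF assms r(1)] .
  have "pderiv p = 0"
  proof (rule ccontr)
    assume nz: "pderiv p \<noteq> 0"
    hence "degree p \<le> degree (pderiv p)"
      using p r(2) Q.poly_pderiv_mem unfolding min_poly_over_def by blast
    moreover from nz have "degree p \<noteq> 0" by (auto simp: pderiv_eq_0_iff)
    ultimately show False by (simp add: degree_pderiv)
  qed
  hence "degree p = 0" by (simp add: pderiv_eq_0_iff)
  thus False using p r monic_degree_0[of p] unfolding min_poly_over_def by auto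
qed

section \<open>Simple extensions and the primitive element theorem\<close>

definition adjoin :: "complex \<Rightarrow> complex set" where
  "adjoin x = (\<lambda>p. poly p x) ` polys_over \<rat>"

lemma adjoin_subset: "complex_subring K \<Longrightarrow> \<rat> \<subseteq> K \<Longrightarrow> x \<in> K \<Longrightarrow> adjoin x \<subseteq> K"
  unfolding adjoin_def using complex_subring.poly_eval_mem[of K] polys_over_mono[of \<rat> K] by blast

lemma gen_mem_adjoin: "x \<in> adjoin x"
  unfolding adjoin_def
  by (intro image_eqI[of _ _ "[:0, 1:]"]) (auto intro!: Q.pCons_mem Q.poly_0_mem)

lemma Rats_subset_adjoin: "\<rat> \<subseteq> adjoin x"
  unfolding adjoin_def
proof
  fix q :: complex assume "q \<in> \<rat>"
  thus "q \<in> (\<lambda>p. poly p x) ` polys_over \<rat>"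
    by (intro image_eqI[of _ _ "[:q:]"]) (auto intro!: Q.pCons_mem Q.poly_0_mem)
qed

lemma adjoin_subring: "complex_subring (adjoin x)"
proof
  show "0 \<in> adjoin x" "1 \<in> adjoin x" using Rats_subset_adjoin[of x] by auto
next
  fix y z assume "y \<in> adjoin x" "z \<in> adjoin x"
  then obtain p q where p: "p \<in> polys_over \<rat>" "q \<in> polys_over \<rat>" "y = poly p x" "z = poly q x"
    by (auto simp: adjoin_def)
  show "y + z \<in> adjoin x" unfolding adjoin_def
    using p by (intro image_eqI[of _ _ "p + q"]) (auto intro: Q.poly_add_mem)
  show "y * z \<in> adjoin x" unfolding adjoin_def
    using p by (intro image_eqI[of _ _ "p * q"]) (auto intro: Q.poly_mult_mem)
  show "- y \<in> adjoin x" unfolding adjoin_def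
    using p by (intro image_eqI[of _ _ "- p"]) (auto intro: Q.poly_uminus_mem)
qed

lemma algebraic_adjoin: "algebraic_num x \<Longrightarrow> y \<in> adjoin x \<Longrightarrow> algebraic_num y"
  using adjoin_subset[OF complex_subring_algebraic] algebraic_num_Rats by blast

text \<open>Otherwise the factor X could be split off, and since \<open>y\<close> is nonzero the
  quotient would be an annihilator of smaller degree.\<close>

lemma min_poly_coeff_0:
  assumes "min_poly_over \<rat> y p" "y \<noteq> 0"
  shows "coeff p 0 \<noteq> 0"
proof
  assume "coeff p 0 = 0"
  then obtain r where r: "p = pCons 0 r" by (metis coeff_pCons_0 pCons_cases)
  have "p \<noteq> 0" using assms by (auto simp: min_poly_over_def)
  hence "r \<noteq> 0" using r by auto
  moreover have "r \<in> polys_over \<rat>" using assms(1) Q.pCons_memD r unfolding min_poly_over_def by blast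
  moreover have "poly r y = 0" using assms r by (auto simp: min_poly_over_def)
  ultimately have "degree p \<le> degree r" using assms(1) unfolding min_poly_over_def by blast
  thus False using r \<open>r \<noteq> 0\<close> by simp
qed

text \<open>Writing the minimal polynomial as \<open>a + X r\<close> with \<open>a\<close> nonzero
  gives the inverse of \<open>y\<close> as \<open>- r(y) / a\<close>, a polynomial expression in
  \<open>y\<close>.\<close>

lemma subring_algebraic_inverse:
  assumes "complex_subring K" "\<rat> \<subseteq> K" "y \<in> K" "algebraic_num y"
  shows "inverse y \<in> K"
proof (cases "y = 0")
  case False
  obtain p where p: "min_poly_over \<rat> y p" using ex_min_poly_Rats assms(4) by blast
  obtain a r where ar: "p = pCons a r" by (cases p)
  have a: "a \<noteq> 0" using min_poly_coeff_0[OF p False] ar by simp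
  have mem: "a \<in> \<rat>" "r \<in> polys_over \<rat>"
    using p Q.pCons_memD ar unfolding min_poly_over_def by blast+
  have "a + y * poly r y = 0" using p ar by (simp add: min_poly_over_def)
  hence "y * poly r y = - a" by (simp add: add_eq_0_iff)
  hence "y * (- inverse a * poly r y) = 1" using a by (simp add: field_simps)
  hence "inverse y = - inverse a * poly r y" by (rule inverse_unique)
  moreover have "poly r y \<in> K" "- inverse a \<in> K"
    using assms adjoin_subset[OF assms(1,2,3)] mem by (auto simp: adjoin_def)
  ultimately show ?thesis using complex_subring.mult_mem[OF assms(1), of "- inverse a" "poly r y"] by simp
qed (use assms in auto)

lemma adjoin_subfield: "algebraic_num x \<Longrightarrow> complex_subfield (adjoin x)"
  unfolding complex_subfield_def complex_subfield_axioms_def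
  using adjoin_subring subring_algebraic_inverse[OF adjoin_subring Rats_subset_adjoin] algebraic_adjoin
  by blast

text \<open>Put \<open>z = x + c y\<close>. Over the field generated by \<open>z\<close>, the
  polynomials \<open>g(X)\<close> and \<open>f(z - c X)\<close> share the root \<open>y\<close>; for
  all but finitely many \<open>c\<close> it is their only common root, and
  \<open>unique_common_root_mem\<close> then places \<open>y\<close>, hence \<open>x\<close>, in
  that field.\<close>

lemma primitive_element_two:
  assumes x: "algebraic_num x" and y: "algebraic_num y"
  shows "\<exists>c::nat. x \<in> adjoin (x + of_nat c * y) \<and> y \<in> adjoin (x + of_nat c * y)"
proof -
  obtain f where f: "min_poly_over \<rat> x f" using ex_min_poly_Rats x by blast
  obtain g where g: "min_poly_over \<rat> y g" using ex_min_poly_Rats y by blast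
  have fg: "f \<noteq> 0" "g \<noteq> 0" "f \<in> polys_over \<rat>" "g \<in> polys_over \<rat>" "poly f x = 0" "poly g y = 0"
    using f g by (auto simp: min_poly_over_def)
  \<comment> \<open>The bad values of \<open>c\<close>: those with \<open>x + c y = a + c b\<close>
    for roots \<open>a\<close> of \<open>f\<close> and \<open>b\<close> of \<open>g\<close>,
    \<open>b\<close> different from \<open>y\<close>. The pairs with \<open>b = y\<close> contribute
    only 0, by division by zero.\<close>
  define B where "B = (\<lambda>(a, b). (a - x) / (y - b)) ` ({a. poly f a = 0} \<times> {b. poly g b = 0})"
  have "finite B" unfolding B_def using fg by (intro finite_imageI finite_cartesian_product poly_roots_finite)
  moreover have "infinite (range (of_nat :: nat \<Rightarrow> complex))"
    by (simp add: finite_image_iff inj_of_nat)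
  ultimately have "\<not> range (of_nat :: nat \<Rightarrow> complex) \<subseteq> B" using finite_subset by blast
  then obtain c :: nat where c: "of_nat c \<notin> B" by blast
  define z where "z = x + of_nat c * y"
  interpret F: complex_subfield "adjoin z"
    using x y AN.add_mem AN.mult_mem AN.of_nat_mem unfolding z_def by (intro adjoin_subfield) auto
  define h where "h = pcompose f [:z, - of_nat c:]"
  have "y \<in> adjoin z"
  proof (rule F.unique_common_root_mem)
    show "g \<in> polys_over (adjoin z)" using fg polys_over_mono[OF F.Rats_subset] by blast
    show "rsquarefree g" using min_poly_Rats_rsquarefree g .
    show "poly g y = 0" "poly h y = 0" using fg by (auto simp: h_def poly_pcompose z_def mult_ac)
    show "h \<in> polys_over (adjoin z)" unfolding h_def
      using fg polys_over_mono[OF F.Rats_subset]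
      by (intro F.poly_pcompose_mem F.pCons_mem F.poly_0_mem F.uminus_mem F.of_nat_mem gen_mem_adjoin) auto
    fix b assume b: "poly g b = 0" "poly h b = 0"
    show "b = y"
    proof (rule ccontr)
      assume "b \<noteq> y"
      have "poly f (x + of_nat c * y - of_nat c * b) = 0" using b by (simp add: h_def poly_pcompose z_def mult_ac)
      moreover have "of_nat c = (x + of_nat c * y - of_nat c * b - x) / (y - b)"
        using \<open>b \<noteq> y\<close> by (simp add: field_simps)
      ultimately have "of_nat c \<in> B" unfolding B_def using b by (intro image_eqI[of _ _ "(_, b)"]) auto
      thus False using c by simp
    qed
  qed
  moreover have "x = z - of_nat c * y" by (simp add: z_def)
  ultimately have "x \<in> adjoin z" using F.diff_mem F.mult_mem F.of_nat_mem gen_mem_adjoin by metis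
  with \<open>y \<in> adjoin z\<close> show ?thesis unfolding z_def by blast
qed

lemma primitive_element:
  assumes "finite B" "complex_subring K" "\<rat> \<subseteq> K" "B \<subseteq> K" "\<forall>b\<in>B. algebraic_num b"
  shows "\<exists>x\<in>K. algebraic_num x \<and> B \<subseteq> adjoin x"
  using assms(1,4,5)
proof (induction B rule: finite_induct)
  case empty
  show ?case using assms(3) algebraic_num_Rats by (intro bexI[of _ 0]) auto
next
  case (insert b B)
  then obtain x where x: "x \<in> K" "algebraic_num x" "B \<subseteq> adjoin x" by auto
  obtain c where c: "x \<in> adjoin (x + of_nat c * b)" "b \<in> adjoin (x + of_nat c * b)"
    using primitive_element_two[OF x(2), of b] insert.prems by auto
  have "adjoin x \<subseteq> adjoin (x + of_nat c * b)"
    by (intro adjoin_subset adjoin_subring Rats_subset_adjoin c)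
  moreover have "x + of_nat c * b \<in> K"
    using insert.prems x(1) by (simp add: complex_subring.add_mem[OF assms(2)] complex_subring.mult_mem[OF assms(2)]
      complex_subring.of_nat_mem[OF assms(2)])
  moreover have "algebraic_num (x + of_nat c * b)"
    using insert.prems x(2) AN.add_mem AN.mult_mem AN.of_nat_mem by auto
  ultimately show ?case using x c by (intro bexI[of _ "x + of_nat c * b"]) auto
qed

section \<open>Number fields as simple extensions\<close>

lemma complex_ring_simps [simp]:
  "carrier complex_ring = UNIV" "x \<otimes>\<^bsub>complex_ring\<^esub> y = x * y" "\<one>\<^bsub>complex_ring\<^esub> = 1"
  "\<zero>\<^bsub>complex_ring\<^esub> = 0" "x \<oplus>\<^bsub>complex_ring\<^esub> y = x + y"
  by (simp_all add: ring_of_type_algebra_def fun_eq_iff)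

lemma ring_complex_ring: "ring complex_ring" by (rule ring_from_type_algebra)

text \<open>Bridge from the inductive dimension predicate to a finite spanning family: each step of
  the induction adds the vector \<open>v\<close> as generator number \<open>n\<close>.\<close>

lemma dimension_lin_span:
  assumes "ring.dimension complex_ring n \<rat> E"
  shows "\<exists>w. E = lin_span \<rat> w {..<n}"
  using assms
proof (induction n "\<rat> :: complex set" E rule: ring.dimension.induct[OF ring_complex_ring, consumes 1])
  case (2 v E n)
  then obtain w where w: "E = lin_span \<rat> w {..<n}" by auto
  have "ring.line_extension complex_ring \<rat> v E = lin_span \<rat> (w(n := v)) {..<Suc n}"
    unfolding w lin_span_def
  proof (intro equalityI subsetI, goal_cases)
    case (1 x)
    then obtain k c where "k \<in> \<rat>" "\<forall>i\<in>{..<n}. c i \<in> \<rat>" "x = k * v + (\<Sum>i<n. c i * w i)"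
      by (auto simp: ring.line_extension_mem_iff[OF ring_complex_ring])
    thus ?case by (auto intro!: exI[of _ "c(n := k)"] sum.cong)
  next
    case (2 x)
    then obtain c where "\<forall>i\<in>{..<Suc n}. c i \<in> \<rat>" "x = (\<Sum>i<Suc n. c i * (w(n := v)) i)" by auto
    thus ?case
      by (auto simp: ring.line_extension_mem_iff[OF ring_complex_ring] intro!: bexI[of _ "c n"] exI[of _ c])
  qed
  thus ?case by blast
qed (simp add: lin_span_def)

text \<open>\<open>K\<close> is a finite span stable under multiplication by each of its elements,
  so the determinant trick makes them all algebraic; a primitive element for the finitely many
  generators then generates \<open>K\<close>.\<close>

lemma number_field_adjoin:
  assumes "number_field K"
  shows "\<exists>x. algebraic_num x \<and> K = adjoin x"
proof -
  have sf: "subfield K complex_ring" using assms by (simp add: number_field_def)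
  have sr: "subring K complex_ring" using sf subfieldE(1) by blast
  have K: "complex_subring K"
  proof
    show "0 \<in> K" "1 \<in> K" using subringE(2,3)[OF sr] by auto
    show "x + y \<in> K" "x * y \<in> K" if "x \<in> K" "y \<in> K" for x y
      using subringE(6,7)[OF sr] that by auto
    show "- x \<in> K" if "x \<in> K" for x
    proof -
      have "\<ominus>\<^bsub>complex_ring\<^esub> x = - x"
        using abelian_group.minus_equality[OF ring.is_abelian_group[OF ring_complex_ring], of "- x" x] by simp
      thus ?thesis using subringE(5)[OF sr that] by simp
    qed
  qed
  have inv: "inverse x \<in> K" if "x \<in> K" for x
  proof (cases "x = 0")
    case False
    hence "x * inv\<^bsub>complex_ring\<^esub> x = 1"
      using ring.subfield_m_inv(2)[OF ring_complex_ring sf, of x] that by simp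
    hence "inverse x = inv\<^bsub>complex_ring\<^esub> x" by (rule inverse_unique)
    thus ?thesis using ring.subfield_m_inv(1)[OF ring_complex_ring sf, of x] that False by simp
  qed (use that in auto)
  have Q: "\<rat> \<subseteq> K"
    using complex_subfield.Rats_subset[of K] K inv
    by (auto simp: complex_subfield_def complex_subfield_axioms_def)
  obtain n :: nat and w where w: "K = lin_span \<rat> w {..<n}"
    using assms dimension_lin_span unfolding number_field_def ring.finite_dimension_def[OF ring_complex_ring] by blast
  have wK: "w i \<in> K" if "i < n" for i using that unfolding w by (intro Q.span_base) auto
  have nz: "\<exists>i<n. w i \<noteq> 0"
  proof (rule ccontr)
    assume "\<not> ?thesis"
    hence "K = {0}" unfolding w lin_span_def by auto
    thus False using complex_subring.one_mem[OF K] by auto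
  qed
  then obtain r where r: "r < n" "w r \<noteq> 0" by blast
  have alg: "algebraic_num y" if "y \<in> K" for y
    unfolding algebraic_num_def
    using that wK r complex_subring.mult_mem[OF K]
    by (intro exI[of _ "card {..<n}"] Q.integral_of_stable_span[where w = w and r = r]) (auto simp flip: w)
  obtain x where x: "x \<in> K" "algebraic_num x" "w ` {..<n} \<subseteq> adjoin x"
    using primitive_element[of "w ` {..<n}" K] K Q wK alg by blast
  interpret F: complex_subring "adjoin x" by (rule adjoin_subring)
  have "K \<subseteq> adjoin x"
  proof
    fix y assume "y \<in> K"
    then obtain c where "\<forall>i<n. c i \<in> \<rat>" "y = (\<Sum>i<n. c i * w i)" unfolding w lin_span_def by auto
    thus "y \<in> adjoin x" using x(3) Rats_subset_adjoin by (auto intro!: F.sum_mem F.mult_mem)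
  qed
  thus ?thesis using x adjoin_subset[OF K Q x(1)] by blast
qed

text \<open>Puts the rationals into the same shape as a number field, so that rational and imaginary
  positions share one development.\<close>

lemma Rats_eq_adjoin: "\<rat> = adjoin 0"
  by (intro equalityI adjoin_subset[OF complex_subring_Rats] Rats_subset_adjoin) auto

section \<open>Embeddings and norms\<close>

lemma finite_common_denominator:
  assumes "finite A" "A \<subseteq> (\<rat> :: complex set)"
  shows "\<exists>D::int. D > 0 \<and> (\<forall>a\<in>A. of_int D * a \<in> \<int>)"
  using assms
proof (induction A rule: finite_induct)
  case empty
  show ?case by (intro exI[of _ 1]) auto
next
  case (insert a A)
  then obtain D :: int where D: "D > 0" "\<forall>a\<in>A. of_int D * a \<in> \<int>" by auto
  obtain m n where a: "n > 0" "a = of_int m / of_int n"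
    using insert.prems by (auto elim: Rats_cases')
  show ?case
  proof (intro exI[of _ "D * n"] conjI ballI)
    fix b assume "b \<in> insert a A"
    thus "of_int (D * n) * b \<in> \<int>"
    proof
      assume "b = a"
      hence "of_int (D * n) * b = of_int (D * m)" using a by simp
      thus ?thesis by (simp only: Ints_of_int)
    next
      assume "b \<in> A"
      hence "of_int n * (of_int D * b) \<in> \<int>" using D by (intro Ints_mult[of "of_int n" "of_int D * b"]) auto
      thus ?thesis by (simp only: of_int_mult mult_ac)
    qed
  qed (use D a in auto)
qed

text \<open>If \<open>p\<close> is monic of degree \<open>n\<close> with root \<open>x\<close>, then
  \<open>D^n p(X / D)\<close> is monic with root \<open>D x\<close>; each coefficient below the
  leading one gains at least one factor \<open>D\<close>, and a common denominator makes it
  integral.\<close>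

lemma algebraic_num_scale_int:
  assumes "algebraic_num x"
  shows "\<exists>D::int. D > 0 \<and> algebraic_int (of_int D * x)"
proof -
  obtain p where p: "p \<in> polys_over \<rat>" "lead_coeff p = 1" "poly p x = 0"
    using assms by (auto simp: algebraic_num_def integral_over_def)
  define n where "n = degree p"
  have "range (coeff p) \<subseteq> insert 0 (coeff p ` {..n})"
  proof
    fix a assume "a \<in> range (coeff p)"
    then obtain i where "a = coeff p i" by blast
    thus "a \<in> insert 0 (coeff p ` {..n})" using coeff_eq_0[of p i] by (cases "i \<le> n") (auto simp: n_def)
  qed
  hence "finite (range (coeff p))" by (rule finite_subset) simp
  then obtain D :: int where D: "D > 0" "\<And>i. of_int D * coeff p i \<in> \<int>"
    using finite_common_denominator[of "range (coeff p)"] p(1) by (auto simp: polys_over_def)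
  define q where "q = (\<Sum>i\<le>n. Polynomial.monom (of_int D ^ (n - i) * coeff p i) i)"
  have cq: "coeff q i = (if i \<le> n then of_int D ^ (n - i) * coeff p i else 0)" for i
    by (simp add: q_def Polynomial.coeff_sum sum.delta)
  have "coeff q n = 1" using p by (simp add: cq n_def)
  moreover have "degree q = n"
    using \<open>coeff q n = 1\<close> by (intro antisym degree_le le_degree) (auto simp: cq)
  moreover have "q \<in> polys_over \<int>"
    unfolding polys_over_def mem_Collect_eq
  proof
    fix i
    have "of_int D ^ (n - i) * coeff p i \<in> \<int>" if less: "i < n"
    proof -
      obtain k where k: "n - i = Suc k" using less by (cases "n - i") auto
      have "of_int D ^ k * (of_int D * coeff p i) \<in> \<int>" by (rule Ints_mult[OF Ints_power D(2)]) auto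
      thus ?thesis unfolding k power_Suc2 by (simp only: mult.assoc)
    qed
    thus "coeff q i \<in> \<int>" using \<open>coeff q n = 1\<close> by (cases "i = n") (auto simp: cq)
  qed
  moreover have "poly q (of_int D * x) = of_int D ^ n * poly p x"
  proof -
    have "poly q (of_int D * x) = (\<Sum>i\<le>n. of_int D ^ (n - i) * coeff p i * (of_int D * x) ^ i)"
      by (simp add: q_def poly_sum poly_monom)
    also have "\<dots> = (\<Sum>i\<le>n. of_int D ^ n * (coeff p i * x ^ i))"
    proof (rule sum.cong)
      fix i assume "i \<in> {..n}"
      hence pow: "(of_int D :: complex) ^ (n - i) * of_int D ^ i = of_int D ^ n" by (simp flip: power_add)
      have "of_int D ^ (n - i) * coeff p i * (of_int D * x) ^ i
          = (of_int D ^ (n - i) * of_int D ^ i) * (coeff p i * x ^ i)"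
        by (simp only: power_mult_distrib mult_ac)
      thus "of_int D ^ (n - i) * coeff p i * (of_int D * x) ^ i = of_int D ^ n * (coeff p i * x ^ i)"
        by (simp only: pow)
    qed simp
    finally show ?thesis by (simp add: poly_altdef n_def sum_distrib_left)
  qed
  ultimately have "algebraic_int (of_int D * x)"
    using p(3) by (intro algebraic_int.intros[of q]) (auto simp: polys_over_def)
  thus ?thesis using D by blast
qed

text \<open>An integer polynomial of least degree vanishing at \<open>x\<close> has nonzero constant
  term \<open>D\<close>, since X could otherwise be cancelled. The equation
  \<open>D + x r(x) = 0\<close> then exhibits the cofactor \<open>- r(x)\<close>, an integer
  polynomial at an algebraic integer.\<close>

lemma algebraic_int_dvd_int:
  fixes x :: complex
  assumes "algebraic_int x" "x \<noteq> 0"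
  shows "\<exists>(D::int) y. D \<noteq> 0 \<and> algebraic_int y \<and> of_int D = x * y"
proof -
  define P where "P = (\<lambda>p. p \<in> polys_over \<int> \<and> p \<noteq> 0 \<and> poly p x = 0)"
  obtain q where "q \<in> polys_over \<int>" "lead_coeff q = 1" "poly q x = 0"
    using assms(1) by (auto simp: algebraic_int_iff_integral_over integral_over_def)
  hence "P q" by (auto simp: P_def)
  then obtain p where p: "P p" "\<And>q. P q \<Longrightarrow> degree p \<le> degree q"
    using ex_has_least_nat[of P q degree] by auto
  obtain a r where ar: "p = pCons a r" by (cases p)
  have mem: "a \<in> \<int>" "r \<in> polys_over \<int>" using p(1) Z.pCons_memD ar unfolding P_def by blast+
  have "a \<noteq> 0"
  proof
    assume "a = 0"
    hence "P r" using p(1) mem assms(2) ar by (auto simp: P_def)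
    from p(2)[OF this] show False using ar \<open>P r\<close> by (auto simp: P_def)
  qed
  obtain D :: int where D: "a = of_int D" using mem(1) by (auto elim: Ints_cases)
  have "a + x * poly r x = 0" using p(1) ar by (simp add: P_def)
  hence "of_int D = x * - poly r x" using D by (simp add: eq_neg_iff_add_eq_0)
  moreover have "algebraic_int (- poly r x)"
    using A.poly_eval_mem[of r x] polys_over_mono[OF A.Ints_subset] mem(2) assms(1) by auto
  ultimately show ?thesis using D \<open>a \<noteq> 0\<close> by (intro exI[of _ D] exI[of _ "- poly r x"]) auto
qed

lemma embeddings_iff:
  "\<sigma> \<in> embeddings K \<longleftrightarrow> \<sigma> \<in> extensional K \<and> \<sigma> 1 = 1 \<and>
     (\<forall>x\<in>K. \<forall>y\<in>K. \<sigma> (x * y) = \<sigma> x * \<sigma> y \<and> \<sigma> (x + y) = \<sigma> x + \<sigma> y)"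
  unfolding embeddings_def Ring.ring_hom_def by auto

text \<open>The generator is taken integral so that its shifts by natural numbers, the multipliers
  of \<open>ex_separating_multiplier\<close>, are algebraic integers.\<close>

locale integral_primitive =
  fixes K :: "complex set" and \<theta> :: complex and f :: "complex poly"
  assumes K_eq: "K = adjoin \<theta>" and theta_int: "algebraic_int \<theta>" and f: "min_poly_over \<rat> \<theta> f"
begin

abbreviation "E \<equiv> embeddings K"

sublocale F: complex_subfield K
  unfolding K_eq by (intro adjoin_subfield algebraic_int_imp_algebraic_num theta_int)

lemma theta_mem: "\<theta> \<in> K" unfolding K_eq by (rule gen_mem_adjoin)

lemma emb_add: "\<sigma> \<in> E \<Longrightarrow> x \<in> K \<Longrightarrow> y \<in> K \<Longrightarrow> \<sigma> (x + y) = \<sigma> x + \<sigma> y"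
  and emb_mult: "\<sigma> \<in> E \<Longrightarrow> x \<in> K \<Longrightarrow> y \<in> K \<Longrightarrow> \<sigma> (x * y) = \<sigma> x * \<sigma> y"
  and emb_1: "\<sigma> \<in> E \<Longrightarrow> \<sigma> 1 = 1"
  by (auto simp: embeddings_iff)

lemma emb_0: "\<sigma> \<in> E \<Longrightarrow> \<sigma> 0 = 0"
  using emb_add[of \<sigma> 0 0] F.zero_mem by simp

lemma emb_uminus: "\<sigma> \<in> E \<Longrightarrow> x \<in> K \<Longrightarrow> \<sigma> (- x) = - \<sigma> x"
proof -
  assume x: "\<sigma> \<in> E" "x \<in> K"
  have "\<sigma> x + \<sigma> (- x) = 0"
    using emb_add[OF x F.uminus_mem[OF x(2)]] emb_0[OF x(1)] by simp
  thus ?thesis by (simp add: eq_neg_iff_add_eq_0 add.commute)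
qed

lemma emb_of_nat: "\<sigma> \<in> E \<Longrightarrow> \<sigma> (of_nat n) = of_nat n"
  by (induction n) (auto simp: emb_0 emb_1 emb_add F.of_nat_mem F.one_mem)

lemma emb_of_int: "\<sigma> \<in> E \<Longrightarrow> \<sigma> (of_int n) = of_int n"
  by (cases n rule: int_cases2) (auto simp: emb_of_nat emb_uminus F.of_nat_mem)

lemma emb_Rats:
  assumes "\<sigma> \<in> E" "q \<in> \<rat>"
  shows "\<sigma> q = q"
proof -
  obtain m n where q: "n > 0" "q = of_int m / of_int n" using assms(2) by (auto elim: Rats_cases')
  hence "of_int n * q = of_int m" by simp
  hence "of_int n * \<sigma> q = of_int m"
    using emb_mult[OF assms(1), of "of_int n" q] assms F.Rats_subset F.of_int_mem
      emb_of_int[OF assms(1), of n] emb_of_int[OF assms(1), of m] by auto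
  with \<open>of_int n * q = of_int m\<close> have "of_int n * \<sigma> q = of_int n * q" by simp
  thus ?thesis using q(1) by simp
qed

lemma emb_poly:
  assumes "\<sigma> \<in> E" "p \<in> polys_over \<rat>" "x \<in> K"
  shows "\<sigma> (poly p x) = poly p (\<sigma> x)"
  using assms(2)
proof (induction p)
  case (pCons a p)
  have "a \<in> \<rat>" "p \<in> polys_over \<rat>" using Q.pCons_memD[OF pCons.prems] by auto
  moreover from this have "poly p x \<in> K" using F.poly_eval_mem[of p x] polys_over_mono[OF F.Rats_subset] assms(3) by auto
  ultimately show ?case
    using assms pCons.IH F.Rats_subset
    by (simp add: emb_add[OF assms(1)] emb_mult[OF assms(1)] emb_Rats[OF assms(1)] F.mult_mem subset_iff)
qed (auto simp: emb_0 assms(1))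

lemma f_props: "f \<in> polys_over \<rat>" "lead_coeff f = 1" "poly f \<theta> = 0" "f \<noteq> 0"
  using f by (auto simp: min_poly_over_def)

lemma mem_K_E: assumes "x \<in> K" obtains p where "p \<in> polys_over \<rat>" "x = poly p \<theta>"
  using assms unfolding K_eq adjoin_def by blast

lemma emb_theta_root: "\<sigma> \<in> E \<Longrightarrow> poly f (\<sigma> \<theta>) = 0"
  using emb_poly[of \<sigma> f \<theta>] f_props theta_mem emb_0[of \<sigma>] by simp

lemma emb_eqI:
  assumes "\<sigma> \<in> E" "\<tau> \<in> E" "\<sigma> \<theta> = \<tau> \<theta>"
  shows "\<sigma> = \<tau>"
proof (rule extensionalityI[of _ K])
  show "\<sigma> \<in> extensional K" "\<tau> \<in> extensional K" using assms by (auto simp: embeddings_iff)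
  fix x assume "x \<in> K"
  then obtain p where "p \<in> polys_over \<rat>" "x = poly p \<theta>" by (rule mem_K_E)
  thus "\<sigma> x = \<tau> x" using emb_poly[OF assms(1)] emb_poly[OF assms(2)] assms(3) theta_mem by simp
qed

text \<open>The embedding sends \<open>p(\<theta>)\<close> to \<open>p(r)\<close>. It is well
  defined because \<open>f\<close> divides every rational polynomial vanishing at \<theta>, and
  \<open>f\<close> vanishes at \<open>r\<close>.\<close>

lemma emb_exists:
  assumes r: "poly f r = 0"
  shows "\<exists>\<sigma>\<in>E. \<sigma> \<theta> = r"
proof -
  define P where "P = (\<lambda>y p. p \<in> polys_over \<rat> \<and> y = poly p \<theta>)"
  define \<sigma> where "\<sigma> = (\<lambda>y\<in>K. poly (SOME p. P y p) r)"
  have wd: "poly p r = poly q r" if pq: "p \<in> polys_over \<rat>" "q \<in> polys_over \<rat>" "poly p \<theta> = poly q \<theta>" for p q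
  proof -
    have "p - q \<in> polys_over \<rat>" "poly (p - q) \<theta> = 0" using pq Q.poly_diff_mem by auto
    then obtain t where "p - q = f * t" using Q.min_poly_over_dvd[OF f] by blast
    hence "poly (p - q) r = 0" using r by simp
    thus ?thesis by simp
  qed
  have val: "\<sigma> (poly p \<theta>) = poly p r" if "p \<in> polys_over \<rat>" for p
  proof -
    have mem: "poly p \<theta> \<in> K" using that unfolding K_eq adjoin_def by auto
    have "P (poly p \<theta>) (SOME q. P (poly p \<theta>) q)" by (rule someI[of _ p]) (simp add: P_def that)
    thus ?thesis using wd[of p "SOME q. P (poly p \<theta>) q"] that mem by (simp add: \<sigma>_def P_def)
  qed
  have "\<sigma> \<in> E"
    unfolding embeddings_iff
  proof (intro conjI ballI)
    show "\<sigma> \<in> extensional K" by (simp add: \<sigma>_def)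
    show "\<sigma> 1 = 1" using val[OF Q.poly_1_mem] by simp
    fix x y assume "x \<in> K" "y \<in> K"
    then obtain p q where pq: "p \<in> polys_over \<rat>" "x = poly p \<theta>" "q \<in> polys_over \<rat>" "y = poly q \<theta>"
      using mem_K_E[of x thesis] mem_K_E[of y thesis] by (auto elim!: mem_K_E)
    show "\<sigma> (x * y) = \<sigma> x * \<sigma> y" "\<sigma> (x + y) = \<sigma> x + \<sigma> y"
      using pq val[of p] val[of q] val[OF Q.poly_mult_mem[of p q]] val[OF Q.poly_add_mem[of p q]] by auto
  qed
  moreover have "\<sigma> \<theta> = r"
    using val[OF Q.pCons_mem[OF Q.zero_mem Q.poly_1_mem]] by simp
  ultimately show ?thesis by blast
qed

lemma bij_emb_roots: "bij_betw (\<lambda>\<sigma>. \<sigma> \<theta>) E {r. poly f r = 0}"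
proof (rule bij_betw_imageI)
  show "inj_on (\<lambda>\<sigma>. \<sigma> \<theta>) E" by (rule inj_onI) (rule emb_eqI)
  show "(\<lambda>\<sigma>. \<sigma> \<theta>) ` E = {r. poly f r = 0}"
    using emb_theta_root emb_exists by (fastforce simp: image_iff)
qed

lemma finite_E: "finite E"
  using bij_betw_finite[OF bij_emb_roots] poly_roots_finite f_props by auto

definition "d = card E"

lemma degree_f: "degree f = d"
proof -
  have "f = (\<Prod>z|poly f z = 0. [:- z, 1:])"
    using complex_poly_decompose_rsquarefree[OF min_poly_Rats_rsquarefree[OF f]] f_props by simp
  hence "degree f = (\<Sum>z|poly f z = 0. degree [:- z, 1:])"
    using degree_prod_eq_sum_degree[of "{z. poly f z = 0}" "\<lambda>z. [:- z, 1:]"] by simp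
  also have "\<dots> = d" unfolding d_def using bij_betw_same_card[OF bij_emb_roots] by simp
  finally show ?thesis .
qed

text \<open>The inclusion of \<open>K\<close>, restricted because \<open>embeddings\<close> consists
  of extensional maps.\<close>

definition idE :: "complex \<Rightarrow> complex" where "idE = restrict (\<lambda>x. x) K"

lemma idE_mem: "idE \<in> E"
  by (auto simp: embeddings_iff idE_def F.one_mem F.mult_mem F.add_mem)

lemma idE_apply: "x \<in> K \<Longrightarrow> idE x = x" by (simp add: idE_def)

lemma d_pos: "d > 0"
  unfolding d_def using finite_E idE_mem by (auto simp: card_gt_0_iff)

lemma K_lin_span: "K = lin_span \<rat> (\<lambda>i. \<theta> ^ i) {..<d}"
proof (intro equalityI subsetI)
  fix x assume "x \<in> K"
  then obtain p where p: "p \<in> polys_over \<rat>" "x = poly p \<theta>" by (rule mem_K_E)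
  obtain r t where rt: "t \<in> polys_over \<rat>" "p = f * r + t" "t = 0 \<or> degree t < d"
    using Q.monic_division[OF f_props(1,2) p(1)] degree_f by auto
  have "x = poly t \<theta>" using p rt f_props by simp
  also have "\<dots> = (\<Sum>i<d. coeff t i * \<theta> ^ i)"
    using rt(3) d_pos unfolding poly_altdef
    by (intro sum.mono_neutral_left) (auto simp: coeff_eq_0)
  finally show "x \<in> lin_span \<rat> (\<lambda>i. \<theta> ^ i) {..<d}"
    using rt(1) by (auto simp: lin_span_def polys_over_def)
next
  fix x assume "x \<in> lin_span \<rat> (\<lambda>i. \<theta> ^ i) {..<d}"
  thus "x \<in> K" using F.Rats_subset theta_mem unfolding lin_span_def
    by (auto intro!: F.sum_mem F.mult_mem F.power_mem)
qed

text \<open>The witness is the characteristic polynomial of multiplication by \<open>x\<close> on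
  the span of the first \<open>d\<close> powers of \<theta>.\<close>

lemma ex_annihilator:
  assumes "x \<in> K"
  shows "\<exists>p\<in>polys_over \<rat>. lead_coeff p = 1 \<and> degree p = d \<and> poly p x = 0"
proof -
  have "integral_over \<rat> (card {..<d}) x"
    using assms theta_mem d_pos
    by (intro Q.integral_of_stable_span[where w = "\<lambda>i. \<theta> ^ i" and r = 0])
      (auto simp flip: K_lin_span intro!: F.mult_mem F.power_mem)
  thus ?thesis by (simp add: integral_over_def)
qed

text \<open>These are the primitive elements of \<open>K\<close>; see
  \<open>K_eq_adjoin_separating\<close>.\<close>

definition separating :: "complex \<Rightarrow> bool" where
  "separating x \<longleftrightarrow> x \<in> K \<and> inj_on (\<lambda>\<sigma>. \<sigma> x) E"

definition emb_poly_of :: "complex \<Rightarrow> complex poly" where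
  "emb_poly_of x = (\<Prod>\<sigma>\<in>E. [:- \<sigma> x, 1:])"

lemma emb_poly_of_props:
  "degree (emb_poly_of x) = d" "lead_coeff (emb_poly_of x) = 1" "\<sigma> \<in> E \<Longrightarrow> poly (emb_poly_of x) (\<sigma> x) = 0"
proof -
  show "degree (emb_poly_of x) = d"
    unfolding emb_poly_of_def d_def by (subst degree_prod_eq_sum_degree) auto
  show "lead_coeff (emb_poly_of x) = 1" unfolding emb_poly_of_def lead_coeff_prod by simp
  show "\<sigma> \<in> E \<Longrightarrow> poly (emb_poly_of x) (\<sigma> x) = 0"
    using finite_E by (auto simp: emb_poly_of_def poly_prod prod_zero_iff)
qed

text \<open>A monic rational annihilator of degree \<open>d\<close> also vanishes at the
  \<open>d\<close> distinct conjugates. Its difference to \<open>emb_poly_of x\<close> has smaller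
  degree and the same \<open>d\<close> roots, so it is zero.\<close>

lemma emb_poly_of_Rats:
  assumes "separating x"
  shows "emb_poly_of x \<in> polys_over \<rat>"
proof -
  have x: "x \<in> K" "inj_on (\<lambda>\<sigma>. \<sigma> x) E" using assms by (auto simp: separating_def)
  obtain p where p: "p \<in> polys_over \<rat>" "lead_coeff p = 1" "degree p = d" "poly p x = 0"
    using ex_annihilator[OF x(1)] by blast
  have "p - emb_poly_of x = 0"
  proof (rule ccontr)
    let ?q = "p - emb_poly_of x"
    assume nz: "?q \<noteq> 0"
    have "coeff ?q d = 0" using p emb_poly_of_props(1,2)[where x = x] by simp
    moreover have "degree ?q \<le> d" using p emb_poly_of_props by (intro degree_diff_le) auto
    moreover have "lead_coeff ?q \<noteq> 0" using nz by (simp only: leading_coeff_0_iff not_False_eq_True)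
    ultimately have "degree ?q < d" by (cases "degree ?q = d") auto
    moreover have "(\<lambda>\<sigma>. \<sigma> x) ` E \<subseteq> {z. poly ?q z = 0}"
      using emb_poly_of_props(3)[of _ x] emb_poly[OF _ p(1) x(1), symmetric] p(4) emb_0 by (auto simp: image_subset_iff)
    hence "d \<le> card {z. poly ?q z = 0}"
      unfolding d_def card_image[OF x(2), symmetric] using nz by (intro card_mono poly_roots_finite)
    moreover have "card {z. poly ?q z = 0} \<le> degree ?q" using nz by (rule card_poly_roots_bound)
    ultimately show False by simp
  qed
  thus ?thesis using p(1) by simp
qed

lemma emb_algebraic_int:
  assumes "\<sigma> \<in> E" "x \<in> K" "algebraic_int x"
  shows "algebraic_int (\<sigma> x)"
proof -
  obtain p where p: "p \<in> polys_over \<int>" "lead_coeff p = 1" "poly p x = 0"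
    using assms(3) by (auto simp: algebraic_int_iff_integral_over integral_over_def)
  hence "poly p (\<sigma> x) = 0"
    using emb_poly[OF assms(1), of p x] polys_over_mono[OF Ints_subset_Rats] assms emb_0[OF assms(1)] by auto
  thus ?thesis using p by (intro algebraic_int.intros[of p]) (auto simp: polys_over_def)
qed

text \<open>The coefficients are algebraic integers because the conjugates are, and they are
  rational; hence they are integers.\<close>

lemma emb_poly_of_Ints:
  assumes "separating x" "algebraic_int x"
  shows "emb_poly_of x \<in> polys_over \<int>"
proof -
  have "emb_poly_of x \<in> polys_over {x. algebraic_int x}"
    unfolding emb_poly_of_def using assms emb_algebraic_int A.uminus_mem A.one_mem
    by (intro A.poly_prod_mem A.pCons_mem A.poly_0_mem) (auto simp: separating_def)
  thus ?thesis using emb_poly_of_Rats[OF assms(1)] rational_algebraic_int_is_int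
    by (auto simp: polys_over_def)
qed

text \<open>With \<open>x = u(\<theta>)\<close>, the only common root of \<open>f\<close> and
  \<open>u - x\<close> is \<theta>: any other root of \<open>f\<close> is some
  \<open>\<sigma> \<theta>\<close>, and \<open>\<sigma> x = x\<close> forces \<sigma> to be the
  inclusion.\<close>

lemma K_eq_adjoin_separating:
  assumes "separating x"
  shows "K = adjoin x"
proof
  have x: "x \<in> K" "inj_on (\<lambda>\<sigma>. \<sigma> x) E" using assms by (auto simp: separating_def)
  show "adjoin x \<subseteq> K" by (intro adjoin_subset F.complex_subring_axioms F.Rats_subset x)
  have "algebraic_num x" using x(1) algebraic_adjoin[of \<theta> x] K_eq theta_int algebraic_int_imp_algebraic_num by auto
  then interpret X: complex_subfield "adjoin x" by (rule adjoin_subfield)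
  obtain u where u: "u \<in> polys_over \<rat>" "x = poly u \<theta>" using x(1) by (rule mem_K_E)
  have "\<theta> \<in> adjoin x"
  proof (rule X.unique_common_root_mem)
    show "f \<in> polys_over (adjoin x)" using f_props polys_over_mono[OF X.Rats_subset] by blast
    show "rsquarefree f" using min_poly_Rats_rsquarefree f .
    show "poly f \<theta> = 0" using f_props by simp
    show "u - [:x:] \<in> polys_over (adjoin x)"
      using u polys_over_mono[OF X.Rats_subset] gen_mem_adjoin
      by (intro X.poly_diff_mem X.poly_const_mem) auto
    show "poly (u - [:x:]) \<theta> = 0" using u by simp
    fix z assume z: "poly f z = 0" "poly (u - [:x:]) z = 0"
    obtain \<sigma> where s: "\<sigma> \<in> E" "\<sigma> \<theta> = z" using emb_exists[OF z(1)] by blast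
    have "\<sigma> x = x" using emb_poly[OF s(1) u(1) theta_mem] u z s by simp
    hence "\<sigma> = idE" using inj_onD[OF x(2), of \<sigma> idE] s(1) idE_mem idE_apply x(1) by simp
    thus "z = \<theta>" using s idE_apply theta_mem by simp
  qed
  thus "K \<subseteq> adjoin x" unfolding K_eq by (intro adjoin_subset adjoin_subring Rats_subset_adjoin)
qed

definition Nm :: "complex \<Rightarrow> complex" where "Nm x = (\<Prod>\<sigma>\<in>E. \<sigma> x)"

lemma poly_emb_poly_of_0: "poly (emb_poly_of x) 0 = (- 1) ^ d * Nm x"
  by (simp add: emb_poly_of_def Nm_def poly_prod d_def prod_uminus)

lemma Nm_mult: "x \<in> K \<Longrightarrow> y \<in> K \<Longrightarrow> Nm (x * y) = Nm x * Nm y"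
  by (simp add: Nm_def emb_mult prod.distrib)

lemma emb_nonzero: "\<sigma> \<in> E \<Longrightarrow> x \<in> K \<Longrightarrow> x \<noteq> 0 \<Longrightarrow> \<sigma> x \<noteq> 0"
  using emb_mult[of \<sigma> x "inverse x"] F.inverse_mem emb_1[of \<sigma>] by auto

lemma Nm_nonzero: "x \<in> K \<Longrightarrow> x \<noteq> 0 \<Longrightarrow> Nm x \<noteq> 0"
  unfolding Nm_def using finite_E emb_nonzero by (auto simp: prod_zero_iff)

lemma Nm_0: "Nm 0 = 0"
  unfolding Nm_def using finite_E idE_mem emb_0 by (auto simp: prod_zero_iff)

lemma Nm_1: "Nm 1 = 1" by (simp add: Nm_def emb_1)

text \<open>The witness is a shift \<open>\<theta> + n\<close>, separating because \<theta> is. If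
  \<sigma> and \<tau> agree on \<open>x z\<close> but not on \<open>x\<close>, then \<open>n\<close>
  has one particular value; if they agree on both, they agree on \<theta>.\<close>

lemma ex_separating_multiplier:
  assumes "x \<in> K" "x \<noteq> 0"
  shows "\<exists>z. algebraic_int z \<and> z \<noteq> 0 \<and> separating z \<and> separating (x * z)"
proof -
  \<comment> \<open>The values of \<open>n\<close> to avoid: \<open>- \<theta>\<close> would make
    \<open>z\<close> zero, and each quotient is the one \<open>n\<close> at which \<sigma> and
    \<tau> could collide on \<open>x z\<close>.\<close>
  define B where "B = insert (- \<theta>) ((\<lambda>(\<sigma>, \<tau>). (\<tau> (x * \<theta>) - \<sigma> (x * \<theta>)) / (\<sigma> x - \<tau> x)) ` (E \<times> E))"
  have "finite B" unfolding B_def using finite_E by simp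
  moreover have "infinite (range (of_nat :: nat \<Rightarrow> complex))"
    by (simp add: finite_image_iff inj_of_nat)
  ultimately have "\<not> range (of_nat :: nat \<Rightarrow> complex) \<subseteq> B" using finite_subset by blast
  then obtain n :: nat where n: "of_nat n \<notin> B" by blast
  define z where "z = \<theta> + of_nat n"
  have zK: "z \<in> K" unfolding z_def by (intro F.add_mem theta_mem F.of_nat_mem)
  have "algebraic_int z" unfolding z_def using theta_int A.add_mem A.of_nat_mem by auto
  moreover have "z \<noteq> 0"
  proof
    assume "z = 0"
    hence "of_nat n = - \<theta>" by (simp add: z_def eq_neg_iff_add_eq_0 add.commute)
    thus False using n by (simp add: B_def)
  qed
  moreover have "separating z"
    unfolding separating_def using zK emb_eqI
  proof (safe intro!: inj_onI)
    fix \<sigma> \<tau> assume st: "\<sigma> \<in> E" "\<tau> \<in> E" "\<sigma> z = \<tau> z"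
    hence "\<sigma> \<theta> = \<tau> \<theta>"
      unfolding z_def by (simp add: emb_add[OF st(1)] emb_add[OF st(2)] emb_of_nat[OF st(1)] emb_of_nat[OF st(2)]
        theta_mem F.of_nat_mem)
    thus "\<sigma> = \<tau>" using st emb_eqI by blast
  qed
  moreover have "inj_on (\<lambda>\<sigma>. \<sigma> (x * z)) E"
  proof (rule inj_onI)
    fix \<sigma> \<tau> assume st: "\<sigma> \<in> E" "\<tau> \<in> E" "\<sigma> (x * z) = \<tau> (x * z)"
    have ex: "\<rho> (x * z) = \<rho> (x * \<theta>) + \<rho> x * of_nat n" if "\<rho> \<in> E" for \<rho>
      using that assms theta_mem
      by (simp add: z_def distrib_left emb_add[OF that] emb_mult[OF that] F.mult_mem F.of_nat_mem emb_of_nat[OF that])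
    have "\<sigma> x = \<tau> x"
    proof (rule ccontr)
      assume "\<sigma> x \<noteq> \<tau> x"
      moreover have "of_nat n * (\<sigma> x - \<tau> x) = \<tau> (x * \<theta>) - \<sigma> (x * \<theta>)"
        using ex[OF st(1)] ex[OF st(2)] st(3) by (simp add: algebra_simps)
      ultimately have "of_nat n = (\<tau> (x * \<theta>) - \<sigma> (x * \<theta>)) / (\<sigma> x - \<tau> x)"
        by (simp add: nonzero_eq_divide_eq)
      hence "of_nat n \<in> B" unfolding B_def using st by auto
      thus False using n by simp
    qed
    hence "\<sigma> \<theta> = \<tau> \<theta>" using st ex[of \<sigma>] ex[of \<tau>] assms theta_mem emb_nonzero[of \<tau> x]
      by (simp add: emb_mult[OF st(1)] emb_mult[OF st(2)])
    thus "\<sigma> = \<tau>" using st emb_eqI by blast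
  qed
  ultimately show ?thesis using assms zK F.mult_mem unfolding separating_def by blast
qed

lemma Nm_Rats_separating:
  assumes "separating x"
  shows "Nm x \<in> \<rat>"
proof -
  have "poly (emb_poly_of x) 0 \<in> \<rat>" using emb_poly_of_Rats[OF assms] by (intro Q.poly_eval_mem) auto
  thus ?thesis unfolding poly_emb_poly_of_0 by (cases "even d") auto
qed

lemma Nm_Rats:
  assumes "x \<in> K"
  shows "Nm x \<in> \<rat>"
proof (cases "x = 0")
  case False
  then obtain z where z: "z \<noteq> 0" "separating z" "separating (x * z)"
    using ex_separating_multiplier assms by blast
  have zK: "z \<in> K" using z by (simp add: separating_def)
  have "Nm x = Nm (x * z) / Nm z" using Nm_mult[OF assms zK] Nm_nonzero[OF zK z(1)] by simp
  thus ?thesis using z Nm_Rats_separating by simp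
qed (simp add: Nm_0)

lemma Nm_algebraic_int: "x \<in> K \<Longrightarrow> algebraic_int x \<Longrightarrow> algebraic_int (Nm x)"
  unfolding Nm_def using emb_algebraic_int A.prod_mem[of E "\<lambda>\<sigma>. \<sigma> x"] by auto

lemma Nm_Ints: "x \<in> K \<Longrightarrow> algebraic_int x \<Longrightarrow> Nm x \<in> \<int>"
  using Nm_Rats Nm_algebraic_int rational_algebraic_int_is_int by blast

text \<open>The product of the other conjugates is an algebraic integer, and it lies in
  \<open>K\<close> although its factors need not, because it equals the rational norm divided by
  \<open>x\<close>.\<close>

lemma Nm_cofactor:
  assumes "x \<in> K" "algebraic_int x" "x \<noteq> 0"
  shows "\<exists>y\<in>K. algebraic_int y \<and> Nm x = x * y"
proof -
  define y where "y = (\<Prod>\<sigma>\<in>E - {idE}. \<sigma> x)"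
  have eq: "Nm x = x * y"
    unfolding Nm_def y_def using prod.remove[OF finite_E idE_mem, of "\<lambda>\<sigma>. \<sigma> x"] idE_apply assms by simp
  hence "y = Nm x * inverse x" using assms by simp
  hence "y \<in> K" using Nm_Rats[OF assms(1)] F.Rats_subset assms by (auto intro!: F.mult_mem F.inverse_mem)
  moreover have "algebraic_int y"
    unfolding y_def using emb_algebraic_int assms A.prod_mem[of "E - {idE}" "\<lambda>\<sigma>. \<sigma> x"] by auto
  ultimately show ?thesis using eq by blast
qed

text \<open>Lagrange interpolation at the conjugates of \<open>x\<close>, cleared of denominators.\<close>

lemma order_contains_multiple:
  assumes sep: "separating x" and xint: "algebraic_int x"
  shows "\<exists>D::int. D \<noteq> 0 \<and> (\<forall>y\<in>K. algebraic_int y \<longrightarrow> of_int D * y \<in> (\<lambda>p. poly p x) ` polys_over \<int>)"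
proof -
  have x: "x \<in> K" "inj_on (\<lambda>\<sigma>. \<sigma> x) E" using sep by (auto simp: separating_def)
  \<comment> \<open>The Lagrange denominator at the node \<open>\<sigma> x\<close>; the product
    \<Delta> clears all of them at once.\<close>
  define \<delta> where "\<delta> \<sigma> = (\<Prod>\<tau>\<in>E - {\<sigma>}. \<sigma> x - \<tau> x)" for \<sigma>
  define \<Delta> where "\<Delta> = (\<Prod>\<sigma>\<in>E. \<delta> \<sigma>)"
  have conj_int: "algebraic_int (\<sigma> x)" if "\<sigma> \<in> E" for \<sigma> using emb_algebraic_int that x xint by blast
  have d_int: "algebraic_int (\<delta> \<sigma>)" if "\<sigma> \<in> E" for \<sigma>
    unfolding \<delta>_def using that conj_int A.diff_mem A.prod_mem[of "E - {\<sigma>}" "\<lambda>\<tau>. \<sigma> x - \<tau> x"] by auto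
  have "algebraic_int \<Delta>" unfolding \<Delta>_def using d_int A.prod_mem[of E \<delta>] by auto
  moreover have "\<Delta> \<noteq> 0"
    unfolding \<Delta>_def \<delta>_def using finite_E x(2) by (auto simp: prod_zero_iff inj_on_def)
  \<comment> \<open>\<Delta> is only known to be a nonzero algebraic integer, so it is replaced by a
    nonzero rational integer multiple.\<close>
  ultimately obtain D :: int and \<epsilon> where D: "D \<noteq> 0" "algebraic_int \<epsilon>" "of_int D = \<Delta> * \<epsilon>"
    using algebraic_int_dvd_int by blast
  define L where "L \<sigma> = Polynomial.smult (\<Prod>\<rho>\<in>E - {\<sigma>}. \<delta> \<rho>) (\<Prod>\<tau>\<in>E - {\<sigma>}. [:- \<tau> x, 1:])" for \<sigma>
  have L_mem: "L \<sigma> \<in> polys_over {x. algebraic_int x}" if "\<sigma> \<in> E" for \<sigma>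
    unfolding L_def using conj_int d_int A.uminus_mem A.one_mem
    by (intro A.poly_smult_mem A.prod_mem A.poly_prod_mem A.pCons_mem A.poly_0_mem) auto
  have L_deg: "degree (L \<sigma>) < d" if "\<sigma> \<in> E" for \<sigma>
  proof -
    have "degree (L \<sigma>) \<le> (\<Sum>\<tau>\<in>E - {\<sigma>}. degree [:- \<tau> x, 1:])"
      unfolding L_def using finite_E
      by (intro order_trans[OF degree_smult_le] order_trans[OF degree_prod_sum_le]) (auto simp: o_def)
    also have "\<dots> < d" using that finite_E d_pos by (simp add: d_def)
    finally show ?thesis .
  qed
  have L_val: "poly (L \<sigma>) (\<rho> x) = (if \<rho> = \<sigma> then \<Delta> else 0)" if "\<sigma> \<in> E" "\<rho> \<in> E" for \<sigma> \<rho>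
  proof (cases "\<rho> = \<sigma>")
    case True
    have "\<Delta> = \<delta> \<sigma> * (\<Prod>\<rho>\<in>E - {\<sigma>}. \<delta> \<rho>)"
      unfolding \<Delta>_def using that finite_E by (simp add: prod.remove)
    thus ?thesis using True by (simp add: L_def poly_prod \<delta>_def mult_ac)
  next
    case False
    hence "(\<Prod>\<tau>\<in>E - {\<sigma>}. \<rho> x - \<tau> x) = 0"
      using that finite_E by (auto simp: prod_zero_iff)
    thus ?thesis using False by (simp add: L_def poly_prod)
  qed
  have "of_int D * y \<in> (\<lambda>p. poly p x) ` polys_over \<int>" if y: "y \<in> K" "algebraic_int y" for y
  proof -
    obtain p0 where p0: "p0 \<in> polys_over \<rat>" "y = poly p0 x"
      using y(1) unfolding K_eq_adjoin_separating[OF sep] adjoin_def by blast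
    obtain r p where p: "p \<in> polys_over \<rat>" "p0 = emb_poly_of x * r + p" "p = 0 \<or> degree p < d"
      using Q.monic_division[OF emb_poly_of_Rats[OF sep] emb_poly_of_props(2) p0(1)]
      unfolding emb_poly_of_props(1) by blast
    have px: "poly p x = y"
      using p p0 emb_poly_of_props(3)[OF idE_mem, of x] idE_apply x by simp
    \<comment> \<open>The interpolation polynomial with value \<Delta> times \<open>\<rho> y\<close>
      at \<open>\<rho> x\<close>. Its coefficients are visibly algebraic integers, those of
      \<open>p\<close> are rational; equating the two forms of \<open>\<Delta> p\<close> combines
      both facts.\<close>
    define q where "q = (\<Sum>\<sigma>\<in>E. Polynomial.smult (\<sigma> y) (L \<sigma>))"
    have qeq: "Polynomial.smult \<Delta> p = q"
    proof (rule poly_eqI_degree[of "(\<lambda>\<sigma>. \<sigma> x) ` E"])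
      have card: "card ((\<lambda>\<sigma>. \<sigma> x) ` E) = d" using card_image[OF x(2)] by (simp add: d_def)
      show "degree (Polynomial.smult \<Delta> p) < card ((\<lambda>\<sigma>. \<sigma> x) ` E)"
        unfolding card using p(3) d_pos le_less_trans[OF degree_smult_le] by fastforce
      have "degree q \<le> d - 1"
        unfolding q_def using L_deg by (intro degree_sum_le finite_E order_trans[OF degree_smult_le]) fastforce
      thus "degree q < card ((\<lambda>\<sigma>. \<sigma> x) ` E)" using card d_pos by simp
      fix z assume "z \<in> (\<lambda>\<sigma>. \<sigma> x) ` E"
      then obtain \<rho> where \<rho>: "\<rho> \<in> E" "z = \<rho> x" by blast
      have "poly p (\<rho> x) = \<rho> y" using emb_poly[OF \<rho>(1) p(1) x(1)] px by simp
      thus "poly (Polynomial.smult \<Delta> p) z = poly q z"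
      proof -
        have "poly q z = (\<Sum>\<sigma>\<in>E. if \<sigma> = \<rho> then \<rho> y * \<Delta> else 0)"
          unfolding q_def poly_sum \<rho>(2)
        proof (rule sum.cong)
          fix \<sigma> assume "\<sigma> \<in> E"
          thus "poly (Polynomial.smult (\<sigma> y) (L \<sigma>)) (\<rho> x) = (if \<sigma> = \<rho> then \<rho> y * \<Delta> else 0)"
            using L_val[OF \<open>\<sigma> \<in> E\<close> \<rho>(1)] by auto
        qed simp
        thus ?thesis
          using \<rho> finite_E \<open>poly p (\<rho> x) = \<rho> y\<close> by simp
      qed
    qed
    have "q \<in> polys_over {x. algebraic_int x}"
      unfolding q_def using L_mem emb_algebraic_int y by (intro A.poly_sum_mem A.poly_smult_mem) auto
    hence "algebraic_int (\<epsilon> * (\<Delta> * coeff p i))" for i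
      using algebraic_int_mult[OF D(2), of "coeff q i"] unfolding polys_over_def by (simp flip: qeq)
    hence "algebraic_int (of_int D * coeff p i)" for i by (simp add: D(3) mult_ac)
    hence "of_int D * coeff p i \<in> \<int>" for i
      using p(1) by (intro rational_algebraic_int_is_int Rats_mult) (auto simp: polys_over_def)
    hence "Polynomial.smult (of_int D) p \<in> polys_over \<int>" by (simp add: polys_over_def)
    thus ?thesis using px by (intro image_eqI[of _ _ "Polynomial.smult (of_int D) p"]) auto
  qed
  thus ?thesis using D(1) by blast
qed

end

section \<open>The norm as an index\<close>

definition add_subgroup :: "complex set \<Rightarrow> bool" where
  "add_subgroup A \<longleftrightarrow> 0 \<in> A \<and> (\<forall>x\<in>A. \<forall>y\<in>A. x - y \<in> A)"

lemma add_subgroupD: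
  assumes "add_subgroup A"
  shows "0 \<in> A" "x \<in> A \<Longrightarrow> y \<in> A \<Longrightarrow> x - y \<in> A" "x \<in> A \<Longrightarrow> - x \<in> A"
    "x \<in> A \<Longrightarrow> y \<in> A \<Longrightarrow> x + y \<in> A"
proof -
  show d: "x - y \<in> A" if "x \<in> A" "y \<in> A" for x y
    using assms that by (auto simp: add_subgroup_def)
  show "0 \<in> A" using assms by (auto simp: add_subgroup_def)
  hence u: "- x \<in> A" if "x \<in> A" for x using d[of 0 x] that by simp
  show "x \<in> A \<Longrightarrow> - x \<in> A" by (rule u)
  show "x \<in> A \<Longrightarrow> y \<in> A \<Longrightarrow> x + y \<in> A" using d[of x "- y"] u[of y] by simp
qed

text \<open>The order \<open>b + a\<close> mirrors the right cosets of a factor ring, so that the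
  two agree by unfolding in \<open>card_Quot_PIdl\<close>.\<close>

definition coset_of :: "complex set \<Rightarrow> complex \<Rightarrow> complex set" where
  "coset_of B a = (\<lambda>b. b + a) ` B"

definition cosets :: "complex set \<Rightarrow> complex set \<Rightarrow> complex set set" where
  "cosets A B = coset_of B ` A"

text \<open>An infinite index reads as 0. A nonzero value therefore expresses finiteness, and the
  tower law holds without finiteness assumptions.\<close>

definition subgroup_index :: "complex set \<Rightarrow> complex set \<Rightarrow> nat" where
  "subgroup_index A B = card (cosets A B)"

lemma coset_of_eq_iff:
  assumes "add_subgroup B"
  shows "coset_of B x = coset_of B y \<longleftrightarrow> x - y \<in> B"
proof
  assume "coset_of B x = coset_of B y"
  moreover have "x \<in> coset_of B x"
    unfolding coset_of_def using add_subgroupD(1)[OF assms] by (intro image_eqI[of _ _ 0]) auto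
  ultimately show "x - y \<in> B" by (auto simp: coset_of_def)
next
  have *: "coset_of B x \<subseteq> coset_of B y" if "x - y \<in> B" for x y
    unfolding coset_of_def
  proof safe
    fix b assume "b \<in> B"
    thus "b + x \<in> (\<lambda>b. b + y) ` B"
      using add_subgroupD(4)[OF assms _ that] by (intro image_eqI[of _ _ "b + (x - y)"]) auto
  qed
  assume "x - y \<in> B"
  moreover from this have "y - x \<in> B" using add_subgroupD(3)[OF assms, of "x - y"] by simp
  ultimately show "coset_of B x = coset_of B y" using * by blast
qed

text \<open>\<open>\<psi>\<close> is a complete invariant of the cosets and not a homomorphism, so
  it may be built from arbitrarily chosen representatives.\<close>

lemma subgroup_index_eq_card:
  assumes "add_subgroup B" "\<psi> ` A = T" "\<And>x y. x \<in> A \<Longrightarrow> y \<in> A \<Longrightarrow> \<psi> x = \<psi> y \<longleftrightarrow> x - y \<in> B"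
  shows "subgroup_index A B = card T"
proof -
  have "bij_betw (\<lambda>Y. \<psi> (SOME a. a \<in> A \<and> coset_of B a = Y)) (cosets A B) T"
  proof -
    define r where "r Y = (SOME a. a \<in> A \<and> coset_of B a = Y)" for Y
    have r: "r (coset_of B a) \<in> A" "\<psi> (r (coset_of B a)) = \<psi> a" if "a \<in> A" for a
    proof -
      have *: "r (coset_of B a) \<in> A \<and> coset_of B (r (coset_of B a)) = coset_of B a"
        unfolding r_def by (rule someI[of _ a]) (use that in simp)
      thus "r (coset_of B a) \<in> A" by simp
      thus "\<psi> (r (coset_of B a)) = \<psi> a" using * assms(3) that coset_of_eq_iff[OF assms(1)] by simp
    qed
    have "bij_betw (\<lambda>Y. \<psi> (r Y)) (cosets A B) T"
    proof (rule bij_betw_imageI)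
      show "inj_on (\<lambda>Y. \<psi> (r Y)) (cosets A B)"
        unfolding cosets_def
        by (rule inj_onI) (auto simp: r assms(3) simp flip: coset_of_eq_iff[OF assms(1)])
      show "(\<lambda>Y. \<psi> (r Y)) ` cosets A B = T"
        unfolding cosets_def image_image assms(2)[symmetric] using r by (intro image_cong) auto
    qed
    thus ?thesis by (simp add: r_def)
  qed
  thus ?thesis unfolding subgroup_index_def by (rule bij_betw_same_card)
qed

text \<open>The invariant of \<open>a\<close> is the pair of its coset modulo \<open>C\<close> and
  the coset modulo \<open>B\<close> of its difference to the chosen representative of the
  former.\<close>

lemma subgroup_index_mult:
  assumes A: "add_subgroup A" and B: "add_subgroup B" and C: "add_subgroup C" and sub: "B \<subseteq> C" "C \<subseteq> A"
  shows "subgroup_index A B = subgroup_index A C * subgroup_index C B"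
proof -
  define r where "r Y = (SOME a. a \<in> A \<and> coset_of C a = Y)" for Y
  have r: "r (coset_of C a) \<in> A" "a - r (coset_of C a) \<in> C" if "a \<in> A" for a
  proof -
    have *: "r (coset_of C a) \<in> A \<and> coset_of C (r (coset_of C a)) = coset_of C a"
      unfolding r_def by (rule someI[of _ a]) (use that in simp)
    thus "r (coset_of C a) \<in> A" "a - r (coset_of C a) \<in> C"
      using coset_of_eq_iff[OF C, of a] by auto
  qed
  define \<psi> where "\<psi> a = (coset_of C a, coset_of B (a - r (coset_of C a)))" for a
  have "subgroup_index A B = card (cosets A C \<times> cosets C B)"
  proof (rule subgroup_index_eq_card[OF B])
    show "\<psi> ` A = cosets A C \<times> cosets C B"
    proof (intro equalityI subsetI)
      fix z assume "z \<in> \<psi> ` A"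
      thus "z \<in> cosets A C \<times> cosets C B" using r by (auto simp: \<psi>_def cosets_def)
    next
      fix z assume "z \<in> cosets A C \<times> cosets C B"
      then obtain a c where z: "z = (coset_of C a, coset_of B c)" "a \<in> A" "c \<in> C"
        by (auto simp: cosets_def)
      define a' where "a' = r (coset_of C a) + c"
      have "a' - a \<in> C" using add_subgroupD(2)[OF C z(3) r(2)[OF z(2)]] by (simp add: a'_def algebra_simps)
      hence eq: "coset_of C a' = coset_of C a" using coset_of_eq_iff[OF C] by blast
      hence "\<psi> a' = z" by (simp add: \<psi>_def z(1)) (simp add: a'_def)
      moreover have "a' \<in> A" unfolding a'_def using add_subgroupD(4)[OF A] r(1) z sub by blast
      ultimately show "z \<in> \<psi> ` A" by blast
    qed
    fix x y assume xy: "x \<in> A" "y \<in> A"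
    show "\<psi> x = \<psi> y \<longleftrightarrow> x - y \<in> B"
    proof (cases "coset_of C x = coset_of C y")
      case True
      thus ?thesis by (simp add: \<psi>_def coset_of_eq_iff[OF B])
    next
      case False
      thus ?thesis using coset_of_eq_iff[OF C] sub by (auto simp: \<psi>_def)
    qed
  qed
  thus ?thesis by (simp add: subgroup_index_def card_cartesian_product)
qed

lemma add_subgroup_scale: "add_subgroup A \<Longrightarrow> add_subgroup ((*) z ` A)"
  unfolding add_subgroup_def by (auto simp: image_iff right_diff_distrib[symmetric])

lemma subgroup_index_scale:
  assumes "z \<noteq> 0" "add_subgroup B"
  shows "subgroup_index ((*) z ` A) ((*) z ` B) = subgroup_index A B"
  unfolding subgroup_index_def[of A B]
proof (rule subgroup_index_eq_card[OF add_subgroup_scale[OF assms(2)]])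
  show "(\<lambda>x. coset_of B (x / z)) ` (*) z ` A = cosets A B"
    using assms(1) by (auto simp: cosets_def image_image)
  fix x y assume "x \<in> (*) z ` A" "y \<in> (*) z ` A"
  then obtain a b where "x = z * a" "y = z * b" by blast
  thus "coset_of B (x / z) = coset_of B (y / z) \<longleftrightarrow> x - y \<in> (*) z ` B"
    using assms by (auto simp: coset_of_eq_iff right_diff_distrib[symmetric])
qed

section \<open>The index of a principal ideal in the ring of integers\<close>

context integral_primitive
begin

abbreviation "\<O> \<equiv> {x \<in> K. algebraic_int x}"

definition order_of :: "complex \<Rightarrow> complex set" where
  "order_of x = (\<lambda>p. poly p x) ` polys_over \<int>"

lemma add_subgroup_O: "add_subgroup \<O>"
  using F.zero_mem A.zero_mem F.diff_mem A.diff_mem by (auto simp: add_subgroup_def)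

lemma add_subgroup_order: "add_subgroup (order_of x)"
  unfolding add_subgroup_def
proof (intro conjI ballI)
  show "0 \<in> order_of x" unfolding order_of_def by (intro image_eqI[of _ _ 0]) (auto simp: Z.poly_0_mem)
  fix y z assume "y \<in> order_of x" "z \<in> order_of x"
  then obtain p q where p: "p \<in> polys_over \<int>" "q \<in> polys_over \<int>" "y = poly p x" "z = poly q x"
    by (auto simp: order_of_def)
  thus "y - z \<in> order_of x"
    unfolding order_of_def by (intro image_eqI[of _ _ "p - q"]) (auto intro: Z.poly_diff_mem)
qed

lemma order_subset_O:
  assumes "x \<in> \<O>" shows "order_of x \<subseteq> \<O>"
proof
  fix y assume "y \<in> order_of x"
  then obtain p where p: "p \<in> polys_over \<int>" "y = poly p x" by (auto simp: order_of_def)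
  thus "y \<in> \<O>"
    using assms F.poly_eval_mem[of p x] A.poly_eval_mem[of p x] polys_over_mono[OF F.Ints_subset]
      polys_over_mono[OF A.Ints_subset] by auto
qed

lemma order_reduce:
  assumes "separating x" "algebraic_int x" "y \<in> order_of x"
  obtains c :: "nat \<Rightarrow> int" where "y = (\<Sum>i<d. of_int (c i) * x ^ i)"
proof -
  obtain p0 where p0: "p0 \<in> polys_over \<int>" "y = poly p0 x" using assms(3) by (auto simp: order_of_def)
  obtain r p where p: "p \<in> polys_over \<int>" "p0 = emb_poly_of x * r + p" "p = 0 \<or> degree p < d"
    using Z.monic_division[OF emb_poly_of_Ints[OF assms(1,2)] emb_poly_of_props(2) p0(1)]
    unfolding emb_poly_of_props(1) by blast
  have "y = poly p x"
    using p p0 emb_poly_of_props(3)[OF idE_mem, of x] idE_apply assms(1) by (simp add: separating_def)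
  also have "\<dots> = (\<Sum>i<d. coeff p i * x ^ i)"
    using p(3) d_pos unfolding poly_altdef by (intro sum.mono_neutral_left) (auto simp: coeff_eq_0)
  also have "\<dots> = (\<Sum>i<d. of_int \<lfloor>Re (coeff p i)\<rfloor> * x ^ i)"
  proof (rule sum.cong)
    fix i
    have "coeff p i \<in> \<int>" using p(1) by (auto simp: polys_over_def)
    then obtain n :: int where "coeff p i = of_int n" by (auto elim: Ints_cases)
    thus "coeff p i * x ^ i = of_int \<lfloor>Re (coeff p i)\<rfloor> * x ^ i" by simp
  qed simp
  finally show ?thesis by (rule that)
qed

lemma order_sum_mem: "(\<Sum>i<d. of_int (c i) * x ^ i) \<in> order_of x"
  unfolding order_of_def
  by (intro image_eqI[of _ _ "\<Sum>i<d. Polynomial.monom (of_int (c i)) i"] Z.poly_sum_mem Z.poly_monom_mem)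
    (auto simp: poly_sum poly_monom)

text \<open>Elements of the order have integer coordinates on the first \<open>d\<close> powers of
  \<open>x\<close>; reducing these modulo the absolute value of \<open>D\<close> leaves finitely
  many coset representatives.\<close>

lemma finite_cosets_order_scale:
  assumes "separating x" "algebraic_int x" "D \<noteq> 0"
  shows "subgroup_index (order_of x) ((*) (of_int D) ` order_of x) \<noteq> 0"
proof -
  let ?B = "(*) (of_int D) ` order_of x"
  have B: "add_subgroup ?B" by (intro add_subgroup_scale add_subgroup_order)
  define g where "g = (\<lambda>c. coset_of ?B (\<Sum>i<d. of_int (c i) * x ^ i))"
  have "cosets (order_of x) ?B \<subseteq> g ` ({..<d} \<rightarrow>\<^sub>E {0..<\<bar>D\<bar>})"
  proof
    fix Y assume "Y \<in> cosets (order_of x) ?B"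
    then obtain y where y: "y \<in> order_of x" "Y = coset_of ?B y" by (auto simp: cosets_def)
    obtain c where c: "y = (\<Sum>i<d. of_int (c i) * x ^ i)" using order_reduce[OF assms(1,2) y(1)] by blast
    define c' where "c' = (\<lambda>i\<in>{..<d}. c i mod \<bar>D\<bar>)"
    have "Y = g c'"
      unfolding y(2) g_def coset_of_eq_iff[OF B]
    proof (rule image_eqI)
      \<comment> \<open>The residues are taken modulo the absolute value of \<open>D\<close> while
        the multiple is one of \<open>D\<close>; \<open>sgn D\<close> makes up the
        difference.\<close>
      show "(\<Sum>i<d. of_int (sgn D * (c i div \<bar>D\<bar>)) * x ^ i) \<in> order_of x" by (rule order_sum_mem)
      have *: "of_int (c i) - of_int (c' i) = (of_int D * of_int (sgn D * (c i div \<bar>D\<bar>)) :: complex)" if "i < d" for i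
      proof -
        have "c i - c' i = \<bar>D\<bar> * (c i div \<bar>D\<bar>)" using that
          by (simp add: c'_def minus_mod_eq_mult_div)
        also have "\<dots> = D * (sgn D * (c i div \<bar>D\<bar>))" by (simp add: abs_sgn mult_ac)
        finally show ?thesis by (simp only: of_int_diff[symmetric] of_int_mult[symmetric])
      qed
      show "y - (\<Sum>i<d. of_int (c' i) * x ^ i) = of_int D * (\<Sum>i<d. of_int (sgn D * (c i div \<bar>D\<bar>)) * x ^ i)"
        unfolding c sum_subtractf[symmetric] left_diff_distrib[symmetric] sum_distrib_left
        by (rule sum.cong) (auto simp only: * mult.assoc lessThan_iff)
    qed
    moreover have "c' \<in> {..<d} \<rightarrow>\<^sub>E {0..<\<bar>D\<bar>}" using assms(3) by (auto simp: c'_def)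
    ultimately show "Y \<in> g ` ({..<d} \<rightarrow>\<^sub>E {0..<\<bar>D\<bar>})" by blast
  qed
  moreover have "finite ({..<d} \<rightarrow>\<^sub>E {0..<\<bar>D\<bar>})" by (intro finite_PiE) auto
  ultimately have "finite (cosets (order_of x) ?B)" using finite_subset by blast
  moreover have "cosets (order_of x) ?B \<noteq> {}"
    using add_subgroupD(1)[OF add_subgroup_order, of x] by (auto simp: cosets_def)
  ultimately show ?thesis by (simp add: subgroup_index_def)
qed

text \<open>The kernel of evaluation at \<open>x\<close> is generated by
  \<open>emb_poly_of x\<close> over the integers: the remainder of degree below \<open>d\<close>
  vanishes at \<open>d\<close> distinct conjugates.\<close>

lemma order_relation:
  assumes "separating x" "algebraic_int x" "p \<in> polys_over \<int>" "poly p x = 0"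
  shows "\<exists>r\<in>polys_over \<int>. p = emb_poly_of x * r"
proof -
  have x: "x \<in> K" "inj_on (\<lambda>\<sigma>. \<sigma> x) E" using assms by (auto simp: separating_def)
  obtain r t where rt: "r \<in> polys_over \<int>" "t \<in> polys_over \<int>" "p = emb_poly_of x * r + t" "t = 0 \<or> degree t < d"
    using Z.monic_division[OF emb_poly_of_Ints[OF assms(1,2)] emb_poly_of_props(2) assms(3)]
    unfolding emb_poly_of_props(1) by blast
  have "poly t x = 0"
    using rt(3) assms(4) emb_poly_of_props(3)[OF idE_mem, of x] idE_apply x by simp
  have "t = 0"
  proof (rule ccontr)
    assume "t \<noteq> 0"
    have "poly t (\<sigma> x) = 0" if "\<sigma> \<in> E" for \<sigma>
      using emb_poly[OF that _ x(1), of t] rt(2) polys_over_mono[OF Ints_subset_Rats] \<open>poly t x = 0\<close> emb_0[OF that]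
      by auto
    hence "(\<lambda>\<sigma>. \<sigma> x) ` E \<subseteq> {z. poly t z = 0}" by auto
    hence "d \<le> card {z. poly t z = 0}"
      unfolding d_def card_image[OF x(2), symmetric] using \<open>t \<noteq> 0\<close> by (intro card_mono poly_roots_finite)
    moreover have "card {z. poly t z = 0} \<le> degree t" using \<open>t \<noteq> 0\<close> by (rule card_poly_roots_bound)
    ultimately show False using rt(4) \<open>t \<noteq> 0\<close> by simp
  qed
  thus ?thesis using rt by auto
qed

text \<open>\<open>\<int>[x] / (x) = \<int>[X] / (F, X) = \<int> / F(0)\<close> for the monic polynomial \<open>F\<close> with roots the conjugates of \<open>x\<close>.\<close>

lemma index_order:
  assumes sep: "separating x" and xint: "algebraic_int x" and nz: "x \<noteq> 0"
  shows "real (subgroup_index (order_of x) ((*) x ` order_of x)) = cmod (Nm x)"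
proof -
  define F where "F = emb_poly_of x"
  have F: "F \<in> polys_over \<int>" "poly F x = 0"
    using emb_poly_of_Ints[OF sep xint] emb_poly_of_props(3)[OF idE_mem, of x] idE_apply sep
    by (auto simp: F_def separating_def)
  obtain F' where F': "F = pCons (coeff F 0) F'" by (metis coeff_pCons_0 pCons_cases)
  have F'm: "F' \<in> polys_over \<int>" using F F' Z.pCons_memD by metis
  obtain c :: int where c: "coeff F 0 = of_int c" using F(1) by (auto simp: polys_over_def elim: Ints_cases)
  have "of_int c = (- 1) ^ d * Nm x"
    using poly_emb_poly_of_0[of x] c by (simp add: F_def poly_0_coeff_0)
  hence Nmc: "Nm x = of_int c \<or> Nm x = - of_int c" by (cases "even d") simp_all
  have "c \<noteq> 0" using Nmc Nm_nonzero nz sep by (auto simp: separating_def)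
  \<comment> \<open>Evaluating \<open>F\<close> at \<open>x\<close> shows \<open>c\<close> to be a
    multiple of \<open>x\<close> within the order, so a constant term may change by multiples of
    \<open>c\<close> inside one coset.\<close>
  have ceq: "of_int c = x * (- poly F' x)"
    using F(2) c by (subst (asm) F') (simp add: eq_neg_iff_add_eq_0)
  have sgx: "add_subgroup ((*) x ` order_of x)" by (intro add_subgroup_scale add_subgroup_order)
  define P where "P = (\<lambda>y p. p \<in> polys_over \<int> \<and> y = poly p x)"
  have key: "poly p x - poly q x \<in> (*) x ` order_of x \<longleftrightarrow> (\<exists>k::int. coeff p 0 - coeff q 0 = of_int (c * k))"
    if pq: "p \<in> polys_over \<int>" "q \<in> polys_over \<int>" for p q
  proof
    assume "poly p x - poly q x \<in> (*) x ` order_of x"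
    then obtain r where r: "r \<in> polys_over \<int>" "poly p x - poly q x = x * poly r x"
      by (auto simp: order_of_def)
    have "p - q - pCons 0 r \<in> polys_over \<int>" using pq r by (intro Z.poly_diff_mem Z.pCons_mem) auto
    moreover have "poly (p - q - pCons 0 r) x = 0" using r by simp
    ultimately obtain t where t: "t \<in> polys_over \<int>" "p - q - pCons 0 r = F * t"
      using order_relation[OF sep xint] unfolding F_def by blast
    obtain k :: int where k: "coeff t 0 = of_int k" using t(1) by (auto simp: polys_over_def elim: Ints_cases)
    have "coeff (p - q - pCons 0 r) 0 = coeff F 0 * coeff t 0" unfolding t(2) by (simp add: coeff_mult_0)
    thus "\<exists>k::int. coeff p 0 - coeff q 0 = of_int (c * k)" using k c by auto
  next
    assume "\<exists>k::int. coeff p 0 - coeff q 0 = of_int (c * k)"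
    then obtain k :: int where k: "coeff p 0 - coeff q 0 = of_int (c * k)" by blast
    obtain a p' where p': "p = pCons a p'" by (cases p)
    obtain b q' where q': "q = pCons b q'" by (cases q)
    have mem: "p' \<in> polys_over \<int>" "q' \<in> polys_over \<int>" using pq p' q' Z.pCons_memD by auto
    have "poly p x - poly q x = (a - b) + x * (poly p' x - poly q' x)"
      unfolding p' q' by (simp add: algebra_simps)
    also have "a - b = of_int c * of_int k" using k by (simp add: p' q')
    also have "of_int c * of_int k + x * (poly p' x - poly q' x) = x * poly (p' - q' - Polynomial.smult (of_int k) F') x"
      unfolding ceq by (simp add: algebra_simps)
    finally show "poly p x - poly q x \<in> (*) x ` order_of x"
      using mem F'm unfolding order_of_def
      by (simp only:) (intro imageI Z.poly_diff_mem Z.poly_smult_mem Ints_of_int)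
  qed
  \<comment> \<open>The invariant reads the constant term, modulo \<open>c\<close>, of an arbitrary
    integer polynomial representing \<open>y\<close>; by \<open>key\<close> the choice does not
    matter. The floor of the real part only turns the complex coefficient into an integer.\<close>
  define \<psi> where "\<psi> y = \<lfloor>Re (coeff (SOME p. P y p) 0)\<rfloor> mod \<bar>c\<bar>" for y
  have P: "P y (SOME p. P y p)" if "y \<in> order_of x" for y
    using that someI_ex[of "P y"] by (auto simp: order_of_def P_def)
  have "subgroup_index (order_of x) ((*) x ` order_of x) = card {0..<\<bar>c\<bar>}"
  proof (rule subgroup_index_eq_card[OF sgx])
    have iff: "\<psi> y = \<psi> z \<longleftrightarrow> y - z \<in> (*) x ` order_of x" if yz: "y \<in> order_of x" "z \<in> order_of x" for y z
    proof -
      define p where "p = (SOME p. P y p)"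
      define q where "q = (SOME p. P z p)"
      have pq: "p \<in> polys_over \<int>" "y = poly p x" "q \<in> polys_over \<int>" "z = poly q x"
        using P[OF yz(1)] P[OF yz(2)] by (auto simp: P_def p_def q_def)
      obtain a b :: int where ab: "coeff p 0 = of_int a" "coeff q 0 = of_int b"
        using pq by (auto simp: polys_over_def elim!: Ints_cases) (metis Ints_cases)
      have "\<psi> y = \<psi> z \<longleftrightarrow> a mod \<bar>c\<bar> = b mod \<bar>c\<bar>" by (simp add: \<psi>_def p_def[symmetric] q_def[symmetric] ab)
      also have "\<dots> \<longleftrightarrow> c dvd a - b" by (simp add: mod_eq_dvd_iff)
      also have "\<dots> \<longleftrightarrow> (\<exists>k::int. coeff p 0 - coeff q 0 = of_int (c * k))"
        unfolding dvd_def ab of_int_diff[symmetric] of_int_eq_iff ..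
      finally show ?thesis using key[OF pq(1,3)] pq by simp
    qed
    thus "\<And>y z. y \<in> order_of x \<Longrightarrow> z \<in> order_of x \<Longrightarrow> \<psi> y = \<psi> z \<longleftrightarrow> y - z \<in> (*) x ` order_of x" by blast
    show "\<psi> ` order_of x = {0..<\<bar>c\<bar>}"
    proof (intro equalityI subsetI)
      fix k assume "k \<in> \<psi> ` order_of x"
      thus "k \<in> {0..<\<bar>c\<bar>}" using \<open>c \<noteq> 0\<close> by (auto simp: \<psi>_def)
    next
      fix k assume k: "k \<in> {0..<\<bar>c\<bar>}"
      have y: "of_int k \<in> order_of x"
        unfolding order_of_def by (intro image_eqI[of _ _ "[:of_int k:]"] Z.poly_const_mem) auto
      define p where "p = (SOME p. P (of_int k) p)"
      have p: "p \<in> polys_over \<int>" "of_int k = poly p x" using P[OF y] by (auto simp: P_def p_def)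
      obtain a :: int where a: "coeff p 0 = of_int a" using p by (auto simp: polys_over_def elim!: Ints_cases)
      have "poly p x - poly [:of_int k:] x \<in> (*) x ` order_of x"
        using p add_subgroupD(1)[OF sgx] by simp
      then obtain l :: int where "coeff p 0 - of_int k = of_int (c * l)"
        using key[OF p(1) Z.poly_const_mem[of "of_int k"]] by auto
      hence "a - k = c * l" unfolding a of_int_diff[symmetric] of_int_eq_iff .
      hence "c dvd a - k" by simp
      hence "a mod \<bar>c\<bar> = k mod \<bar>c\<bar>" by (simp add: mod_eq_dvd_iff)
      hence "\<psi> (of_int k) = k" using k by (simp add: \<psi>_def p_def[symmetric] a)
      thus "k \<in> \<psi> ` order_of x" using y by (metis image_eqI)
    qed
  qed
  thus ?thesis using Nmc by auto
qed

text \<open>A multiple \<open>G = D \<O>\<close> lies in the order \<open>L\<close> generated by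
  \<open>x\<close>. Computing the index of \<open>x G\<close> in \<open>L\<close> through
  \<open>G\<close> and through \<open>x L\<close> gives equal indices of \<open>x G\<close> in
  \<open>G\<close> and of \<open>x L\<close> in \<open>L\<close>; the former is the index for
  \<open>\<O>\<close> after scaling, the latter is \<open>index_order\<close>.\<close>

lemma index_separating:
  assumes sep: "separating x" and xint: "algebraic_int x" and nz: "x \<noteq> 0"
  shows "real (subgroup_index \<O> ((*) x ` \<O>)) = cmod (Nm x)"
proof -
  let ?L = "order_of x"
  have xK: "x \<in> \<O>" using sep xint by (simp add: separating_def)
  obtain D :: int where D: "D \<noteq> 0" "\<And>y. y \<in> \<O> \<Longrightarrow> of_int D * y \<in> ?L"
    using order_contains_multiple[OF sep xint] unfolding order_of_def by auto
  define G where "G = (*) (of_int D) ` \<O>"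
  have G: "add_subgroup G" unfolding G_def by (intro add_subgroup_scale add_subgroup_O)
  have GL: "G \<subseteq> ?L" using D by (auto simp: G_def)
  have L: "add_subgroup ?L" by (rule add_subgroup_order)
  have DL: "(*) (of_int D) ` ?L \<subseteq> G" unfolding G_def using order_subset_O[OF xK] by (intro image_mono)
  have "subgroup_index ?L ((*) (of_int D) ` ?L) = subgroup_index ?L G * subgroup_index G ((*) (of_int D) ` ?L)"
    by (rule subgroup_index_mult[OF L add_subgroup_scale[OF L] G DL GL])
  \<comment> \<open>Finiteness of this index is what permits cancelling it from the two
    computations.\<close>
  hence fin: "subgroup_index ?L G \<noteq> 0" using finite_cosets_order_scale[OF sep xint D(1)] by auto
  have xL: "(*) x ` ?L \<subseteq> ?L"
  proof safe
    fix y assume "y \<in> ?L"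
    then obtain p where "p \<in> polys_over \<int>" "y = poly p x" by (auto simp: order_of_def)
    thus "x * y \<in> ?L" unfolding order_of_def by (intro image_eqI[of _ _ "pCons 0 p"] Z.pCons_mem) auto
  qed
  have xG: "(*) x ` G \<subseteq> G"
    unfolding G_def using xK F.mult_mem A.mult_mem by (auto simp: image_iff mult.left_commute)
  have "subgroup_index ?L G * subgroup_index G ((*) x ` G) = subgroup_index ?L ((*) x ` G)"
    by (rule subgroup_index_mult[symmetric, OF L add_subgroup_scale[OF G] G xG GL])
  also have "\<dots> = subgroup_index ?L ((*) x ` ?L) * subgroup_index ((*) x ` ?L) ((*) x ` G)"
    by (rule subgroup_index_mult[OF L add_subgroup_scale[OF G] add_subgroup_scale[OF L] image_mono[OF GL] xL])
  also have "subgroup_index ((*) x ` ?L) ((*) x ` G) = subgroup_index ?L G"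
    by (rule subgroup_index_scale[OF nz G])
  finally have "subgroup_index G ((*) x ` G) = subgroup_index ?L ((*) x ` ?L)" using fin by simp
  moreover have "(*) x ` G = (*) (of_int D) ` (*) x ` \<O>"
    unfolding G_def image_image by (simp add: mult.left_commute)
  hence "subgroup_index G ((*) x ` G) = subgroup_index \<O> ((*) x ` \<O>)"
    unfolding G_def using subgroup_index_scale[of "of_int D" "(*) x ` \<O>" \<O>] D(1) add_subgroup_scale[OF add_subgroup_O]
    by simp
  ultimately show ?thesis using index_order[OF sep xint nz] by simp
qed

lemma index_O_mult:
  assumes "x \<in> \<O>" "y \<in> \<O>" "x \<noteq> 0"
  shows "subgroup_index \<O> ((*) (x * y) ` \<O>) = subgroup_index \<O> ((*) x ` \<O>) * subgroup_index \<O> ((*) y ` \<O>)"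
proof -
  have sub: "(*) z ` \<O> \<subseteq> \<O>" if "z \<in> \<O>" for z using that F.mult_mem A.mult_mem by auto
  have eq: "(*) (x * y) ` \<O> = (*) x ` (*) y ` \<O>" by (simp add: image_image mult.assoc)
  have "subgroup_index \<O> ((*) (x * y) ` \<O>) = subgroup_index \<O> ((*) x ` \<O>) * subgroup_index ((*) x ` \<O>) ((*) x ` (*) y ` \<O>)"
    unfolding eq
    by (intro subgroup_index_mult add_subgroup_scale add_subgroup_O image_mono sub assms)
  thus ?thesis using subgroup_index_scale[OF assms(3) add_subgroup_scale[OF add_subgroup_O]] by simp
qed

text \<open>An arbitrary \<open>x\<close> is the quotient of the separating elements \<open>x z\<close> and \<open>z\<close>, and both sides are multiplicative.\<close>

lemma index_eq_norm:
  assumes "x \<in> \<O>" "x \<noteq> 0"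
  shows "real (subgroup_index \<O> ((*) x ` \<O>)) = cmod (Nm x)"
proof -
  obtain z where z: "algebraic_int z" "z \<noteq> 0" "separating z" "separating (x * z)"
    using ex_separating_multiplier assms by blast
  have zO: "z \<in> \<O>" using z by (simp add: separating_def)
  have nz: "cmod (Nm z) \<noteq> 0" using Nm_nonzero zO z(2) by auto
  have "real (subgroup_index \<O> ((*) (x * z) ` \<O>)) = cmod (Nm (x * z))"
    using z assms A.mult_mem by (intro index_separating) auto
  also have "\<dots> = cmod (Nm x) * cmod (Nm z)" using Nm_mult assms zO by (simp add: norm_mult)
  finally have "real (subgroup_index \<O> ((*) x ` \<O>)) * cmod (Nm z) = cmod (Nm x) * cmod (Nm z)"
    using index_O_mult[OF assms(1) zO assms(2)] index_separating[OF z(3,1,2)] by simp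
  thus ?thesis using nz by simp
qed

end

section \<open>Factorization in rings of integers of class number one\<close>

lemma integers_of_simps [simp]:
  "carrier (integers_of K) = {x \<in> K. algebraic_int x}"
  "x \<otimes>\<^bsub>integers_of K\<^esub> y = x * y" "\<one>\<^bsub>integers_of K\<^esub> = 1"
  "\<zero>\<^bsub>integers_of K\<^esub> = 0" "x \<oplus>\<^bsub>integers_of K\<^esub> y = x + y"
  by (simp_all add: integers_of_def)

text \<open>Reconciles the special case in \<open>comp_norm\<close> with the product over
  embeddings, which over the rationals has one factor.\<close>

lemma embeddings_Rats:
  assumes "integral_primitive \<rat> \<theta> f"
  shows "embeddings \<rat> = {restrict (\<lambda>x. x) \<rat>}"
proof -
  interpret integral_primitive \<rat> \<theta> f by fact
  have "\<sigma> = idE" if "\<sigma> \<in> embeddings \<rat>" for \<sigma>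
  proof (rule extensionalityI[of _ \<rat>])
    show "\<sigma> \<in> extensional \<rat>" "idE \<in> extensional \<rat>" using that idE_mem by (auto simp: embeddings_iff)
    show "\<sigma> x = idE x" if "x \<in> \<rat>" for x using emb_Rats[OF \<open>\<sigma> \<in> embeddings \<rat>\<close> that] idE_apply that by simp
  qed
  thus ?thesis using idE_mem unfolding idE_def by blast
qed

text \<open>A positive integer multiple of a primitive element is integral and generates the same
  field.\<close>

lemma ex_integral_primitive:
  assumes "K = \<rat> \<or> number_field K"
  shows "\<exists>\<theta> f. integral_primitive K \<theta> f"
proof -
  obtain x where x: "algebraic_num x" "K = adjoin x"
    using assms number_field_adjoin Rats_eq_adjoin algebraic_num_Rats[of 0] by auto
  obtain D :: int where D: "D > 0" "algebraic_int (of_int D * x)" using algebraic_num_scale_int[OF x(1)] by blast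
  interpret X: complex_subring "adjoin x" by (rule adjoin_subring)
  interpret Y: complex_subring "adjoin (of_int D * x)" by (rule adjoin_subring)
  have "x = inverse (of_int D) * (of_int D * x)" using D by simp
  also have "\<dots> \<in> adjoin (of_int D * x)"
    by (intro Y.mult_mem[OF subsetD[OF Rats_subset_adjoin] gen_mem_adjoin] Rats_inverse) auto
  finally have "adjoin x \<subseteq> adjoin (of_int D * x)"
    by (intro adjoin_subset adjoin_subring Rats_subset_adjoin)
  moreover have "adjoin (of_int D * x) \<subseteq> adjoin x"
    by (intro adjoin_subset adjoin_subring Rats_subset_adjoin X.mult_mem X.of_int_mem gen_mem_adjoin)
  ultimately have "K = adjoin (of_int D * x)" using x by blast
  moreover obtain f where "min_poly_over \<rat> (of_int D * x) f"
    using ex_min_poly_Rats algebraic_int_imp_algebraic_num D by blast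
  ultimately show ?thesis using D unfolding integral_primitive_def by blast
qed

context integral_primitive
begin

abbreviation "R \<equiv> integers_of K"

sublocale \<O>: complex_subring \<O>
  by (rule complex_subring.intro)
    (simp_all add: F.zero_mem F.one_mem F.add_mem F.uminus_mem F.mult_mem algebraic_int_add algebraic_int_mult)

lemma cring_R: "cring R"
proof (rule cringI)
  show "abelian_group R"
  proof (rule abelian_groupI)
    fix x assume "x \<in> carrier R"
    thus "\<exists>y\<in>carrier R. y \<oplus>\<^bsub>R\<^esub> x = \<zero>\<^bsub>R\<^esub>" using \<O>.uminus_mem by (intro bexI[of _ "- x"]) auto
  qed (use \<O>.zero_mem \<O>.add_mem in \<open>auto simp: add_ac\<close>)
  show "comm_monoid R"
    by (rule comm_monoidI) (use \<O>.one_mem \<O>.mult_mem in \<open>auto simp: mult_ac\<close>)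
qed (auto simp: distrib_right)

lemma PIdl_eq: "PIdl\<^bsub>R\<^esub> x = (*) x ` \<O>"
  by (auto simp: cgenideal_def mult.commute)

lemma comp_norm_eq: "x \<in> K \<Longrightarrow> comp_norm K x = Nm x"
  using embeddings_Rats integral_primitive_axioms unfolding comp_norm_def Nm_def by auto

lemma card_Quot_PIdl:
  assumes "x \<in> \<O>" "x \<noteq> 0"
  shows "real (card (carrier (R Quot PIdl\<^bsub>R\<^esub> x))) = cmod (Nm x)"
proof -
  have "carrier (R Quot PIdl\<^bsub>R\<^esub> x) = cosets \<O> ((*) x ` \<O>)"
    unfolding FactRing_def PIdl_eq A_RCOSETS_def' cosets_def coset_of_def a_r_coset_def' by auto
  thus ?thesis using index_eq_norm[OF assms] by (simp add: subgroup_index_def)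
qed

text \<open>Complex conjugation pairs off the embeddings of a totally imaginary field.\<close>

lemma Nm_pos:
  assumes im: "totally_imaginary K" and x: "x \<in> K" "x \<noteq> 0"
  shows "\<exists>r>0. Nm x = complex_of_real r"
proof -
  have Im: "Im (\<sigma> \<theta>) \<noteq> 0" if s: "\<sigma> \<in> E" for \<sigma>
  proof
    assume "Im (\<sigma> \<theta>) = 0"
    hence real: "\<sigma> \<theta> \<in> \<real>" by (simp add: complex_is_Real_iff)
    interpret Re: complex_subring \<real> by unfold_locales auto
    have "\<sigma> y \<in> \<real>" if yK: "y \<in> K" for y
    proof -
      obtain p where p: "p \<in> polys_over \<rat>" "y = poly p \<theta>" using mem_K_E[OF yK] by blast
      have "\<rat> \<subseteq> (\<real> :: complex set)" by (auto elim!: Rats_cases')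
      hence "poly p (\<sigma> \<theta>) \<in> \<real>" using p(1) real polys_over_mono[of \<rat> \<real>] by (intro Re.poly_eval_mem) auto
      thus ?thesis using emb_poly[OF s p(1) theta_mem] p(2) by simp
    qed
    thus False using im s unfolding totally_imaginary_def by blast
  qed
  define c where "c \<sigma> = restrict (\<lambda>x. cnj (\<sigma> x)) K" for \<sigma> :: "complex \<Rightarrow> complex"
  have c: "c \<sigma> \<in> E" if "\<sigma> \<in> E" for \<sigma>
    using that by (simp add: embeddings_iff c_def F.one_mem F.mult_mem F.add_mem)
  have cc: "c (c \<sigma>) = \<sigma>" if "\<sigma> \<in> E" for \<sigma>
  proof (rule extensionalityI[of _ K])
    show "c (c \<sigma>) \<in> extensional K" by (simp add: c_def)
    show "\<sigma> \<in> extensional K" using that by (simp add: embeddings_iff)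
  qed (simp add: c_def)
  \<comment> \<open>The sign of the imaginary part at \<theta> selects one embedding from each
    conjugate pair; it never vanishes, since a real image of \<theta> makes the whole embedding
    real.\<close>
  define P where "P = {\<sigma> \<in> E. Im (\<sigma> \<theta>) > 0}"
  have bij: "bij_betw c P (E - P)"
  proof (rule bij_betw_byWitness[where f' = c])
    show "\<forall>\<sigma>\<in>P. c (c \<sigma>) = \<sigma>" "\<forall>\<sigma>\<in>E - P. c (c \<sigma>) = \<sigma>" using cc by (auto simp: P_def)
    show "c ` P \<subseteq> E - P" using c theta_mem by (auto simp: P_def c_def)
    show "c ` (E - P) \<subseteq> P"
    proof safe
      fix \<sigma> assume s: "\<sigma> \<in> E" "\<sigma> \<notin> P"
      hence "Im (\<sigma> \<theta>) < 0" using Im[OF s(1)] by (simp add: P_def)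
      thus "c \<sigma> \<in> P" using c[OF s(1)] theta_mem by (simp add: P_def c_def)
    qed
  qed
  have fin: "finite P" using finite_E by (simp add: P_def)
  have "Nm x = (\<Prod>\<sigma>\<in>P. \<sigma> x) * (\<Prod>\<sigma>\<in>E - P. \<sigma> x)"
    unfolding Nm_def using finite_E by (subst prod.subset_diff[of P]) (auto simp: P_def mult.commute)
  also have "(\<Prod>\<sigma>\<in>E - P. \<sigma> x) = (\<Prod>\<sigma>\<in>P. cnj (\<sigma> x))"
    unfolding prod.reindex_bij_betw[OF bij, symmetric] using x by (simp add: c_def)
  also have "(\<Prod>\<sigma>\<in>P. \<sigma> x) * (\<Prod>\<sigma>\<in>P. cnj (\<sigma> x)) = complex_of_real (\<Prod>\<sigma>\<in>P. (cmod (\<sigma> x))\<^sup>2)"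
    by (simp only: prod.distrib[symmetric] complex_norm_square[symmetric] of_real_prod)
  finally have "Nm x = complex_of_real (\<Prod>\<sigma>\<in>P. (cmod (\<sigma> x))\<^sup>2)" .
  moreover have "(\<Prod>\<sigma>\<in>P. (cmod (\<sigma> x))\<^sup>2) > 0"
    using emb_nonzero x by (intro prod_pos) (auto simp: P_def)
  ultimately show ?thesis by blast
qed

text \<open>On integers the norm is an integer and the floor changes nothing; a natural number is
  wanted as the measure for descent.\<close>

definition anorm :: "complex \<Rightarrow> nat" where "anorm x = nat \<lfloor>cmod (Nm x)\<rfloor>"

lemma anorm_eq: "Nm x = of_int n \<Longrightarrow> anorm x = nat \<bar>n\<bar>"
  by (simp add: anorm_def) (metis floor_of_int of_int_abs)

lemma real_anorm: "x \<in> \<O> \<Longrightarrow> real (anorm x) = cmod (Nm x)"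
  using Nm_Ints[of x] by (auto simp: anorm_eq elim!: Ints_cases)

lemma anorm_mult: "x \<in> \<O> \<Longrightarrow> y \<in> \<O> \<Longrightarrow> anorm (x * y) = anorm x * anorm y"
proof -
  assume xy: "x \<in> \<O>" "y \<in> \<O>"
  hence "real (anorm (x * y)) = real (anorm x * anorm y)"
    using real_anorm[OF \<O>.mult_mem[OF xy]] real_anorm[OF xy(1)] real_anorm[OF xy(2)] by (simp add: Nm_mult norm_mult)
  thus ?thesis by (simp only: of_nat_eq_iff)
qed

lemma anorm_eq_0: "x \<in> \<O> \<Longrightarrow> anorm x = 0 \<longleftrightarrow> x = 0"
proof -
  assume x: "x \<in> \<O>"
  have "anorm x = 0 \<longleftrightarrow> Nm x = 0" using real_anorm[OF x] by (metis norm_eq_zero of_nat_eq_0_iff)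
  thus ?thesis using x Nm_nonzero Nm_0 by auto
qed

text \<open>This is how rational primes enter the factorization: each ideal containing
  \<open>x\<close> contains the natural number \<open>anorm x\<close>.\<close>

lemma anorm_cofactor:
  assumes "x \<in> \<O>" shows "\<exists>y\<in>\<O>. of_nat (anorm x) = x * y"
proof (cases "x = 0")
  case True
  thus ?thesis using anorm_eq_0[OF assms] \<O>.zero_mem by auto
next
  case False
  obtain y where y: "y \<in> \<O>" "Nm x = x * y" using Nm_cofactor assms False by blast
  obtain n :: int where n: "Nm x = of_int n" using Nm_Ints assms by (auto elim: Ints_cases)
  have an: "anorm x = nat \<bar>n\<bar>" by (rule anorm_eq[OF n])
  show ?thesis
  proof (cases "n \<ge> 0")
    case True
    thus ?thesis using y n an by (intro bexI[of _ y]) auto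
  next
    case False
    thus ?thesis using y n an \<O>.uminus_mem by (intro bexI[of _ "- y"]) auto
  qed
qed

lemma anorm_of_nat: "anorm (of_nat q) = q ^ d"
  unfolding anorm_def Nm_def d_def
  by (simp add: emb_of_nat norm_power flip: of_nat_power cong: prod.cong)

lemma anorm_1_unit:
  assumes "x \<in> \<O>" shows "anorm x = 1 \<longleftrightarrow> (\<exists>y\<in>\<O>. x * y = 1)"
proof
  assume "anorm x = 1"
  moreover obtain y where y: "y \<in> \<O>" "of_nat (anorm x) = x * y" using anorm_cofactor[OF assms] by blast
  ultimately have "x * y = 1" by simp
  thus "\<exists>y\<in>\<O>. x * y = 1" using y(1) by blast
next
  assume "\<exists>y\<in>\<O>. x * y = 1"
  then obtain y where y: "y \<in> \<O>" "x * y = 1" by blast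
  have "anorm x * anorm y = anorm 1" using anorm_mult[OF assms y(1)] y(2) by simp
  also have "anorm 1 = 1" using anorm_of_nat[of 1] by simp
  finally show "anorm x = 1" by simp
qed

lemma carrier_PIdl_iff_unit:
  assumes "x \<in> \<O>" shows "PIdl\<^bsub>R\<^esub> x = \<O> \<longleftrightarrow> anorm x = 1"
  unfolding anorm_1_unit[OF assms] PIdl_eq
proof
  assume "(*) x ` \<O> = \<O>"
  hence "1 \<in> (*) x ` \<O>" using \<O>.one_mem by auto
  thus "\<exists>y\<in>\<O>. x * y = 1" by auto
next
  assume "\<exists>y\<in>\<O>. x * y = 1"
  then obtain y where y: "y \<in> \<O>" "x * y = 1" by blast
  have "z = x * (y * z)" for z using y by (simp flip: mult.assoc)
  hence "\<O> \<subseteq> (*) x ` \<O>" using \<O>.mult_mem y(1) by blast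
  thus "(*) x ` \<O> = \<O>" using \<O>.mult_mem assms by blast
qed

end

section \<open>Principality of the ideals in every component ring\<close>

lemma principal_Rats:
  assumes I: "ideal I (integers_of \<rat>)"
  shows "\<exists>g\<in>carrier (integers_of \<rat>). I = PIdl\<^bsub>integers_of \<rat>\<^esub> g"
proof -
  obtain \<theta> f where "integral_primitive \<rat> \<theta> f" using ex_integral_primitive by blast
  then interpret integral_primitive \<rat> \<theta> f .
  interpret I: ideal I "integers_of \<rat>" by fact
  have OZ: "\<O> = \<int>" using rational_algebraic_int_is_int by (auto elim!: Ints_cases)
  have mult: "a * x \<in> I" if "a \<in> I" "x \<in> \<int>" for a x using I.I_r_closed[of a x] that OZ by auto
  have add: "a + b \<in> I" if "a \<in> I" "b \<in> I" for a b using additive_subgroup.a_closed[OF I.is_additive_subgroup, of a b] that by simp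
  have sub: "I \<subseteq> \<int>" using I.Icarr OZ by auto
  have zero: "0 \<in> I" using additive_subgroup.zero_closed[OF I.is_additive_subgroup] by simp
  show ?thesis
  proof (cases "\<exists>n::nat. n > 0 \<and> of_nat n \<in> I")
    case True
    define n where "n = (LEAST n::nat. n > 0 \<and> of_nat n \<in> I)"
    have n: "n > 0" "of_nat n \<in> I" using LeastI_ex[OF True] by (auto simp: n_def)
    have least: "n \<le> k" if "k > 0" "of_nat k \<in> I" for k
      unfolding n_def using that by (intro Least_le) auto
    have "I = (*) (of_nat n) ` \<int>"
    proof (intro equalityI subsetI)
      fix x assume x: "x \<in> I"
      then obtain m :: int where m: "x = of_int m" using sub by (auto elim: Ints_cases)
      have "x + of_nat n * of_int (- (m div int n)) \<in> I" using x n by (intro add mult) auto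
      also have "x + of_nat n * of_int (- (m div int n)) = of_int (m mod int n)"
      proof -
        have "m + int n * - (m div int n) = m mod int n" using minus_mult_div_eq_mod[of m "int n"] by simp
        hence "(of_int (m + int n * - (m div int n)) :: complex) = of_int (m mod int n)" by (simp only:)
        thus ?thesis unfolding m by (simp only: of_int_add of_int_mult of_int_of_nat_eq)
      qed
      also have "\<dots> = of_nat (nat (m mod int n))" using n by simp
      finally have "of_nat (nat (m mod int n)) \<in> I" .
      moreover have "nat (m mod int n) < n" using n(1) by (simp add: nat_less_iff)
      ultimately have "\<not> nat (m mod int n) > 0" using least[of "nat (m mod int n)"] by linarith
      hence "m mod int n = 0" using n(1) pos_mod_sign[of "int n" m] by linarith
      hence "int n dvd m" by (rule dvd_eq_mod_eq_0[THEN iffD2])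
      then obtain k where "m = int n * k" by blast
      thus "x \<in> (*) (of_nat n) ` \<int>" by (intro image_eqI[of _ _ "of_int k"]) (auto simp: m)
    qed (use mult n in auto)
    thus ?thesis unfolding PIdl_eq OZ by (intro bexI[of _ "of_nat n"]) auto
  next
    case False
    have "x = 0" if x: "x \<in> I" for x
    proof -
      obtain m :: int where m: "x = of_int m" using x sub by (auto elim: Ints_cases)
      have "x * of_int (sgn m) \<in> I" using x by (intro mult) auto
      also have "x * of_int (sgn m) = of_int \<bar>m\<bar>"
        unfolding m of_int_mult[symmetric] of_int_eq_iff by (simp only: abs_sgn)
      also have "\<dots> = of_nat (nat \<bar>m\<bar>)" by simp
      finally have mem: "of_nat (nat \<bar>m\<bar>) \<in> I" .
      have "\<not> nat \<bar>m\<bar> > 0"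
      proof
        assume "nat \<bar>m\<bar> > 0"
        with mem have "\<exists>n::nat. n > 0 \<and> of_nat n \<in> I" by (intro exI conjI)
        with False show False ..
      qed
      thus ?thesis by (simp add: m)
    qed
    hence "I = {0}" using zero by blast
    thus ?thesis unfolding PIdl_eq OZ by (intro bexI[of _ 0]) auto
  qed
qed

context integral_primitive
begin

text \<open>A single class gives \<open>a I = b \<O>\<close> with \<open>a\<close>, \<open>b\<close>
  nonzero. Then \<open>b = a g\<close> for some \<open>g\<close> in \<open>I\<close>, and cancelling
  \<open>a\<close> shows that \<open>g\<close> generates \<open>I\<close>.\<close>

lemma principal_of_class_number:
  assumes cn: "class_number K = 1" and I: "ideal I R"
  shows "\<exists>g\<in>carrier R. I = PIdl\<^bsub>R\<^esub> g"
proof (cases "I = {0}")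
  case True
  thus ?thesis using PIdl_eq[of 0] \<O>.zero_mem by (intro bexI[of _ 0]) auto
next
  case False
  interpret R: cring R by (rule cring_R)
  let ?r = "ideal_class_rel K"
  have I': "I \<in> nonzero_ideals K" using I False by (simp add: nonzero_ideals_def)
  have O': "\<O> \<in> nonzero_ideals K"
  proof -
    have "\<O> \<noteq> {0}" using \<O>.one_mem by (metis singletonD zero_neq_one)
    thus ?thesis using R.oneideal by (simp add: nonzero_ideals_def)
  qed
  obtain S where "nonzero_ideals K // ?r = {S}"
    using cn unfolding class_number_def by (auto simp: card_1_singleton_iff)
  \<comment> \<open>\<open>\<O>\<close> is related to itself, so equality of the two images already
    puts the pair of \<open>I\<close> and \<open>\<O>\<close> into the relation.\<close>
  hence "?r `` {I} = ?r `` {\<O>}" using quotientI[OF I', of ?r] quotientI[OF O', of ?r] by auto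
  moreover have "(\<O>, \<O>) \<in> ?r"
    using O' \<O>.one_mem unfolding ideal_class_rel_def by (auto intro!: bexI[of _ 1])
  ultimately have "(I, \<O>) \<in> ?r" by blast
  then obtain a b where ab: "a \<in> \<O>" "a \<noteq> 0" "b \<in> \<O>" "b \<noteq> 0" "a <#\<^bsub>R\<^esub> I = b <#\<^bsub>R\<^esub> \<O>"
    unfolding ideal_class_rel_def by auto
  hence eq: "(*) a ` I = (*) b ` \<O>" by (simp add: l_coset_def UNION_singleton_eq_range)
  have "b * 1 \<in> (*) a ` I" unfolding eq using \<O>.one_mem by blast
  then obtain g where g: "g \<in> I" "b = a * g" by auto
  interpret I: ideal I R by fact
  have "I = (*) g ` \<O>"
  proof (intro equalityI subsetI)
    fix x assume "x \<in> I"
    hence "a * x \<in> (*) b ` \<O>" using eq by blast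
    then obtain y where "y \<in> \<O>" "a * x = b * y" by auto
    thus "x \<in> (*) g ` \<O>" using ab(2) g by auto
  next
    fix x assume "x \<in> (*) g ` \<O>"
    thus "x \<in> I" using I.I_r_closed[OF g(1)] by auto
  qed
  moreover have "g \<in> carrier R" using I.Icarr g by blast
  ultimately show ?thesis using PIdl_eq by blast
qed

end

text \<open>What the tuple argument takes from a factor of \<open>M\<close>: principal ideals for
  factorization, and control over the sign of the norm.\<close>

locale component =
  integral_primitive +
  assumes principal: "\<And>I. ideal I (integers_of K) \<Longrightarrow> \<exists>g\<in>carrier (integers_of K). I = PIdl\<^bsub>integers_of K\<^esub> g"
    and rat_or_imag: "K = \<rat> \<or> totally_imaginary K"
begin

text \<open>A divisor of \<open>v\<close> of least norm greater than \<open>1\<close> generates a prime ideal.\<close>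

lemma ex_prime_divisor:
  assumes v: "v \<in> \<O>" "anorm v > 1"
  shows "\<exists>\<pi>\<in>\<O>. primeideal (PIdl\<^bsub>R\<^esub> \<pi>) R \<and> v \<in> PIdl\<^bsub>R\<^esub> \<pi>"
proof -
  interpret R: cring R by (rule cring_R)
  define P where "P = (\<lambda>x. x \<in> \<O> \<and> anorm x > 1 \<and> v \<in> (*) x ` \<O>)"
  have "P v" using v \<O>.one_mem by (auto simp: P_def intro!: image_eqI[of _ _ 1])
  then obtain \<pi> where pi: "P \<pi>" "\<And>y. P y \<Longrightarrow> anorm \<pi> \<le> anorm y"
    using ex_has_least_nat[of P v anorm] by blast
  have piO: "\<pi> \<in> \<O>" using pi by (simp add: P_def)
  have "primeideal (PIdl\<^bsub>R\<^esub> \<pi>) R"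
  proof (rule primeidealI)
    show "ideal (PIdl\<^bsub>R\<^esub> \<pi>) R" using R.cgenideal_ideal piO by simp
    show "cring R" by (rule cring_R)
    show "carrier R \<noteq> PIdl\<^bsub>R\<^esub> \<pi>" using carrier_PIdl_iff_unit[OF piO] pi by (auto simp: P_def)
    fix a b assume ab: "a \<in> carrier R" "b \<in> carrier R" "a \<otimes>\<^bsub>R\<^esub> b \<in> PIdl\<^bsub>R\<^esub> \<pi>"
    show "a \<in> PIdl\<^bsub>R\<^esub> \<pi> \<or> b \<in> PIdl\<^bsub>R\<^esub> \<pi>"
    proof (rule disjCI)
      assume nb: "b \<notin> PIdl\<^bsub>R\<^esub> \<pi>"
      \<comment> \<open>Its generator \<open>g\<close> is a common divisor of \<open>b\<close> and
        \<pi>. If \<open>g\<close> is no unit, it also divides \<open>v\<close>, and minimality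
        makes it an associate of \<pi>, which then divides \<open>b\<close>. If \<open>g\<close> is
        a unit, 1 is a combination of \<open>b\<close> and \<pi>, and multiplying by
        \<open>a\<close> shows that \<pi> divides \<open>a\<close>.\<close>
      have "ideal (PIdl\<^bsub>R\<^esub> b <+>\<^bsub>R\<^esub> PIdl\<^bsub>R\<^esub> \<pi>) R"
        using ab piO by (intro R.add_ideals R.cgenideal_ideal) auto
      then obtain g where g: "g \<in> \<O>" "PIdl\<^bsub>R\<^esub> b <+>\<^bsub>R\<^esub> PIdl\<^bsub>R\<^esub> \<pi> = PIdl\<^bsub>R\<^esub> g"
        using principal by auto
      have elts: "z \<in> (*) g ` \<O> \<longleftrightarrow> (\<exists>x\<in>\<O>. \<exists>y\<in>\<O>. z = b * x + \<pi> * y)" for z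
        unfolding PIdl_eq[symmetric] g(2)[symmetric] set_add_def' by (auto simp: PIdl_eq)
      have "\<pi> \<in> (*) g ` \<O>" unfolding elts using \<O>.zero_mem \<O>.one_mem by (intro bexI[of _ 0] bexI[of _ 1]) auto
      then obtain e where e: "e \<in> \<O>" "\<pi> = g * e" by auto
      have "b \<in> (*) g ` \<O>" unfolding elts using \<O>.zero_mem \<O>.one_mem by (intro bexI[of _ 1] bexI[of _ 0]) auto
      then obtain k where k: "k \<in> \<O>" "b = g * k" by auto
      have an: "anorm \<pi> = anorm g * anorm e" using anorm_mult g e by simp
      have "anorm g \<noteq> 0" "anorm e \<noteq> 0" using an pi by (auto simp: P_def intro!: gr0I)
      have "anorm g = 1"
      proof (rule ccontr)
        assume "anorm g \<noteq> 1"
        have "v \<in> (*) g ` \<O>" using pi e \<O>.mult_mem by (auto simp: P_def mult.assoc)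
        hence "P g" using g \<open>anorm g \<noteq> 0\<close> \<open>anorm g \<noteq> 1\<close> by (auto simp: P_def)
        hence "anorm g * anorm e \<le> anorm g * 1" using pi(2) an by fastforce
        hence "anorm e = 1" using \<open>anorm g \<noteq> 0\<close> \<open>anorm e \<noteq> 0\<close> by (simp only: mult_le_cancel1) linarith
        then obtain e' where e': "e' \<in> \<O>" "e * e' = 1" using anorm_1_unit[OF e(1)] by blast
        have "\<pi> * (e' * k) = (e * e') * (g * k)" unfolding e(2) by (simp only: mult_ac)
        hence "b = \<pi> * (e' * k)" using e'(2) k(2) by (simp only: mult_1)
        hence "b \<in> PIdl\<^bsub>R\<^esub> \<pi>" unfolding PIdl_eq using \<O>.mult_mem e' k by blast
        thus False using nb by simp
      qed
      then obtain g' where g': "g' \<in> \<O>" "g * g' = 1" using anorm_1_unit[OF g(1)] by blast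
      have "g * g' \<in> (*) g ` \<O>" using g' by blast
      then obtain x y where xy: "x \<in> \<O>" "y \<in> \<O>" "1 = b * x + \<pi> * y" unfolding g' elts by blast
      obtain t where t: "t \<in> \<O>" "a * b = \<pi> * t" using ab by (auto simp: PIdl_eq)
      have "a = a * (b * x + \<pi> * y)" using xy(3) by simp
      also have "\<dots> = (a * b) * x + \<pi> * (a * y)" by (simp add: algebra_simps)
      also have "\<dots> = \<pi> * (t * x + a * y)" unfolding t by (simp add: algebra_simps)
      finally show "a \<in> PIdl\<^bsub>R\<^esub> \<pi>"
        unfolding PIdl_eq using \<O>.mult_mem[OF t(1) xy(1)] \<O>.mult_mem[of a y] ab(1) xy(2) \<O>.add_mem by auto
    qed
  qed
  thus ?thesis using pi piO PIdl_eq by (auto simp: P_def)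
qed

text \<open>Splitting off a prime factor of \<open>n\<close>, a prime ideal contains that factor or
  the smaller cofactor; it cannot contain 1.\<close>

lemma primeideal_contains_prime:
  assumes Q: "primeideal Q R" and "n > 0" "of_nat n \<in> Q"
  shows "\<exists>q. Factorial_Ring.prime q \<and> q dvd n \<and> of_nat q \<in> Q"
  using assms(2,3)
proof (induction n rule: less_induct)
  case (less n)
  interpret Q: primeideal Q R by fact
  have "n \<noteq> 1"
  proof
    assume "n = 1"
    hence "\<one>\<^bsub>R\<^esub> \<in> Q" using less.prems by simp
    thus False using Q.one_imp_carrier Q.I_notcarr by simp
  qed
  then obtain p where p: "Factorial_Ring.prime p" "p dvd n" using prime_factor_nat by blast
  then obtain m where m: "n = p * m" by auto
  have mem: "(of_nat k :: complex) \<in> carrier R" for k using \<O>.of_nat_mem by auto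
  have "of_nat p \<otimes>\<^bsub>R\<^esub> of_nat m \<in> Q" using less.prems m by simp
  hence "of_nat p \<in> Q \<or> of_nat m \<in> Q" using Q.I_prime mem by blast
  thus ?case
  proof
    assume "of_nat m \<in> Q"
    moreover have "m < n" "m > 0" using m less.prems(1) p prime_gt_1_nat[of p] by (auto intro!: gr0I)
    ultimately show ?thesis using less.IH[of m] m by auto
  qed (use p in blast)
qed

text \<open>As \<open>g\<close> divides \<open>q\<close>, its absolute norm divides a power of
  \<open>q\<close>, and it equals the size of the residue ring. The sign is then settled by
  positivity at imaginary positions and by \<open>g = q\<close> at rational ones.\<close>

lemma place_norm:
  assumes q: "Factorial_Ring.prime q" and Q: "primeideal Q R" "PIdl\<^bsub>R\<^esub> (of_nat q) \<subseteq> Q"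
    and g: "g \<in> carrier R" "Q = PIdl\<^bsub>R\<^esub> g" "K = \<rat> \<longrightarrow> g = of_nat q"
  shows "comp_norm K g = of_nat q ^ (THE f. card (carrier (R Quot Q)) = q ^ f)"
    and "(THE f. card (carrier (R Quot Q)) = q ^ f) > 0" and "g \<noteq> 0" and "anorm g > 1"
proof -
  interpret Q: primeideal Q R by fact
  have gO: "g \<in> \<O>" using g by simp
  have "of_nat q * 1 \<in> PIdl\<^bsub>R\<^esub> (of_nat q)" unfolding PIdl_eq using \<O>.one_mem by blast
  hence "of_nat q \<in> (*) g ` \<O>" using Q(2) g(2) PIdl_eq by auto
  then obtain y where y: "y \<in> \<O>" "of_nat q = g * y" by auto
  have q1: "q > 1" using q prime_gt_1_nat by blast
  have "anorm g dvd q ^ d" using anorm_mult[OF gO y(1)] anorm_of_nat[of q] y(2) by (metis dvd_triv_left)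
  then obtain f where f: "anorm g = q ^ f" using q by (auto simp: divides_primepow_nat)
  show "g \<noteq> 0" using y(2) q1 by auto
  hence "real (card (carrier (R Quot Q))) = real (anorm g)"
    using card_Quot_PIdl[OF gO] g(2) real_anorm[OF gO] by simp
  hence card: "card (carrier (R Quot Q)) = q ^ f" using f by (simp only: of_nat_eq_iff)
  hence the: "(THE f. card (carrier (R Quot Q)) = q ^ f) = f"
    using q1 by (intro the_equality) (auto simp: power_inject_exp)
  have "anorm g \<noteq> 1" using carrier_PIdl_iff_unit[OF gO] Q.I_notcarr g(2) by auto
  thus "(THE f. card (carrier (R Quot Q)) = q ^ f) > 0" "anorm g > 1"
    unfolding the using f q1 one_less_power[of q f] by (auto intro!: gr0I)
  show "comp_norm K g = of_nat q ^ (THE f. card (carrier (R Quot Q)) = q ^ f)"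
    unfolding the
  proof (cases "K = \<rat>")
    case True
    have "cmod (comp_norm K g) = real q ^ f" using comp_norm_eq gO real_anorm[OF gO] f by simp
    hence "real q ^ f = real q ^ 1" using True g(3) by (simp add: comp_norm_def)
    hence "f = 1" using q1 by (subst (asm) power_inject_exp) auto
    thus "comp_norm K g = of_nat q ^ f" using True g(3) by (simp add: comp_norm_def)
  next
    case False
    then obtain r where r: "r > 0" "Nm g = complex_of_real r"
      using Nm_pos rat_or_imag gO \<open>g \<noteq> 0\<close> by blast
    hence "r = real q ^ f" using real_anorm[OF gO] f by simp
    thus "comp_norm K g = of_nat q ^ f" using r comp_norm_eq gO by simp
  qed
qed

text \<open>Descent on \<open>anorm v\<close>: a prime ideal containing \<open>v\<close> contains a
  rational prime dividing \<open>anorm v\<close>, larger than 3 by coprimality, so its chosen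
  generator can be divided out. \<open>P\<close> stays fixed while the prime factors of the cofactor
  shrink.\<close>

lemma factorization:
  assumes gen: "\<And>q Q. Factorial_Ring.prime q \<Longrightarrow> q > 3 \<Longrightarrow> primeideal Q R \<Longrightarrow> PIdl\<^bsub>R\<^esub> (of_nat q) \<subseteq> Q \<Longrightarrow>
      \<gamma> Q \<in> carrier R \<and> Q = PIdl\<^bsub>R\<^esub> (\<gamma> Q) \<and> (K = \<rat> \<longrightarrow> \<gamma> Q = of_nat q)"
    and v: "v \<in> \<O>" "v \<noteq> 0" "coprime (anorm v) 6" and P: "finite P" "prime_factors (anorm v) \<subseteq> P"
  shows "\<exists>u\<in>\<O>. \<exists>L. anorm u = 1 \<and> v = u * (\<Prod>q\<in>P. \<Prod>Q\<leftarrow>L q. \<gamma> Q) \<and>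
    (\<forall>q\<in>P. \<forall>Q\<in>set (L q). primeideal Q R \<and> PIdl\<^bsub>R\<^esub> (of_nat q) \<subseteq> Q)"
  using v P(2)
proof (induction "anorm v" arbitrary: v rule: less_induct)
  case less
  show ?case
  proof (cases "anorm v = 1")
    case True
    thus ?thesis using less.prems by (intro bexI[of _ v] exI[of _ "\<lambda>_. []"]) auto
  next
    case False
    have av: "anorm v \<noteq> 0" using anorm_eq_0 less.prems by simp
    obtain \<pi> where pi: "\<pi> \<in> \<O>" "primeideal (PIdl\<^bsub>R\<^esub> \<pi>) R" "v \<in> PIdl\<^bsub>R\<^esub> \<pi>"
      using ex_prime_divisor[OF less.prems(1)] av False by auto
    define Q where "Q = PIdl\<^bsub>R\<^esub> \<pi>"
    interpret Q: primeideal Q R using pi by (simp add: Q_def)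
    obtain y where y: "y \<in> \<O>" "of_nat (anorm v) = v * y" using anorm_cofactor less.prems by blast
    have "of_nat (anorm v) \<in> Q" unfolding y(2) using Q.I_r_closed[of v y] pi y(1) by (simp add: Q_def)
    then obtain q where q: "Factorial_Ring.prime q" "q dvd anorm v" "of_nat q \<in> Q"
      using primeideal_contains_prime[OF Q.primeideal_axioms] av by auto
    have "q \<noteq> 2" "q \<noteq> 3" using q(2) less.prems(3) by (auto dest!: coprime_common_divisor_nat) 
    hence q3: "q > 3" using q(1) prime_ge_2_nat[of q] by simp
    have qQ: "PIdl\<^bsub>R\<^esub> (of_nat q) \<subseteq> Q" using Q.I_r_closed[OF q(3)] by (auto simp: PIdl_eq)
    have g: "\<gamma> Q \<in> \<O>" "Q = PIdl\<^bsub>R\<^esub> (\<gamma> Q)" "K = \<rat> \<longrightarrow> \<gamma> Q = of_nat q"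
      using gen[OF q(1) q3 Q.primeideal_axioms qQ] by auto
    have ag: "anorm (\<gamma> Q) > 1" using place_norm(4)[OF q(1) Q.primeideal_axioms qQ _ g(2,3)] g(1) by simp
    obtain w where w: "w \<in> \<O>" "v = \<gamma> Q * w"
      using pi(3) g(2) PIdl_eq[of "\<gamma> Q"] unfolding Q_def[symmetric] by auto
    have an: "anorm v = anorm (\<gamma> Q) * anorm w" using anorm_mult g w by simp
    have "anorm w < anorm v" "w \<noteq> 0" using an ag av w by auto
    moreover have "coprime (anorm w) 6" using less.prems(3) an by simp
    moreover have "prime_factors (anorm w) \<subseteq> P"
      using less.prems(4) dvd_prime_factors[of "anorm v" "anorm w"] an av by auto
    ultimately obtain u L where uL: "u \<in> \<O>" "anorm u = 1" "w = u * (\<Prod>q\<in>P. \<Prod>Q\<leftarrow>L q. \<gamma> Q)"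
      "\<forall>q\<in>P. \<forall>Q\<in>set (L q). primeideal Q R \<and> PIdl\<^bsub>R\<^esub> (of_nat q) \<subseteq> Q"
      using less.hyps w(1) by blast
    have qP: "q \<in> P" using less.prems(4) q av by (auto simp: prime_factors_dvd)
    have "(\<Prod>p\<in>P. \<Prod>Q\<leftarrow>(L(q := Q # L q)) p. \<gamma> Q) = \<gamma> Q * (\<Prod>p\<in>P. \<Prod>Q\<leftarrow>L p. \<gamma> Q)"
      by (simp add: prod.remove[OF P(1) qP] mult.assoc)
    thus ?thesis using uL w(2) Q.primeideal_axioms qQ
      by (intro bexI[of _ u] exI[of _ "L(q := Q # L q)"]) auto
  qed
qed

end

lemma component_of_component_field:
  assumes "K = \<rat> \<or> (number_field K \<and> totally_imaginary K \<and> class_number K = 1)"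
  shows "\<exists>\<theta> f. component K \<theta> f"
proof -
  obtain \<theta> f where ip: "integral_primitive K \<theta> f" using ex_integral_primitive assms by blast
  have "\<exists>g\<in>carrier (integers_of K). I = PIdl\<^bsub>integers_of K\<^esub> g" if "ideal I (integers_of K)" for I
    using assms principal_Rats integral_primitive.principal_of_class_number[OF ip] that by blast
  thus ?thesis using assms ip unfolding component_def component_axioms_def by blast
qed

section \<open>Tuples of given norm\<close>

lemma sum_list_take_drop:
  fixes f :: "'a \<Rightarrow> 'b::monoid_add"
  shows "(\<Sum>p\<leftarrow>L. f p) = (\<Sum>p\<leftarrow>take k L. f p) + (\<Sum>p\<leftarrow>drop k L. f p)"
proof -
  have "(\<Sum>p\<leftarrow>take k L @ drop k L. f p) = (\<Sum>p\<leftarrow>take k L. f p) + (\<Sum>p\<leftarrow>drop k L. f p)"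
    by (simp only: map_append sum_list_append)
  thus ?thesis by simp
qed

lemma int_dvd_iff_nat_abs: "int n dvd m \<longleftrightarrow> n dvd nat \<bar>m\<bar>"
proof -
  have "int n dvd int (nat \<bar>m\<bar>) \<longleftrightarrow> n dvd nat \<bar>m\<bar>" by (rule int_dvd_int_iff)
  thus ?thesis by simp
qed

lemma sum_list_shorten:
  fixes f :: "'a \<Rightarrow> 'h::{finite, ab_group_add}" and c :: "'a \<Rightarrow> nat"
  shows "\<exists>L'. set L' \<subseteq> set L \<and> (\<Sum>p\<leftarrow>L'. c p) \<le> (\<Sum>p\<leftarrow>L. c p) \<and>
    (\<Sum>p\<leftarrow>L'. f p) = (\<Sum>p\<leftarrow>L. f p) \<and> length L' \<le> CARD('h) - 1"
proof (induction "length L" arbitrary: L rule: less_induct)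
  case less
  show ?case
  proof (cases "length L \<le> CARD('h) - 1")
    case False
    \<comment> \<open>Prefix lengths run from 0 to \<open>length L\<close>, one value more than
      there are entries; hence the bound \<open>CARD('h) - 1\<close>.\<close>
    define g where "g i = (\<Sum>p\<leftarrow>take i L. f p)" for i
    have "card (g ` {..length L}) \<le> CARD('h)" by (rule card_mono) auto
    also have "\<dots> < card {..length L}" using False by simp
    finally have "\<not> inj_on g {..length L}" by (rule pigeonhole)
    then obtain i j where ij: "i \<le> length L" "j \<le> length L" "i \<noteq> j" "g i = g j"
      unfolding inj_on_def by auto
    obtain a b where ab: "a < b" "b \<le> length L" "g a = g b"
      using ij that[of i j] that[of j i] by (cases "i < j") auto
    define L1 where "L1 = take a L @ drop b L"
    have len: "length L1 < length L" using ab by (simp add: L1_def)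
    have fL: "(\<Sum>p\<leftarrow>L1. f p) = (\<Sum>p\<leftarrow>L. f p)"
      using ab(3) unfolding L1_def g_def sum_list_take_drop[of f L b] by simp
    have "take a (take b L) = take a L" using ab(1) by simp
    hence cL: "(\<Sum>p\<leftarrow>L1. c p) \<le> (\<Sum>p\<leftarrow>L. c p)"
      unfolding L1_def sum_list_take_drop[of c L b] using sum_list_take_drop[of c "take b L" a] by simp
    have sL: "set L1 \<subseteq> set L" unfolding L1_def by (auto dest: in_set_takeD in_set_dropD)
    obtain L' where "set L' \<subseteq> set L1" "(\<Sum>p\<leftarrow>L'. c p) \<le> (\<Sum>p\<leftarrow>L1. c p)"
      "(\<Sum>p\<leftarrow>L'. f p) = (\<Sum>p\<leftarrow>L1. f p)" "length L' \<le> CARD('h) - 1"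
      using less.hyps[OF len] by blast
    thus ?thesis using fL cL sL by (intro exI[of _ L']) auto
  qed blast
qed

lemma sum_list_filter_fst:
  fixes g :: "nat \<times> 'a \<Rightarrow> 'b::comm_monoid_add"
  assumes "finite J" "fst ` set L \<subseteq> J"
  shows "(\<Sum>j\<in>J. \<Sum>p\<leftarrow>filter (\<lambda>(i, Q). i = j) L. g p) = (\<Sum>p\<leftarrow>L. g p)"
  using assms(2)
proof (induction L)
  case (Cons p L)
  obtain i Q where p: "p = (i, Q)" by (cases p)
  have "(\<Sum>j\<in>J. \<Sum>p\<leftarrow>filter (\<lambda>(i, Q). i = j) (p # L). g p)
      = (\<Sum>j\<in>J. (if i = j then g p else 0) + (\<Sum>p\<leftarrow>filter (\<lambda>(i, Q). i = j) L. g p))"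
    by (intro sum.cong) (auto simp: p)
  thus ?case using Cons assms(1) by (simp add: sum.distrib sum.delta p)
qed simp

lemma prod_list_filter_fst:
  fixes g :: "nat \<times> 'a \<Rightarrow> 'b::comm_monoid_mult"
  assumes "finite J" "fst ` set L \<subseteq> J"
  shows "(\<Prod>j\<in>J. \<Prod>p\<leftarrow>filter (\<lambda>(i, Q). i = j) L. g p) = (\<Prod>p\<leftarrow>L. g p)"
  using assms(2)
proof (induction L)
  case (Cons p L)
  obtain i Q where p: "p = (i, Q)" by (cases p)
  have "(\<Prod>j\<in>J. \<Prod>p\<leftarrow>filter (\<lambda>(i, Q). i = j) (p # L). g p)
      = (\<Prod>j\<in>J. (if i = j then g p else 1) * (\<Prod>p\<leftarrow>filter (\<lambda>(i, Q). i = j) L. g p))"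
    by (intro prod.cong) (auto simp: p)
  thus ?case using Cons assms(1) by (simp add: prod.distrib prod.delta p)
qed simp

lemma prod_list_power: "(\<Prod>p\<leftarrow>L. (x::'a::comm_monoid_mult) ^ c p) = x ^ (\<Sum>p\<leftarrow>L. c p)"
  by (induction L) (auto simp: power_add)

text \<open>Reads back the entries of one position from a list assembled position by position, as
  \<open>built_tuple\<close> does.\<close>

lemma filter_fst_concat:
  assumes "distinct js"
  shows "filter (\<lambda>(i, Q). i = j) (concat (map (\<lambda>j. map (Pair j) (l j)) js)) =
    (if j \<in> set js then map (Pair j) (l j) else [])"
  using assms
proof (induction js)
  case (Cons k js)
  have "filter (\<lambda>(i, Q). i = j) (map (Pair k) (l k)) = (if k = j then map (Pair k) (l k) else [])"
    by (auto simp: filter_map o_def)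
  thus ?case using Cons by auto
qed simp

lemma prime_factors_coprime_6:
  assumes "coprime m 6" "q \<in> prime_factors (nat \<bar>m\<bar>)"
  shows "Factorial_Ring.prime q" "q > 3"
proof -
  show p: "Factorial_Ring.prime q" using assms(2) by auto
  have d: "int q dvd m" unfolding int_dvd_iff_nat_abs using assms(2) by auto
  have "q \<noteq> 2" "q \<noteq> 3"
    using d assms(1) by (auto simp: coprime_def)
  thus "q > 3" using prime_ge_2_nat[OF p] by simp
qed

section \<open>The homomorphism on tuples, split into components\<close>

locale tuple_setup =
  fixes s :: nat and K :: "nat \<Rightarrow> complex set"
    and h :: "(nat \<Rightarrow> complex) \<Rightarrow> 'h::ab_group_add"
    and \<alpha> :: "nat \<Rightarrow> complex set \<Rightarrow> complex"
  assumes fields: "component_fields s K" and hom: "residue_hom s K h" and gens: "generator_choice s K \<alpha>"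
begin

abbreviation "\<A> j \<equiv> {x \<in> K j. algebraic_int x}"
abbreviation "N j \<equiv> comp_norm (K j)"
abbreviation "M \<equiv> tuple_ring s K"
abbreviation "H \<equiv> at_pos s h"

lemma K0: "K 0 = \<rat>" using fields by (simp add: component_fields_def)

lemma ex_component:
  assumes "j \<le> s" shows "\<exists>\<theta> f. component (K j) \<theta> f"
proof -
  have "j = 0 \<or> j \<in> {1..s}" using assms by auto
  thus ?thesis using fields K0 component_of_component_field[of "K j"] unfolding component_fields_def by metis
qed

lemma tuple_simps [simp]:
  "carrier M = (\<Pi>\<^sub>E j\<in>{..s}. \<A> j)" "a \<otimes>\<^bsub>M\<^esub> b = (\<lambda>j\<in>{..s}. a j * b j)" "\<one>\<^bsub>M\<^esub> = (\<lambda>j\<in>{..s}. 1)"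
  by (simp_all add: tuple_ring_def)

lemma subring_O: assumes "j \<le> s" shows "complex_subring (\<A> j)"
proof -
  obtain \<theta> f where "component (K j) \<theta> f" using ex_component assms by blast
  then interpret component "K j" \<theta> f .
  show ?thesis by (rule \<O>.complex_subring_axioms)
qed

lemma O_1: "j \<le> s \<Longrightarrow> 1 \<in> \<A> j" by (rule complex_subring.one_mem[OF subring_O])
lemma O_mult: "j \<le> s \<Longrightarrow> x \<in> \<A> j \<Longrightarrow> y \<in> \<A> j \<Longrightarrow> x * y \<in> \<A> j"
  by (rule complex_subring.mult_mem[OF subring_O])

lemma N_mult:
  assumes "j \<le> s" "x \<in> \<A> j" "y \<in> \<A> j" shows "N j (x * y) = N j x * N j y"
proof -
  obtain \<theta> f where "component (K j) \<theta> f" using ex_component assms by blast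
  then interpret component "K j" \<theta> f .
  show ?thesis using assms Nm_mult comp_norm_eq F.mult_mem by simp
qed

lemma N_1: assumes "j \<le> s" shows "N j 1 = 1"
proof -
  obtain \<theta> f where "component (K j) \<theta> f" using ex_component assms by blast
  then interpret component "K j" \<theta> f .
  show ?thesis using comp_norm_eq[OF F.one_mem] Nm_1 by simp
qed

lemma N_int: assumes "j \<le> s" "x \<in> \<A> j" shows "\<exists>n::int. N j x = of_int n"
proof -
  obtain \<theta> f where "component (K j) \<theta> f" using ex_component assms by blast
  then interpret component "K j" \<theta> f .
  have "N j x \<in> \<int>" using comp_norm_eq Nm_Ints assms by simp
  thus ?thesis by (auto elim: Ints_cases)
qed

lemma N_0: "N 0 x = x" by (simp add: comp_norm_def K0)

lemma of_int_mem_O0: "of_int n \<in> \<A> 0"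
  using K0 by (auto intro: int_imp_algebraic_int)

text \<open>Componentwise form of \<open>prime_to_six\<close>, so that products at one position can
  be treated without tuples.\<close>

definition coprime6 :: "nat \<Rightarrow> complex \<Rightarrow> bool" where
  "coprime6 j a \<longleftrightarrow> a \<in> \<A> j \<and> (\<exists>n::int. N j a = of_int n \<and> coprime n 6)"

lemma coprime6_1: "j \<le> s \<Longrightarrow> coprime6 j 1"
  using O_1 N_1 unfolding coprime6_def by (intro conjI exI[of _ 1]) auto

lemma coprime6_mult: "j \<le> s \<Longrightarrow> coprime6 j a \<Longrightarrow> coprime6 j b \<Longrightarrow> coprime6 j (a * b)"
  unfolding coprime6_def using O_mult[of j a b] N_mult[of j a b]
  by (auto simp flip: of_int_mult)

lemma coprime6_prod: "j \<le> s \<Longrightarrow> (\<And>i. i \<in> A \<Longrightarrow> coprime6 j (f i)) \<Longrightarrow> coprime6 j (prod f A)"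
  by (induction A rule: infinite_finite_induct) (auto simp: coprime6_1 coprime6_mult)

lemma coprime6_power: "j \<le> s \<Longrightarrow> coprime6 j a \<Longrightarrow> coprime6 j (a ^ n)"
  by (induction n) (auto simp: coprime6_1 coprime6_mult)

lemma prime_to_six_iff:
  "v \<in> prime_to_six s K \<longleftrightarrow> v \<in> extensional {..s} \<and> (\<forall>j\<le>s. coprime6 j (v j))"
  by (auto simp: prime_to_six_def coprime6_def PiE_iff)

definition single :: "nat \<Rightarrow> complex \<Rightarrow> nat \<Rightarrow> complex" where
  "single j a = (\<lambda>i\<in>{..s}. if i = j then a else 1)"

lemma H_eq: "H j a = h (single j a)" by (simp add: at_pos_def single_def)

lemma single_prime_to_six: "j \<le> s \<Longrightarrow> coprime6 j a \<Longrightarrow> single j a \<in> prime_to_six s K"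
  by (auto simp: prime_to_six_iff single_def coprime6_1)

lemma h_mult:
  "a \<in> prime_to_six s K \<Longrightarrow> b \<in> prime_to_six s K \<Longrightarrow> h (\<lambda>j\<in>{..s}. a j * b j) = h a + h b"
  using hom unfolding residue_hom_def by simp

lemma h_1: "h (\<lambda>i\<in>{..s}. 1) = 0"
  using hom unfolding residue_hom_def by simp

lemma H_1: "H j 1 = 0"
proof -
  have "single j 1 = (\<lambda>i\<in>{..s}. 1)" by (auto simp: single_def)
  thus ?thesis unfolding H_eq using h_1 by (simp only:)
qed

lemma H_mult:
  assumes "j \<le> s" "coprime6 j a" "coprime6 j b"
  shows "H j (a * b) = H j a + H j b"
proof -
  have "single j (a * b) = (\<lambda>i\<in>{..s}. single j a i * single j b i)" by (auto simp: single_def fun_eq_iff)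
  thus ?thesis using h_mult[OF single_prime_to_six single_prime_to_six] assms unfolding H_eq by simp
qed

lemma H_prod:
  assumes "j \<le> s" "\<And>i. i \<in> A \<Longrightarrow> coprime6 j (f i)"
  shows "H j (prod f A) = (\<Sum>i\<in>A. H j (f i))"
  using assms(2)
proof (induction A rule: infinite_finite_induct)
  case (insert x A)
  thus ?case using assms(1) coprime6_prod[of j A f] by (simp add: H_mult)
qed (simp_all add: H_1)

lemma H_power: "j \<le> s \<Longrightarrow> coprime6 j a \<Longrightarrow> H j (a ^ n) = (\<Sum>_<n. H j a)"
  using H_prod[of j "{..<n}" "\<lambda>_. a"] by simp

text \<open>Additivity is available only on tuples prime to six, so \<open>v\<close> is assembled
  one position at a time through tuples that stay prime to six.\<close>

lemma h_eq_sum: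
  assumes v: "v \<in> prime_to_six s K"
  shows "h v = (\<Sum>j\<le>s. H j (v j))"
proof -
  have c: "coprime6 j (v j)" if "j \<le> s" for j using v that by (simp add: prime_to_six_iff)
  \<comment> \<open>Agrees with \<open>v\<close> strictly below \<open>k\<close> and is 1 from there
    on; since positions run up to \<open>s\<close>, all of \<open>v\<close> is reached at
    \<open>Suc s\<close>.\<close>
  define w where "w k = (\<lambda>i\<in>{..s}. if i < k then v i else 1)" for k
  have w: "w k \<in> prime_to_six s K" for k using c by (auto simp: prime_to_six_iff w_def coprime6_1)
  have "h (w k) = (\<Sum>j<k. H j (v j))" if "k \<le> Suc s" for k
    using that
  proof (induction k)
    case 0
    have "w 0 = (\<lambda>i\<in>{..s}. 1)" by (auto simp: w_def)
    hence "h (w 0) = 0" using h_1 by (simp only:)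
    thus ?case by simp
  next
    case (Suc k)
    have "w (Suc k) = (\<lambda>i\<in>{..s}. w k i * single k (v k) i)" by (auto simp: w_def single_def fun_eq_iff)
    hence "h (w (Suc k)) = h (w k) + H k (v k)"
      using h_mult[OF w single_prime_to_six] c Suc.prems unfolding H_eq by simp
    thus ?case using Suc by simp
  qed
  moreover have "w (Suc s) = v" using v by (auto simp: w_def prime_to_six_iff extensional_def fun_eq_iff)
  ultimately show ?thesis by (metis lessThan_Suc_atMost order_refl)
qed

lemma generator_props:
  assumes "Factorial_Ring.prime q" "q > 3" "(j, Q) \<in> places s K q"
  shows "\<alpha> j Q \<in> carrier (integers_of (K j)) \<and> Q = PIdl\<^bsub>integers_of (K j)\<^esub> (\<alpha> j Q) \<and>
    (K j = \<rat> \<longrightarrow> \<alpha> j Q = of_nat q)"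
proof -
  have "\<forall>(j, Q)\<in>places s K q. \<alpha> j Q \<in> carrier (integers_of (K j)) \<and>
      Q = PIdl\<^bsub>integers_of (K j)\<^esub> (\<alpha> j Q) \<and> (K j = \<rat> \<longrightarrow> \<alpha> j Q = of_nat q)"
    using gens assms(1,2) unfolding generator_choice_def by blast
  from bspec[OF this assms(3)] show ?thesis unfolding prod.case .
qed

lemma place_props:
  assumes q: "Factorial_Ring.prime q" "q > 3" and p: "(j, Q) \<in> places s K q"
  shows "j \<le> s" "j > 0" "\<alpha> j Q \<in> \<A> j" "\<alpha> j Q \<noteq> 0" "Q = PIdl\<^bsub>integers_of (K j)\<^esub> (\<alpha> j Q)"
    "N j (\<alpha> j Q) = of_nat q ^ cost K q (j, Q)" "coprime6 j (\<alpha> j Q)"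
proof -
  have Q: "j \<in> {1..s}" "primeideal Q (integers_of (K j))" "PIdl\<^bsub>integers_of (K j)\<^esub> (of_nat q) \<subseteq> Q"
    using p by (auto simp: places_def)
  thus j: "j \<le> s" "j > 0" by auto
  have g: "\<alpha> j Q \<in> carrier (integers_of (K j))" "Q = PIdl\<^bsub>integers_of (K j)\<^esub> (\<alpha> j Q)"
    "K j = \<rat> \<longrightarrow> \<alpha> j Q = of_nat q"
    using generator_props[OF q p] by blast+
  show mem: "\<alpha> j Q \<in> \<A> j" using g(1) by simp
  show "Q = PIdl\<^bsub>integers_of (K j)\<^esub> (\<alpha> j Q)" by (rule g(2))
  obtain \<theta> f where "component (K j) \<theta> f" using ex_component j by blast
  then interpret component "K j" \<theta> f .
  show "\<alpha> j Q \<noteq> 0" by (rule place_norm(3)[OF q(1) Q(2,3) g])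
  show N: "N j (\<alpha> j Q) = of_nat q ^ cost K q (j, Q)"
    using place_norm(1)[OF q(1) Q(2,3) g] by (simp add: cost_def)
  have "coprime q 6"
  proof -
    have "coprime q 2" "coprime q 3" using q by (auto intro!: prime_imp_coprime dest!: dvd_imp_le simp del: coprime_right_2_iff_odd)
    hence "coprime q (2 * 3)" by (simp only: coprime_mult_right_iff)
    thus ?thesis by simp
  qed
  hence "coprime (int q ^ cost K q (j, Q)) 6" by (metis coprime_int_iff coprime_power_left_iff of_nat_numeral)
  thus "coprime6 j (\<alpha> j Q)" using mem N unfolding coprime6_def
    by (intro conjI exI[of _ "int q ^ cost K q (j, Q)"]) auto
qed

section \<open>The tuples built for a fixed integer m\<close>

context
  fixes m :: int
  assumes m: "m \<noteq> 0" "coprime m 6"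
begin

abbreviation "P \<equiv> prime_factors (nat \<bar>m\<bar>)"

lemma P_props: "q \<in> P \<Longrightarrow> Factorial_Ring.prime q" "q \<in> P \<Longrightarrow> q > 3"
  using prime_factors_coprime_6 m by blast+

lemma coprime6_dvd: "n dvd m \<Longrightarrow> coprime6 0 (of_int n)"
  unfolding coprime6_def using of_int_mem_O0 N_0 m(2) coprime_divisors[of n m 6 6] by auto

definition placed :: "(nat \<Rightarrow> (nat \<times> complex set) list) \<Rightarrow> bool" where
  "placed L \<longleftrightarrow> (\<forall>q\<in>P. set (L q) \<subseteq> places s K q)"

text \<open>The divisor used at position 0 of \<open>built_tuple\<close>; by
  \<open>prod_N_part\<close> it is the product of the norms at the other positions.\<close>

definition spent :: "(nat \<Rightarrow> (nat \<times> complex set) list) \<Rightarrow> int" where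
  "spent L = (\<Prod>q\<in>P. int q ^ (\<Sum>p\<leftarrow>L q. cost K q p))"

definition part :: "(nat \<Rightarrow> (nat \<times> complex set) list) \<Rightarrow> nat \<Rightarrow> complex" where
  "part L j = (\<Prod>q\<in>P. \<Prod>(i, Q)\<leftarrow>filter (\<lambda>(i, Q). i = j) (L q). \<alpha> i Q)"

text \<open>Along each list the three claims are proved together, because the additivity of
  \<open>H\<close> and the multiplicativity of the norm apply only once the partial products are
  known to be admissible components.\<close>

lemma part_props:
  assumes L: "placed L" and j: "j \<le> s"
  shows "coprime6 j (part L j)"
    "N j (part L j) = (\<Prod>q\<in>P. \<Prod>p\<leftarrow>filter (\<lambda>(i, Q). i = j) (L q). of_nat q ^ cost K q p)"
    "H j (part L j) = (\<Sum>q\<in>P. \<Sum>(i, Q)\<leftarrow>filter (\<lambda>(i, Q). i = j) (L q). H i (\<alpha> i Q))"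
proof -
  have mem: "coprime6 j (\<alpha> i Q)" "N j (\<alpha> i Q) = of_nat q ^ cost K q (i, Q)" "i = j"
    if "q \<in> P" "(i, Q) \<in> set (filter (\<lambda>(i, Q). i = j) (L q))" for q i Q
    using that L place_props[OF P_props[OF that(1)], of i Q] unfolding placed_def by auto
  have inner: "coprime6 j (\<Prod>(i, Q)\<leftarrow>l. \<alpha> i Q) \<and> N j (\<Prod>(i, Q)\<leftarrow>l. \<alpha> i Q) = (\<Prod>p\<leftarrow>l. of_nat q ^ cost K q p)
      \<and> H j (\<Prod>(i, Q)\<leftarrow>l. \<alpha> i Q) = (\<Sum>(i, Q)\<leftarrow>l. H i (\<alpha> i Q))"
    if q: "q \<in> P" and l: "set l \<subseteq> set (filter (\<lambda>(i, Q). i = j) (L q))" for q l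
    using l
  proof (induction l)
    case (Cons p l)
    obtain i Q where p: "p = (i, Q)" by (cases p)
    note mp = mem[OF q, of i Q]
    have "(i, Q) \<in> set (filter (\<lambda>(i, Q). i = j) (L q))"
      using Cons.prems unfolding p list.set insert_subset by blast
    with mp have mp: "coprime6 j (\<alpha> i Q)" "N j (\<alpha> i Q) = of_nat q ^ cost K q (i, Q)" "i = j" by blast+
    have IH: "coprime6 j (\<Prod>(i, Q)\<leftarrow>l. \<alpha> i Q)" "N j (\<Prod>(i, Q)\<leftarrow>l. \<alpha> i Q) = (\<Prod>p\<leftarrow>l. of_nat q ^ cost K q p)"
      "H j (\<Prod>(i, Q)\<leftarrow>l. \<alpha> i Q) = (\<Sum>(i, Q)\<leftarrow>l. H i (\<alpha> i Q))"
      using Cons by auto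
    show ?case
      using coprime6_mult[OF j mp(1) IH(1)] N_mult[OF j, of "\<alpha> i Q" "\<Prod>(i, Q)\<leftarrow>l. \<alpha> i Q"] H_mult[OF j mp(1) IH(1)] mp IH
      by (simp add: p coprime6_def)
  qed (simp add: coprime6_1 N_1 H_1 j)
  show "coprime6 j (part L j)" unfolding part_def using inner by (intro coprime6_prod j) auto
  show "H j (part L j) = (\<Sum>q\<in>P. \<Sum>(i, Q)\<leftarrow>filter (\<lambda>(i, Q). i = j) (L q). H i (\<alpha> i Q))"
    unfolding part_def using inner by (subst H_prod[OF j]) (auto intro!: sum.cong)
  have "N j (\<Prod>q\<in>A. \<Prod>(i, Q)\<leftarrow>filter (\<lambda>(i, Q). i = j) (L q). \<alpha> i Q) =
      (\<Prod>q\<in>A. \<Prod>p\<leftarrow>filter (\<lambda>(i, Q). i = j) (L q). of_nat q ^ cost K q p)" if "finite A" "A \<subseteq> P" for A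
    using that
  proof (induction A rule: finite_induct)
    case (insert q A)
    have 1: "coprime6 j (\<Prod>(i, Q)\<leftarrow>filter (\<lambda>(i, Q). i = j) (L q). \<alpha> i Q)"
      using inner[of q] insert.prems by blast
    have 2: "coprime6 j (\<Prod>q\<in>A. \<Prod>(i, Q)\<leftarrow>filter (\<lambda>(i, Q). i = j) (L q). \<alpha> i Q)"
      using inner insert.prems by (intro coprime6_prod j) auto
    have 3: "N j (\<Prod>(i, Q)\<leftarrow>filter (\<lambda>(i, Q). i = j) (L q). \<alpha> i Q)
        = (\<Prod>p\<leftarrow>filter (\<lambda>(i, Q). i = j) (L q). of_nat q ^ cost K q p)"
      using inner[of q] insert.prems by blast
    show ?case using insert 1 2 3 N_mult[OF j] unfolding coprime6_def by simp
  qed (simp add: N_1 j)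
  thus "N j (part L j) = (\<Prod>q\<in>P. \<Prod>p\<leftarrow>filter (\<lambda>(i, Q). i = j) (L q). of_nat q ^ cost K q p)"
    unfolding part_def by simp
qed

lemma placed_fst: "placed L \<Longrightarrow> q \<in> P \<Longrightarrow> fst ` set (L q) \<subseteq> {1..s}"
  unfolding placed_def places_def by fastforce

lemma prod_N_part:
  assumes "placed L" shows "(\<Prod>j\<in>{1..s}. N j (part L j)) = of_int (spent L)"
proof -
  have "(\<Prod>j\<in>{1..s}. N j (part L j))
      = (\<Prod>j\<in>{1..s}. \<Prod>q\<in>P. \<Prod>p\<leftarrow>filter (\<lambda>(i, Q). i = j) (L q). of_nat q ^ cost K q p)"
    using part_props(2)[OF assms] by (intro prod.cong) auto
  also have "\<dots> = (\<Prod>q\<in>P. \<Prod>j\<in>{1..s}. \<Prod>p\<leftarrow>filter (\<lambda>(i, Q). i = j) (L q). of_nat q ^ cost K q p)"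
    by (rule prod.swap)
  also have "\<dots> = (\<Prod>q\<in>P. of_nat q ^ (\<Sum>p\<leftarrow>L q. cost K q p))"
  proof (rule prod.cong)
    fix q assume "q \<in> P"
    from prod_list_filter_fst[OF finite_atLeastAtMost placed_fst[OF assms this]]
    show "(\<Prod>j\<in>{1..s}. \<Prod>p\<leftarrow>filter (\<lambda>(i, Q). i = j) (L q). of_nat q ^ cost K q p)
        = (of_nat q ^ (\<Sum>p\<leftarrow>L q. cost K q p) :: complex)"
      unfolding prod_list_power[symmetric] .
  qed simp
  finally show ?thesis by (simp add: spent_def)
qed

lemma sum_H_part:
  assumes "placed L"
  shows "(\<Sum>j\<in>{1..s}. H j (part L j)) = (\<Sum>q\<in>P. \<Sum>(i, Q)\<leftarrow>L q. H i (\<alpha> i Q))"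
proof -
  have "(\<Sum>j\<in>{1..s}. H j (part L j))
      = (\<Sum>j\<in>{1..s}. \<Sum>q\<in>P. \<Sum>(i, Q)\<leftarrow>filter (\<lambda>(i, Q). i = j) (L q). H i (\<alpha> i Q))"
    using part_props(3)[OF assms] by (intro sum.cong) auto
  also have "\<dots> = (\<Sum>q\<in>P. \<Sum>j\<in>{1..s}. \<Sum>(i, Q)\<leftarrow>filter (\<lambda>(i, Q). i = j) (L q). H i (\<alpha> i Q))"
    by (rule sum.swap)
  also have "\<dots> = (\<Sum>q\<in>P. \<Sum>(i, Q)\<leftarrow>L q. H i (\<alpha> i Q))"
  proof (rule sum.cong)
    fix q assume "q \<in> P"
    show "(\<Sum>j\<in>{1..s}. \<Sum>(i, Q)\<leftarrow>filter (\<lambda>(i, Q). i = j) (L q). H i (\<alpha> i Q)) = (\<Sum>(i, Q)\<leftarrow>L q. H i (\<alpha> i Q))"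
      by (rule sum_list_filter_fst[OF finite_atLeastAtMost placed_fst[OF assms \<open>q \<in> P\<close>]])
  qed simp
  finally show ?thesis .
qed

abbreviation "b \<equiv> built_tuple s K \<alpha> m"

lemma built_apply: "j \<le> s \<Longrightarrow> b L j = (if j = 0 then of_int (m div spent L) else part L j)"
  by (simp add: built_tuple_def spent_def part_def)

lemma atMost_insert: "{..s} = insert 0 {1..s}" by auto

text \<open>The subtracted term in each move accounts for the factor \<open>q^f\<close> taken out of
  \<open>m\<close> at position 0: \<open>H 0\<close> is additive on
  \<open>m = (m div spent L) spent L\<close>, both factors being prime to six.\<close>

lemma built_props:
  assumes L: "placed L" and dvd: "spent L dvd m"
  shows "b L \<in> prime_to_six s K" "b L \<in> norm_tuples s K m"
    "h (b L) = H 0 (of_int m) + (\<Sum>q\<in>P. \<Sum>p\<leftarrow>L q. move s K h \<alpha> q p)"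
proof -
  have dvd': "m div spent L dvd m" using dvd by (metis dvd_div_mult_self dvd_triv_left)
  show pts: "b L \<in> prime_to_six s K"
    unfolding prime_to_six_iff
    using built_apply[of _ L] part_props(1)[OF L] coprime6_dvd[OF dvd']
    by (auto simp: built_tuple_def)
  have eq: "m = m div spent L * spent L" using dvd by simp
  have "(\<Prod>j\<le>s. N j (b L j)) = N 0 (b L 0) * (\<Prod>j\<in>{1..s}. N j (b L j))"
    unfolding atMost_insert by simp
  also have "(\<Prod>j\<in>{1..s}. N j (b L j)) = (\<Prod>j\<in>{1..s}. N j (part L j))"
    by (intro prod.cong) (auto simp: built_apply)
  also have "N 0 (b L 0) * \<dots> = of_int (m div spent L * spent L)"
    unfolding prod_N_part[OF L] by (simp add: N_0 built_apply)
  finally have "(\<Prod>j\<le>s. N j (b L j)) = of_int m" using eq by simp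
  thus "b L \<in> norm_tuples s K m" using pts by (simp add: norm_tuples_def prime_to_six_def)
  have cq: "coprime6 0 (of_nat q)" if "q \<in> P" for q
  proof -
    have "int q dvd m" unfolding int_dvd_iff_nat_abs using that by auto
    thus ?thesis using coprime6_dvd[of "int q"] by simp
  qed
  have "H 0 (of_int (spent L)) = H 0 (\<Prod>q\<in>P. of_nat q ^ (\<Sum>p\<leftarrow>L q. cost K q p))" by (simp add: spent_def)
  also have "\<dots> = (\<Sum>q\<in>P. H 0 (of_nat q ^ (\<Sum>p\<leftarrow>L q. cost K q p)))"
    using cq by (intro H_prod coprime6_power) auto
  also have "\<dots> = (\<Sum>q\<in>P. \<Sum>p\<leftarrow>L q. \<Sum>_<cost K q p. H 0 (of_nat q))"
  proof (rule sum.cong)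
    fix q assume q: "q \<in> P"
    have "H 0 (of_nat q ^ (\<Sum>p\<leftarrow>l. cost K q p)) = (\<Sum>p\<leftarrow>l. \<Sum>_<cost K q p. H 0 (of_nat q))" for l
    proof (induction l)
      case (Cons p l)
      have "coprime6 0 (of_nat q ^ n)" for n using coprime6_power cq[OF q] by simp
      thus ?case using Cons H_power[of 0 "of_nat q"] cq[OF q] by (simp add: power_add H_mult)
    qed (simp add: H_1)
    thus "H 0 (of_nat q ^ (\<Sum>p\<leftarrow>L q. cost K q p)) = (\<Sum>p\<leftarrow>L q. \<Sum>_<cost K q p. H 0 (of_nat q))" .
  qed simp
  finally have Hs: "H 0 (of_int (spent L)) = (\<Sum>q\<in>P. \<Sum>p\<leftarrow>L q. \<Sum>_<cost K q p. H 0 (of_nat q))" .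
  have "H 0 (of_int m) = H 0 (of_int (m div spent L) * of_int (spent L))" using eq by (metis of_int_mult)
  also have "\<dots> = H 0 (of_int (m div spent L)) + H 0 (of_int (spent L))"
    using coprime6_dvd dvd dvd' by (intro H_mult) auto
  finally have Hm: "H 0 (of_int m) = H 0 (of_int (m div spent L)) + H 0 (of_int (spent L))" .
  have "h (b L) = H 0 (b L 0) + (\<Sum>j\<in>{1..s}. H j (b L j))"
    unfolding h_eq_sum[OF pts] unfolding atMost_insert by simp
  also have "(\<Sum>j\<in>{1..s}. H j (b L j)) = (\<Sum>j\<in>{1..s}. H j (part L j))"
    by (intro sum.cong) (auto simp: built_apply)
  also have "H 0 (b L 0) + \<dots> = H 0 (of_int (m div spent L)) + (\<Sum>q\<in>P. \<Sum>(i, Q)\<leftarrow>L q. H i (\<alpha> i Q))"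
    unfolding sum_H_part[OF L] by (simp add: built_apply)
  also have "\<dots> = H 0 (of_int m) + ((\<Sum>q\<in>P. \<Sum>(i, Q)\<leftarrow>L q. H i (\<alpha> i Q)) - H 0 (of_int (spent L)))"
    unfolding Hm by simp
  also have "(\<Sum>q\<in>P. \<Sum>(i, Q)\<leftarrow>L q. H i (\<alpha> i Q)) - H 0 (of_int (spent L)) = (\<Sum>q\<in>P. \<Sum>p\<leftarrow>L q. move s K h \<alpha> q p)"
    unfolding Hs sum_subtractf[symmetric]
  proof (rule sum.cong)
    fix q
    show "(\<Sum>(i, Q)\<leftarrow>L q. H i (\<alpha> i Q)) - (\<Sum>p\<leftarrow>L q. \<Sum>_<cost K q p. H 0 (of_nat q)) = (\<Sum>p\<leftarrow>L q. move s K h \<alpha> q p)"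
      unfolding sum_list_subtractf[symmetric] by (intro arg_cong[of _ _ sum_list] map_cong) (auto simp: move_def)
  qed simp
  finally show "h (b L) = H 0 (of_int m) + (\<Sum>q\<in>P. \<Sum>p\<leftarrow>L q. move s K h \<alpha> q p)" .
qed

definition admissible :: "(nat \<Rightarrow> (nat \<times> complex set) list) \<Rightarrow> bool" where
  "admissible L \<longleftrightarrow> (\<forall>q\<in>P. L q \<in> place_seqs s K q (multiplicity q (nat \<bar>m\<bar>)))"

text \<open>By unique factorization in the integers, the separate cost bounds at the primes amount
  to exactness of the one division at position 0.\<close>

lemma admissible_iff: "admissible L \<longleftrightarrow> placed L \<and> spent L dvd m"
proof -
  define c where "c q = (\<Sum>p\<leftarrow>L q. cost K q p)" for q
  have nz: "nat \<bar>m\<bar> \<noteq> 0" using m by simp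
  have spent: "spent L = int (\<Prod>q\<in>P. q ^ c q)" by (simp add: spent_def c_def)
  have "(\<forall>q\<in>P. c q \<le> multiplicity q (nat \<bar>m\<bar>)) \<longleftrightarrow> spent L dvd m"
  proof
    assume "\<forall>q\<in>P. c q \<le> multiplicity q (nat \<bar>m\<bar>)"
    hence "(\<Prod>q\<in>P. q ^ c q) dvd (\<Prod>q\<in>P. q ^ multiplicity q (nat \<bar>m\<bar>))"
      by (intro prod_dvd_prod le_imp_power_dvd) auto
    also have "\<dots> = nat \<bar>m\<bar>" using prod_prime_factors[OF nz] by simp
    finally show "spent L dvd m" unfolding spent int_dvd_iff_nat_abs .
  next
    assume "spent L dvd m"
    hence d: "(\<Prod>q\<in>P. q ^ c q) dvd nat \<bar>m\<bar>" unfolding spent int_dvd_iff_nat_abs .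
    show "\<forall>q\<in>P. c q \<le> multiplicity q (nat \<bar>m\<bar>)"
    proof
      fix q assume q: "q \<in> P"
      have "multiplicity q (\<Prod>q\<in>P. q ^ c q) = c q"
        using multiplicity_prod_prime_powers[of P q c] q by auto
      thus "c q \<le> multiplicity q (nat \<bar>m\<bar>)" using dvd_imp_multiplicity_le[OF d nz, of q] by simp
    qed
  qed
  thus ?thesis unfolding admissible_def placed_def place_seqs_def c_def by auto
qed

text \<open>Position \<open>0\<close> absorbs the sign of the units at the other positions, so \<open>v\<close> and the built tuple differ by an
  element of \<open>U\<^sub>+\<close>.\<close>

lemma norm_tuple_eq_built:
  assumes v: "v \<in> norm_tuples s K m"
  shows "\<exists>L. admissible L \<and> h v = h (b L)"
proof -
  have vO: "v j \<in> \<A> j" if "j \<le> s" for j using v that by (auto simp: norm_tuples_def PiE_iff)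
  have "\<forall>j\<in>{..s}. \<exists>n::int. N j (v j) = of_int n" using N_int vO by auto
  then obtain n :: "nat \<Rightarrow> int" where n: "\<And>j. j \<le> s \<Longrightarrow> N j (v j) = of_int (n j)" by (metis atMost_iff)
  have "of_int (\<Prod>j\<le>s. n j) = (of_int m :: complex)"
    using v n by (simp add: norm_tuples_def)
  hence prod_n: "(\<Prod>j\<le>s. n j) = m" by (simp only: of_int_eq_iff)
  have n_dvd: "n j dvd m" if "j \<le> s" for j
    unfolding prod_n[symmetric] using that by (intro dvd_prodI) auto
  \<comment> \<open>Bundles the unit, its inverse and the lists of primes at position
    \<open>j\<close>, so that one choice over \<open>j\<close> supplies them all.\<close>
  define fac where "fac j u u' l \<longleftrightarrow> u \<in> \<A> j \<and> u' \<in> \<A> j \<and> u * u' = 1 \<and>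
      v j = u * (\<Prod>q\<in>P. \<Prod>Q\<leftarrow>l q. \<alpha> j Q) \<and> (\<forall>q\<in>P. \<forall>Q\<in>set (l q). (j, Q) \<in> places s K q)" for j u u' l
  have "\<exists>z. fac j (fst z) (fst (snd z)) (snd (snd z))" if j: "j \<in> {1..s}" for j
  proof -
    have js: "j \<le> s" using j by simp
    obtain \<theta> f where "component (K j) \<theta> f" using ex_component js by blast
    then interpret component "K j" \<theta> f .
    have an: "anorm (v j) = nat \<bar>n j\<bar>" using anorm_eq n[OF js] comp_norm_eq vO[OF js] by auto
    have nj: "n j \<noteq> 0" "coprime (n j) 6" using n_dvd[OF js] m coprime_divisors[of "n j" m 6 6] by auto
    have vnz: "v j \<noteq> 0" using anorm_eq_0[OF vO[OF js]] an nj by auto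
    have "coprime (int (nat \<bar>n j\<bar>)) (int 6)" using nj(2) by simp
    hence cop: "coprime (anorm (v j)) 6" unfolding an coprime_int_iff .
    have "nat \<bar>n j\<bar> dvd nat \<bar>m\<bar>" using n_dvd[OF js] unfolding int_dvd_iff_nat_abs[symmetric] by simp
    hence pf: "prime_factors (anorm (v j)) \<subseteq> P" unfolding an using m(1) by (intro dvd_prime_factors) auto
    have gen: "\<alpha> j Q \<in> carrier (integers_of (K j)) \<and> Q = PIdl\<^bsub>integers_of (K j)\<^esub> (\<alpha> j Q) \<and> (K j = \<rat> \<longrightarrow> \<alpha> j Q = of_nat q)"
      if "Factorial_Ring.prime q" "q > 3" "primeideal Q (integers_of (K j))" "PIdl\<^bsub>integers_of (K j)\<^esub> (of_nat q) \<subseteq> Q" for q Q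
    proof -
      have "(j, Q) \<in> places s K q" using that j by (simp add: places_def)
      thus ?thesis using generator_props that by blast
    qed
    obtain u l where ul: "u \<in> \<A> j" "anorm u = 1" "v j = u * (\<Prod>q\<in>P. \<Prod>Q\<leftarrow>l q. \<alpha> j Q)"
      "\<forall>q\<in>P. \<forall>Q\<in>set (l q). primeideal Q (integers_of (K j)) \<and> PIdl\<^bsub>integers_of (K j)\<^esub> (of_nat q) \<subseteq> Q"
      using factorization[OF gen vO[OF js] vnz cop finite_set_mset pf] by blast
    obtain u' where u': "u' \<in> \<A> j" "u * u' = 1" using anorm_1_unit[OF ul(1)] ul(2) by blast
    have "\<forall>q\<in>P. \<forall>Q\<in>set (l q). (j, Q) \<in> places s K q" using ul(4) j by (simp add: places_def)
    hence "fac j u u' l" unfolding fac_def using ul(1,3) u' by blast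
    thus ?thesis by (intro exI[of _ "(u, u', l)"]) simp
  qed
  then obtain z where "\<And>j. j \<in> {1..s} \<Longrightarrow> fac j (fst (z j)) (fst (snd (z j))) (snd (snd (z j)))" by metis
  then obtain u u' l where "\<And>j. j \<in> {1..s} \<Longrightarrow> fac j (u j) (u' j) (l j)"
    using that[of "\<lambda>j. fst (z j)" "\<lambda>j. fst (snd (z j))" "\<lambda>j. snd (snd (z j))"] by simp
  hence ul: "\<And>j. j \<in> {1..s} \<Longrightarrow> u j \<in> \<A> j" "\<And>j. j \<in> {1..s} \<Longrightarrow> u' j \<in> \<A> j"
    "\<And>j. j \<in> {1..s} \<Longrightarrow> u j * u' j = 1"
    "\<And>j. j \<in> {1..s} \<Longrightarrow> v j = u j * (\<Prod>q\<in>P. \<Prod>Q\<leftarrow>l j q. \<alpha> j Q)"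
    "\<And>j q Q. j \<in> {1..s} \<Longrightarrow> q \<in> P \<Longrightarrow> Q \<in> set (l j q) \<Longrightarrow> (j, Q) \<in> places s K q"
    unfolding fac_def by blast+
  \<comment> \<open>For each prime the lists of all positions are joined into one sequence of
    places; \<open>filter_fst_concat\<close> recovers the single positions.\<close>
  define L where "L q = concat (map (\<lambda>j. map (Pair j) (l j q)) [1..<Suc s])" for q
  have placed: "placed L" unfolding placed_def L_def using ul(5) by fastforce
  have part: "part L j = (\<Prod>q\<in>P. \<Prod>Q\<leftarrow>l j q. \<alpha> j Q)" if "j \<in> {1..s}" for j
  proof -
    have js: "j \<in> set [1..<Suc s]" using that by auto
    show ?thesis
      unfolding part_def L_def filter_fst_concat[OF distinct_upt] if_P[OF js] map_map o_def prod.case ..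
  qed
  have cp: "coprime6 j (part L j)" if "j \<in> {1..s}" for j using part_props(1)[OF placed] that by auto
  have "\<forall>j\<in>{1..s}. \<exists>e::int. N j (u j) = of_int e \<and> e * e = 1"
  proof
    fix j assume j: "j \<in> {1..s}"
    hence js: "j \<le> s" by simp
    obtain e e' :: int where e: "N j (u j) = of_int e" "N j (u' j) = of_int e'" using N_int[OF js] ul(1,2)[OF j] by blast
    have "N j (u j) * N j (u' j) = 1" using N_mult[OF js ul(1,2)[OF j]] ul(3)[OF j] N_1[OF js] by simp
    hence "e * e' = 1" unfolding e by (metis of_int_eq_1_iff of_int_mult)
    hence "e = 1 \<or> e = - 1" by (metis zmult_eq_1_iff)
    thus "\<exists>e::int. N j (u j) = of_int e \<and> e * e = 1" using e by auto
  qed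
  then obtain e :: "nat \<Rightarrow> int" where e: "\<And>j. j \<in> {1..s} \<Longrightarrow> N j (u j) = of_int (e j)" "\<And>j. j \<in> {1..s} \<Longrightarrow> e j * e j = 1"
    by metis
  \<comment> \<open>The total sign of the unit norms; a unit at a rational position may contribute
    -1.\<close>
  define t where "t = (\<Prod>j\<in>{1..s}. e j)"
  have tt: "t * t = 1" unfolding t_def prod.distrib[symmetric] using e(2) by simp
  have v0: "v 0 = of_int (n 0)" using n[of 0] N_0 by simp
  have "of_int m = (\<Prod>j\<le>s. N j (v j))" using v by (simp add: norm_tuples_def)
  also have "\<dots> = N 0 (v 0) * (\<Prod>j\<in>{1..s}. N j (v j))" unfolding atMost_insert by simp
  also have "(\<Prod>j\<in>{1..s}. N j (v j)) = (\<Prod>j\<in>{1..s}. of_int (e j) * N j (part L j))"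
  proof (rule prod.cong)
    fix j assume j: "j \<in> {1..s}"
    thus "N j (v j) = of_int (e j) * N j (part L j)"
      using N_mult[of j "u j" "part L j"] ul(1,4)[OF j] cp[OF j] e(1)[OF j] part[OF j] by (simp add: coprime6_def)
  qed simp
  also have "N 0 (v 0) * \<dots> = of_int (n 0 * t * spent L)"
    unfolding prod.distrib prod_N_part[OF placed] by (simp add: N_0 v0 t_def)
  finally have meq: "m = n 0 * t * spent L" by (simp only: of_int_eq_iff)
  have dvd: "spent L dvd m" by (rule dvdI[of _ _ "n 0 * t"], subst mult.commute, rule meq)
  have "spent L \<noteq> 0" using meq m by auto
  hence "(n 0 * t * spent L) div spent L = n 0 * t" by (rule nonzero_mult_div_cancel_right)
  hence mdiv: "m div spent L = n 0 * t" unfolding meq[symmetric] .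
  \<comment> \<open>With \<open>t\<close> at position 0 the norm product becomes the square of
    \<open>t\<close>, which is 1; and since the built tuple has \<open>n 0 * t\<close> there,
    multiplying by \<open>t\<close> restores \<open>v 0\<close>.\<close>
  define \<epsilon> where "\<epsilon> = (\<lambda>j\<in>{..s}. if j = 0 then of_int t else u j)"
  define \<epsilon>' where "\<epsilon>' = (\<lambda>j\<in>{..s}. if j = 0 then of_int t else u' j)"
  have tt': "of_int t * of_int t = (1 :: complex)" using tt by (metis of_int_1 of_int_mult)
  have pos: "j \<in> {1..s}" if "j \<le> s" "j \<noteq> 0" for j using that by simp
  have "\<epsilon> \<in> Units M"
    unfolding Units_def
  proof (intro CollectI conjI bexI[of _ \<epsilon>'])
    show "\<epsilon> \<in> carrier M" "\<epsilon>' \<in> carrier M"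
      using ul(1,2)[OF pos] of_int_mem_O0 by (auto simp: \<epsilon>_def \<epsilon>'_def)
    show "\<epsilon>' \<otimes>\<^bsub>M\<^esub> \<epsilon> = \<one>\<^bsub>M\<^esub>" "\<epsilon> \<otimes>\<^bsub>M\<^esub> \<epsilon>' = \<one>\<^bsub>M\<^esub>"
      using ul(3)[OF pos] tt' by (auto simp: \<epsilon>_def \<epsilon>'_def fun_eq_iff mult.commute)
  qed
  moreover have "(\<Prod>j\<le>s. N j (\<epsilon> j)) = 1"
  proof -
    have "(\<Prod>j\<le>s. N j (\<epsilon> j)) = N 0 (\<epsilon> 0) * (\<Prod>j\<in>{1..s}. N j (\<epsilon> j))" unfolding atMost_insert by simp
    also have "(\<Prod>j\<in>{1..s}. N j (\<epsilon> j)) = (\<Prod>j\<in>{1..s}. of_int (e j))"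
      using e(1) by (intro prod.cong) (auto simp: \<epsilon>_def)
    also have "N 0 (\<epsilon> 0) * \<dots> = 1" using tt' by (simp add: N_0 \<epsilon>_def t_def)
    finally show ?thesis .
  qed
  ultimately have "\<epsilon> \<in> U_plus s K" by (simp add: U_plus_def)
  hence h0: "h \<epsilon> = 0" using hom unfolding residue_hom_def by blast
  have eps: "\<epsilon> \<in> prime_to_six s K"
    unfolding prime_to_six_iff
  proof (intro conjI allI impI)
    show "\<epsilon> \<in> extensional {..s}" by (simp add: \<epsilon>_def)
    fix j assume j: "j \<le> s"
    show "coprime6 j (\<epsilon> j)"
    proof (cases "j = 0")
      case True
      have "t dvd 1" using dvdI[OF tt[symmetric]] .
      hence "coprime t 6" by (rule coprime_divisors[OF _ dvd_refl]) simp
      thus ?thesis using True of_int_mem_O0 N_0 unfolding coprime6_def by (auto simp: \<epsilon>_def)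
    next
      case False
      have "e j dvd 1" using dvdI[OF e(2)[OF pos[OF j False], symmetric]] .
      hence "coprime (e j) 6" by (rule coprime_divisors[OF _ dvd_refl]) simp
      thus ?thesis using False j ul(1)[OF pos[OF j False]] e(1)[OF pos[OF j False]] unfolding coprime6_def by (auto simp: \<epsilon>_def)
    qed
  qed
  have "v = (\<lambda>j\<in>{..s}. \<epsilon> j * b L j)"
  proof (rule extensionalityI[of _ "{..s}"])
    show "v \<in> extensional {..s}" using v by (auto simp: norm_tuples_def PiE_iff)
    fix j assume "j \<in> {..s}"
    hence j: "j \<le> s" by simp
    show "v j = (\<lambda>j\<in>{..s}. \<epsilon> j * b L j) j"
    proof (cases "j = 0")
      case True
      have "of_int t * of_int (n 0 * t) = (of_int (n 0) :: complex)" using tt' by (simp add: mult.left_commute)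
      thus ?thesis using True built_apply[of 0 L] mdiv v0 by (simp add: \<epsilon>_def)
    next
      case False
      thus ?thesis using j built_apply[OF j, of L] ul(4)[OF pos[OF j False]] part[OF pos[OF j False]] by (simp add: \<epsilon>_def)
    qed
  qed simp
  hence "h v = h \<epsilon> + h (b L)" using h_mult[OF eps built_props(1)[OF placed dvd]] by simp
  thus ?thesis using h0 admissible_iff placed dvd by (intro exI[of _ L]) auto
qed

lemma sumset_eq:
  "{H 0 (of_int m)} + (\<Sum>q\<in>P. reach s K h \<alpha> q (multiplicity q (nat \<bar>m\<bar>))) =
    {H 0 (of_int m) + (\<Sum>q\<in>P. \<Sum>p\<leftarrow>L q. move s K h \<alpha> q p) | L. admissible L}" (is "?A = ?B")
proof (intro equalityI subsetI)
  fix x assume "x \<in> ?A"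
  then obtain y where y: "\<And>q. q \<in> P \<Longrightarrow> y q \<in> reach s K h \<alpha> q (multiplicity q (nat \<bar>m\<bar>))"
    "x = H 0 (of_int m) + (\<Sum>q\<in>P. y q)"
    by (auto simp: set_sum_alt elim!: set_plus_elim)
  have "\<forall>q\<in>P. \<exists>l. y q = (\<Sum>p\<leftarrow>l. move s K h \<alpha> q p) \<and> l \<in> place_seqs s K q (multiplicity q (nat \<bar>m\<bar>))"
    using y(1) unfolding reach_def by blast
  then obtain L where L: "\<And>q. q \<in> P \<Longrightarrow> y q = (\<Sum>p\<leftarrow>L q. move s K h \<alpha> q p)"
    "\<And>q. q \<in> P \<Longrightarrow> L q \<in> place_seqs s K q (multiplicity q (nat \<bar>m\<bar>))"
    by metis
  have "admissible L" using L(2) by (simp add: admissible_def)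
  moreover have "x = H 0 (of_int m) + (\<Sum>q\<in>P. \<Sum>p\<leftarrow>L q. move s K h \<alpha> q p)" using y(2) L(1) by simp
  ultimately show "x \<in> ?B" by blast
next
  fix x assume "x \<in> ?B"
  then obtain L where L: "admissible L" "x = H 0 (of_int m) + (\<Sum>q\<in>P. \<Sum>p\<leftarrow>L q. move s K h \<alpha> q p)" by blast
  have "(\<Sum>q\<in>P. \<Sum>p\<leftarrow>L q. move s K h \<alpha> q p) \<in> (\<Sum>q\<in>P. reach s K h \<alpha> q (multiplicity q (nat \<bar>m\<bar>)))"
    unfolding set_sum_alt[OF finite_set_mset] using L(1) by (auto simp: admissible_def reach_def)
  thus "x \<in> ?A" unfolding L(2) by (intro set_plus_intro) auto
qed

lemma image_norm_tuples:
  "h ` norm_tuples s K m = {H 0 (of_int m) + (\<Sum>q\<in>P. \<Sum>p\<leftarrow>L q. move s K h \<alpha> q p) | L. admissible L}"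
proof (intro equalityI subsetI)
  fix x assume "x \<in> h ` norm_tuples s K m"
  then obtain L where "admissible L" "x = h (b L)" using norm_tuple_eq_built by blast
  thus "x \<in> {H 0 (of_int m) + (\<Sum>q\<in>P. \<Sum>p\<leftarrow>L q. move s K h \<alpha> q p) | L. admissible L}"
    using built_props(3) admissible_iff by blast
next
  fix x assume "x \<in> {H 0 (of_int m) + (\<Sum>q\<in>P. \<Sum>p\<leftarrow>L q. move s K h \<alpha> q p) | L. admissible L}"
  then obtain L where L: "admissible L" "x = H 0 (of_int m) + (\<Sum>q\<in>P. \<Sum>p\<leftarrow>L q. move s K h \<alpha> q p)" by blast
  have "placed L" "spent L dvd m" using L(1) admissible_iff by blast+
  from built_props(2,3)[OF this] show "x \<in> h ` norm_tuples s K m" unfolding L(2) by (intro image_eqI) (rule sym)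
qed

end

section \<open>Independence of the generators and truncation of the cost\<close>

lemma at_pos_generator:
  assumes q: "Factorial_Ring.prime q" "q > 3" and p: "(j, Q) \<in> places s K q" and \<beta>: "generator_choice s K \<beta>"
  shows "H j (\<beta> j Q) = H j (\<alpha> j Q)"
proof -
  interpret B: tuple_setup s K h \<beta> using fields hom \<beta> by unfold_locales
  note a = place_props[OF q p] and b = B.place_props[OF q p]
  have j: "j \<le> s" by (rule a(1))
  obtain \<theta> f where "component (K j) \<theta> f" using ex_component j by blast
  then interpret C: component "K j" \<theta> f .
  have eq: "(*) (\<alpha> j Q) ` \<A> j = (*) (\<beta> j Q) ` \<A> j" using a(5) b(5) C.PIdl_eq by metis
  have "\<beta> j Q * 1 \<in> (*) (\<alpha> j Q) ` \<A> j" unfolding eq using O_1[OF j] by blast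
  then obtain x where x: "x \<in> \<A> j" "\<beta> j Q = \<alpha> j Q * x" by auto
  have "\<alpha> j Q * 1 \<in> (*) (\<beta> j Q) ` \<A> j" unfolding eq[symmetric] using O_1[OF j] by blast
  then obtain y where y: "y \<in> \<A> j" "\<alpha> j Q = \<beta> j Q * y" by auto
  have "\<alpha> j Q * (x * y) = \<alpha> j Q * 1" using x(2) y(2) by (simp add: mult.assoc[symmetric])
  hence xy: "x * y = 1" by (rule mult_left_cancel[OF a(4), THEN iffD1])
  have "N j (\<beta> j Q) = N j (\<alpha> j Q) * N j x" using N_mult[OF j a(3) x(1)] x(2) by simp
  \<comment> \<open>Both norms are the same power of \<open>q\<close> with the same sign, so the
    unit has norm 1 and not -1, as membership in \<open>U_plus\<close> requires.\<close>
  hence Nx: "N j x = 1" using a(6) b(6) q by simp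
  have cx: "coprime6 j x" using x(1) Nx unfolding coprime6_def by (intro conjI exI[of _ 1]) auto
  have "single j x \<in> Units M"
    unfolding Units_def
  proof (intro CollectI conjI bexI[of _ "single j y"])
    show "single j x \<in> carrier M" "single j y \<in> carrier M"
      using x(1) y(1) O_1 by (auto simp: single_def)
    show "single j y \<otimes>\<^bsub>M\<^esub> single j x = \<one>\<^bsub>M\<^esub>" "single j x \<otimes>\<^bsub>M\<^esub> single j y = \<one>\<^bsub>M\<^esub>"
      using xy by (auto simp: single_def fun_eq_iff mult.commute)
  qed
  moreover have "(\<Prod>i\<le>s. N i (single j x i)) = 1"
    using Nx N_1 by (intro prod.neutral) (auto simp: single_def)
  ultimately have "h (single j x) = 0" using hom unfolding residue_hom_def U_plus_def by auto
  hence "H j x = 0" by (simp add: H_eq)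
  thus ?thesis using H_mult[OF j a(7) cx] x(2) by simp
qed

lemma reach_generator_choice:
  assumes q: "Factorial_Ring.prime q" "q > 3" and \<beta>: "generator_choice s K \<beta>"
  shows "reach s K h \<beta> q e = reach s K h \<alpha> q e"
proof -
  have "move s K h \<beta> q p = move s K h \<alpha> q p" if "p \<in> places s K q" for p
    using that at_pos_generator[OF q _ \<beta>] by (cases p) (simp add: move_def)
  hence eq: "(\<Sum>p\<leftarrow>L. move s K h \<beta> q p) = (\<Sum>p\<leftarrow>L. move s K h \<alpha> q p)" if "L \<in> place_seqs s K q e" for L
    using that by (intro arg_cong[of _ _ sum_list] map_cong) (auto simp: place_seqs_def)
  show ?thesis
    unfolding reach_def by (intro Collect_cong ex_cong1 rev_conj_cong refl) (simp add: eq)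
qed

end

text \<open>The shortened sequence costs no more than the original one, and it has at most
  \<open>CARD('h) - 1\<close> moves of cost at most \<open>w\<close>; together these give the
  minimum.\<close>

lemma reach_truncate:
  fixes h :: "(nat \<Rightarrow> complex) \<Rightarrow> 'h::{finite, ab_group_add}"
  assumes w: "\<forall>p\<in>places s K q. cost K q p \<le> w"
  shows "reach s K h \<alpha> q e = reach s K h \<alpha> q (min e (w * (CARD('h) - 1)))"
proof (intro equalityI subsetI)
  fix x assume "x \<in> reach s K h \<alpha> q e"
  then obtain L where L: "L \<in> place_seqs s K q e" "x = (\<Sum>p\<leftarrow>L. move s K h \<alpha> q p)" by (auto simp: reach_def)
  obtain L' where L': "set L' \<subseteq> set L" "(\<Sum>p\<leftarrow>L'. cost K q p) \<le> (\<Sum>p\<leftarrow>L. cost K q p)"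
    "(\<Sum>p\<leftarrow>L'. move s K h \<alpha> q p) = (\<Sum>p\<leftarrow>L. move s K h \<alpha> q p)" "length L' \<le> CARD('h) - 1"
    using sum_list_shorten[of L "cost K q" "move s K h \<alpha> q"] by blast
  have sub: "set L' \<subseteq> places s K q" using L L' by (auto simp: place_seqs_def)
  have "(\<Sum>p\<leftarrow>L'. cost K q p) \<le> (\<Sum>p\<leftarrow>L'. w)" using sub w by (intro sum_list_mono) auto
  also have "\<dots> = w * length L'" by (simp add: sum_list_triv)
  also have "\<dots> \<le> w * (CARD('h) - 1)" using L'(4) by simp
  finally have "L' \<in> place_seqs s K q (min e (w * (CARD('h) - 1)))"
    using L' L sub by (auto simp: place_seqs_def)
  thus "x \<in> reach s K h \<alpha> q (min e (w * (CARD('h) - 1)))"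
    unfolding reach_def L(2) L'(3)[symmetric] by blast
qed (auto simp: reach_def place_seqs_def)

theorem theorem2p3:
  fixes s :: nat
    and K :: "nat \<Rightarrow> complex set"
    and h :: "(nat \<Rightarrow> complex) \<Rightarrow> 'h::{finite,ab_group_add}"
    and \<alpha> :: "nat \<Rightarrow> complex set \<Rightarrow> complex"
  assumes "component_fields s K"
    and "residue_hom s K h"
    and "generator_choice s K \<alpha>"
  shows
    "(\<forall>m::int. m \<noteq> 0 \<and> coprime m 6 \<longrightarrow>
        h ` norm_tuples s K m =
          {at_pos s h 0 (of_int m)} +
          (\<Sum>q\<in>prime_factors (nat \<bar>m\<bar>). reach s K h \<alpha> q (multiplicity q (nat \<bar>m\<bar>)))) \<and>
     (\<forall>w::nat.
        (\<forall>q::nat. Factorial_Ring.prime q \<and> q > 3 \<longrightarrow> (\<forall>p\<in>places s K q. cost K q p \<le> w)) \<longrightarrow>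
        (\<forall>(q::nat) e. Factorial_Ring.prime q \<and> q > 3 \<longrightarrow>
           reach s K h \<alpha> q e = reach s K h \<alpha> q (min e (w * (CARD('h) - 1))))) \<and>
     (\<forall>\<beta>. generator_choice s K \<beta> \<longrightarrow>
        (\<forall>(q::nat) e. Factorial_Ring.prime q \<and> q > 3 \<longrightarrow>
           reach s K h \<beta> q e = reach s K h \<alpha> q e)) \<and>
     (\<forall>m::int. m \<noteq> 0 \<and> coprime m 6 \<longrightarrow>
        (\<forall>L. (\<forall>q\<in>prime_factors (nat \<bar>m\<bar>). L q \<in> place_seqs s K q (multiplicity q (nat \<bar>m\<bar>))) \<longrightarrow>
           built_tuple s K \<alpha> m L \<in> norm_tuples s K m \<and>
           h (built_tuple s K \<alpha> m L) =
             at_pos s h 0 (of_int m) +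
             (\<Sum>q\<in>prime_factors (nat \<bar>m\<bar>). \<Sum>p\<leftarrow>L q. move s K h \<alpha> q p)) \<and>
        (\<forall>x \<in> {at_pos s h 0 (of_int m)} +
            (\<Sum>q\<in>prime_factors (nat \<bar>m\<bar>). reach s K h \<alpha> q (multiplicity q (nat \<bar>m\<bar>))).
           \<exists>L. (\<forall>q\<in>prime_factors (nat \<bar>m\<bar>). L q \<in> place_seqs s K q (multiplicity q (nat \<bar>m\<bar>))) \<and>
             h (built_tuple s K \<alpha> m L) = x))"
proof -
  interpret tuple_setup s K h \<alpha> using assms by unfold_locales
  show ?thesis
  proof (intro conjI allI impI)
    fix m :: int assume "m \<noteq> 0 \<and> coprime m 6"
    hence m: "m \<noteq> 0" "coprime m 6" by auto
    show "h ` norm_tuples s K m = {at_pos s h 0 (of_int m)} +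
        (\<Sum>q\<in>prime_factors (nat \<bar>m\<bar>). reach s K h \<alpha> q (multiplicity q (nat \<bar>m\<bar>)))"
      unfolding sumset_eq[OF m] image_norm_tuples[OF m] ..
  next
    fix w q :: nat and e
    assume "\<forall>q::nat. Factorial_Ring.prime q \<and> q > 3 \<longrightarrow> (\<forall>p\<in>places s K q. cost K q p \<le> w)"
      "Factorial_Ring.prime q \<and> q > 3"
    thus "reach s K h \<alpha> q e = reach s K h \<alpha> q (min e (w * (CARD('h) - 1)))"
      by (intro reach_truncate) blast
  next
    fix \<beta> and q :: nat and e
    assume "generator_choice s K \<beta>" "Factorial_Ring.prime q \<and> q > 3"
    thus "reach s K h \<beta> q e = reach s K h \<alpha> q e" using reach_generator_choice by blast
  next
    fix m :: int and L
    assume "m \<noteq> 0 \<and> coprime m 6"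
    hence m: "m \<noteq> 0" "coprime m 6" by auto
    assume "\<forall>q\<in>prime_factors (nat \<bar>m\<bar>). L q \<in> place_seqs s K q (multiplicity q (nat \<bar>m\<bar>))"
    hence "placed m L" "spent m L dvd m"
      using admissible_iff[OF m] unfolding admissible_def[OF m] by blast+
    from built_props[OF m this]
    show "built_tuple s K \<alpha> m L \<in> norm_tuples s K m"
      "h (built_tuple s K \<alpha> m L) = at_pos s h 0 (of_int m) +
        (\<Sum>q\<in>prime_factors (nat \<bar>m\<bar>). \<Sum>p\<leftarrow>L q. move s K h \<alpha> q p)" by blast+
  next
    fix m :: int assume "m \<noteq> 0 \<and> coprime m 6"
    hence m: "m \<noteq> 0" "coprime m 6" by auto
    show "\<forall>x \<in> {at_pos s h 0 (of_int m)} +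
        (\<Sum>q\<in>prime_factors (nat \<bar>m\<bar>). reach s K h \<alpha> q (multiplicity q (nat \<bar>m\<bar>))).
      \<exists>L. (\<forall>q\<in>prime_factors (nat \<bar>m\<bar>). L q \<in> place_seqs s K q (multiplicity q (nat \<bar>m\<bar>))) \<and>
        h (built_tuple s K \<alpha> m L) = x"
      unfolding sumset_eq[OF m]
    proof safe
      fix L assume L: "admissible m L"
      hence "placed m L" "spent m L dvd m" using admissible_iff[OF m] by blast+
      from built_props(3)[OF m this] L
      show "\<exists>L'. (\<forall>q\<in>prime_factors (nat \<bar>m\<bar>). L' q \<in> place_seqs s K q (multiplicity q (nat \<bar>m\<bar>))) \<and>
          h (built_tuple s K \<alpha> m L') =
            at_pos s h 0 (of_int m) + (\<Sum>q\<in>prime_factors (nat \<bar>m\<bar>). \<Sum>p\<leftarrow>L q. move s K h \<alpha> q p)"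
        unfolding admissible_def[OF m] by blast
    qed
  qed
qed

end
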